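(* For each of the four transmission modes FD-NoSIC, HD-NoSIC, HD-SIC and FD-SIC described in the context, consider the joint channel and power allocation problem $$\max_{O,\,P_{n,1},\,P_{n,2},\,P_{u_i}}\ \sum_{i=1}^K\sum_{n=1}^D o(n,i)\,\mathcal{R}_{D2D}(n,i)$$ $$\text{s.t. }\ \sum_{i=1}^Ko(n,i)=1\ \ \forall n\in\{1,\dots,D\},\qquad \sum_{n=1}^Do(n,i)\le1\ \ \forall i\in\{1,\dots,K\},$$ where $o(n,i)\in\{0,1\}$ are the entries of the $D\times K$ matrix $O$ and $\mathcal{R}_{D2D}(n,i)$ is the maximum achievable D2D rate of pair $n$ when collocated with cellular user $u_i$, i.e. the solution of the power allocation problem of the couple $(n,i)$ in the considered mode. Then the global optimal solution of the joint problem is achieved by successively (1) solving the power allocation problem of every couple $(n,i)$ separately, which fills the $D\times K$ table $\mathcal{R}_{D2D}$, and (2) solving the channel assignment problem of maximizing $\sum_{n,i}o(n,i)\mathcal{R}_{D2D}(n,i)$, with this table fixed, over the matrices $O$ satisfying the two constraints above. Since each power allocation problem is solved analytically in constant time, step (1) has complexity $O(KD)$. Step (2) is solved by the Kuhn–Munkres (Hungarian) algorithm, applied to the minimization of the opposite objective, with complexity $O(D^2K)$, which dominates the global complexity.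
   Context: There are $D$ device-to-device (D2D) pairs and $K$ cellular users (CUs) $u_1,\dots,u_K$ which are allocated orthogonal uplink channels of bandwidth $B$ and are served by a base station $b$. $o(n,i)=1$ if pair $n$ is collocated on the channel of $u_i$, and $0$ otherwise. Because the channels are orthogonal, the performance of a D2D–CU couple is independent of the activity on the other channels. Fix a couple $(n,i)$ and drop its indices: the devices are $d_1,d_2$ with powers $P_1,P_2$, the CU is $u$ with power $P_u$. The gains of the links $d_1$–$d_2$, $u$–$b$, $d_j$–$b$, $u$–$d_j$ are $h_d,h_{b,u},h_{b,d_j},h_{d_j,u}$; $\eta_j$ is the self-interference cancellation factor of $d_j$ and $\sigma^2$ the noise power. In every mode the power allocation problem maximizes the D2D rate $R_{D2D}$ over the powers subject to $R_u\ge R_{u,min}$ (target rate of $u$), $P_u\le P_{u,M}$, $P_1\le P_{1,M}$, $P_2\le P_{2,M}$. Let $P_{u,m}=(2^{R_{u,min}/B}-1)\sigma^2/h_{b,u}$. FD-NoSIC (full duplex, no interference cancellation): $R_u=B\log_2\big(1+\frac{P_uh_{b,u}}{P_1h_{b,d_1}+P_2h_{b,d_2}+\sigma^2}\big)$ and $R_{D2D}=B\log_2\big(1+\frac{P_2h_d}{P_uh_{d_1,u}+\eta_1P_1+\sigma^2}\big)+B\log_2\big(1+\frac{P_1h_d}{P_uh_{d_2,u}+\eta_2P_2+\sigma^2}\big)$. HD-NoSIC (half duplex, no cancellation): the slot has two halves, optimized separately. In the first only $d_1$ and $u$ transmit, with $R_{d_2}=B\log_2\big(1+\frac{P_1h_d}{P_uh_{d_2,u}+\sigma^2}\big)$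 and the rate of $u$ equal to $B\log_2\big(1+\frac{P_uh_{b,u}}{P_1h_{b,d_1}+\sigma^2}\big)$, required to be $\ge R_{u,min}$; the second is the same with $d_1,d_2$ exchanged. $R_{D2D}=\frac12R_{d_1}+\frac12R_{d_2}$. HD-SIC (half duplex with mutual successive interference cancellation): as HD-NoSIC, but in the first half $R_{d_2}=B\log_2(1+P_1h_d/\sigma^2)$, the rate of $u$ is $B\log_2(1+P_uh_{b,u}/\sigma^2)$, and the power multiplexing conditions $P_uh_{d_2,u}>P_1h_d$, $P_1h_{b,d_1}>P_uh_{b,u}$ are added; in the second half, with $d_1,d_2$ exchanged. In a half where the channel condition ($h_{b,d_1}h_{d_2,u}>h_dh_{b,u}$ for the first half, $h_{d_1,u}h_{b,d_2}>h_{b,u}h_d$ for the second) does not hold or no solution exists ($P_{u,m}>P_{u,M}$, or $P_{1,M}<P_{u,m}h_{b,u}/h_{b,d_1}$ for the first half, $P_{2,M}<P_{u,m}h_{b,u}/h_{b,d_2}$ for the second), HD-SIC reverts to the HD-NoSIC solution for that half. FD-SIC (full duplex with mutual cancellation): $R_u=B\log_2(1+P_uh_{b,u}/\sigma^2)$, $R_{D2D}=B\log_2\big(1+\frac{P_2h_d}{\eta_1P_1+\sigma^2}\big)+B\log_2\big(1+\frac{P_1h_d}{\eta_2P_2+\sigma^2}\big)$, with the added conditions $P_uh_{d_1,u}>P_2h_d+P_1\eta_1$, $P_uh_{d_2,u}>P_1h_d+P_2\eta_2$, and, depending on the order in which $b$ decodes the device messages, either (order 1) $P_2h_{b,d_2}>P_1h_{b,d_1}+P_uh_{b,u}$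 and $P_1h_{b,d_1}>P_uh_{b,u}$, or (order 2) $P_1h_{b,d_1}>P_2h_{b,d_2}+P_uh_{b,u}$ and $P_2h_{b,d_2}>P_uh_{b,u}$. Order 1 is possible when $h_{b,d_1}h_{d_1,u}-\eta_1h_{b,u}>2h_{b,u}h_dh_{b,d_1}/h_{b,d_2}$, $h_{b,d_1}h_{d_2,u}-h_{b,u}h_d>2h_{b,u}\eta_2h_{b,d_1}/h_{b,d_2}$, $P_{u,m}h_{b,u}/h_{b,d_1}<P_{1,M}$ and $2P_{u,m}h_{b,u}/h_{b,d_2}<P_{2,M}$. Order 2 is possible when $h_{d_1,u}h_{b,d_2}-h_dh_{b,u}>2\eta_1h_{b,u}h_{b,d_2}/h_{b,d_1}$, $h_{d_2,u}h_{b,d_2}-\eta_2h_{b,u}>2h_{b,u}h_dh_{b,d_2}/h_{b,d_1}$, $2P_{u,m}h_{b,u}/h_{b,d_1}<P_{1,M}$ and $P_{u,m}h_{b,u}/h_{b,d_2}<P_{2,M}$. If both orders are possible, the table entry is the higher of the two rates; if neither is possible, the entry is that of FD-NoSIC. *)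

theory Defs
  imports "HOL-Analysis.Analysis" "HOL-Library.While_Combinator" "HOL-Library.Monad_Syntax"
begin

section \<open>The power allocation problem of a couple\<close>

record couple =
  bw :: real  noise :: real  h_d :: real  h_bu :: real
  h_bd1 :: real  h_bd2 :: real  h_d1u :: real  h_d2u :: real
  eta1 :: real  eta2 :: real
  P1_max :: real  P2_max :: real  Pu_max :: real  Ru_min :: real

text \<open>Perfect self-interference cancellation and a zero target rate are allowed.\<close>

definition valid_couple :: "couple \<Rightarrow> bool" where
  "valid_couple c \<longleftrightarrow> bw c > 0 \<and> noise c > 0 \<and> h_d c > 0 \<and> h_bu c > 0 \<and>
     h_bd1 c > 0 \<and> h_bd2 c > 0 \<and> h_d1u c > 0 \<and> h_d2u c > 0 \<and> eta1 c \<ge> 0 \<and> eta2 c \<ge> 0 \<and>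
     P1_max c > 0 \<and> P2_max c > 0 \<and> Pu_max c > 0 \<and> Ru_min c \<ge> 0"

definition swap_devices :: "couple \<Rightarrow> couple" where
  "swap_devices c = c\<lparr>h_bd1 := h_bd2 c, h_bd2 := h_bd1 c, h_d1u := h_d2u c, h_d2u := h_d1u c,
     eta1 := eta2 c, eta2 := eta1 c, P1_max := P2_max c, P2_max := P1_max c\<rparr>"

definition shannon :: "couple \<Rightarrow> real \<Rightarrow> real" where
  "shannon c sinr = bw c * log 2 (1 + sinr)"

definition Pu_m :: "couple \<Rightarrow> real" where
  "Pu_m c = (2 powr (Ru_min c / bw c) - 1) * noise c / h_bu c"

text \<open>A power allocation is \<open>((P1, P2), (Pu, Pu'))\<close>: the powers of the two devices, and the power of
  the cellular user in the first and in the second half of the slot. In the half-duplex modes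
  \<open>d1\<close> transmits in the first half and \<open>d2\<close> in the second one; in the full-duplex modes
  the two powers of the cellular user coincide.\<close>

type_synonym powers = "(real \<times> real) \<times> (real \<times> real)"

text \<open>The optimal value is a supremum: it is \<open>-\<infinity>\<close> for an infeasible problem, and the strict
  multiplexing conditions of the SIC modes can prevent it from being attained.\<close>

definition opt_value :: "'p set \<Rightarrow> ('p \<Rightarrow> real) \<Rightarrow> ereal" where
  "opt_value F r = (SUP p\<in>F. ereal (r p))"

subsection \<open>Full duplex\<close>

definition fd_box :: "couple \<Rightarrow> powers set" where
  "fd_box c = {((P1, P2), (Pu, Pu')). Pu' = Pu \<and>
     0 \<le> P1 \<and> P1 \<le> P1_max c \<and> 0 \<le> P2 \<and> P2 \<le> P2_max c \<and> 0 \<le> Pu \<and> Pu \<le> Pu_max c}"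

definition fd_nosic_set :: "couple \<Rightarrow> powers set" where
  "fd_nosic_set c = {((P1, P2), (Pu, Pu')). ((P1, P2), (Pu, Pu')) \<in> fd_box c \<and>
     shannon c (Pu * h_bu c / (P1 * h_bd1 c + P2 * h_bd2 c + noise c)) \<ge> Ru_min c}"

fun fd_nosic_rate :: "couple \<Rightarrow> powers \<Rightarrow> real" where
  "fd_nosic_rate c ((P1, P2), (Pu, Pu')) =
     shannon c (P2 * h_d c / (Pu * h_d1u c + eta1 c * P1 + noise c)) +
     shannon c (P1 * h_d c / (Pu * h_d2u c + eta2 c * P2 + noise c))"

definition fd_sic_common :: "couple \<Rightarrow> powers set" where
  "fd_sic_common c = {((P1, P2), (Pu, Pu')). ((P1, P2), (Pu, Pu')) \<in> fd_box c \<and>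
     shannon c (Pu * h_bu c / noise c) \<ge> Ru_min c \<and>
     Pu * h_d1u c > P2 * h_d c + P1 * eta1 c \<and>
     Pu * h_d2u c > P1 * h_d c + P2 * eta2 c}"

definition fd_sic_set1 :: "couple \<Rightarrow> powers set" where
  "fd_sic_set1 c = {((P1, P2), (Pu, Pu')). ((P1, P2), (Pu, Pu')) \<in> fd_sic_common c \<and>
     P2 * h_bd2 c > P1 * h_bd1 c + Pu * h_bu c \<and> P1 * h_bd1 c > Pu * h_bu c}"

definition fd_sic_set2 :: "couple \<Rightarrow> powers set" where
  "fd_sic_set2 c = {((P1, P2), (Pu, Pu')). ((P1, P2), (Pu, Pu')) \<in> fd_sic_common c \<and>
     P1 * h_bd1 c > P2 * h_bd2 c + Pu * h_bu c \<and> P2 * h_bd2 c > Pu * h_bu c}"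

fun fd_sic_rate :: "couple \<Rightarrow> powers \<Rightarrow> real" where
  "fd_sic_rate c ((P1, P2), (Pu, Pu')) =
     shannon c (P2 * h_d c / (eta1 c * P1 + noise c)) +
     shannon c (P1 * h_d c / (eta2 c * P2 + noise c))"

definition order1_possible :: "couple \<Rightarrow> bool" where
  "order1_possible c \<longleftrightarrow>
     h_bd1 c * h_d1u c - eta1 c * h_bu c > 2 * h_bu c * h_d c * h_bd1 c / h_bd2 c \<and>
     h_bd1 c * h_d2u c - h_bu c * h_d c > 2 * h_bu c * eta2 c * h_bd1 c / h_bd2 c \<and>
     Pu_m c * h_bu c / h_bd1 c < P1_max c \<and>
     2 * Pu_m c * h_bu c / h_bd2 c < P2_max c"

definition order2_possible :: "couple \<Rightarrow> bool" where
  "order2_possible c \<longleftrightarrow>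
     h_d1u c * h_bd2 c - h_d c * h_bu c > 2 * eta1 c * h_bu c * h_bd2 c / h_bd1 c \<and>
     h_d2u c * h_bd2 c - eta2 c * h_bu c > 2 * h_bu c * h_d c * h_bd2 c / h_bd1 c \<and>
     2 * Pu_m c * h_bu c / h_bd1 c < P1_max c \<and>
     Pu_m c * h_bu c / h_bd2 c < P2_max c"

subsection \<open>Half duplex\<close>

text \<open>The problems of the first half, in the variables \<open>(P1, Pu)\<close>; those of the second half
  are obtained with \<open>swap_devices\<close>.\<close>

definition half_nosic_set :: "couple \<Rightarrow> (real \<times> real) set" where
  "half_nosic_set c = {(P1, Pu). 0 \<le> P1 \<and> P1 \<le> P1_max c \<and> 0 \<le> Pu \<and> Pu \<le> Pu_max c \<and>
     shannon c (Pu * h_bu c / (P1 * h_bd1 c + noise c)) \<ge> Ru_min c}"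

definition half_sic_set :: "couple \<Rightarrow> (real \<times> real) set" where
  "half_sic_set c = {(P1, Pu). 0 \<le> P1 \<and> P1 \<le> P1_max c \<and> 0 \<le> Pu \<and> Pu \<le> Pu_max c \<and>
     shannon c (Pu * h_bu c / noise c) \<ge> Ru_min c \<and>
     Pu * h_d2u c > P1 * h_d c \<and> P1 * h_bd1 c > Pu * h_bu c}"

text \<open>The last conjunct only matters when \<open>P1_max = Pu_m * h_bu / h_bd1\<close>: the listed
  inequalities do not exclude this case, but the strict multiplexing conditions have no solution
  there.\<close>

definition half_uses_sic :: "couple \<Rightarrow> bool" where
  "half_uses_sic c \<longleftrightarrow> h_bd1 c * h_d2u c > h_d c * h_bu c \<and>
     \<not> Pu_m c > Pu_max c \<and> \<not> P1_max c < Pu_m c * h_bu c / h_bd1 c \<and> half_sic_set c \<noteq> {}"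

definition half_set :: "bool \<Rightarrow> couple \<Rightarrow> (real \<times> real) set" where
  "half_set sic c = (if sic \<and> half_uses_sic c then half_sic_set c else half_nosic_set c)"

fun half_rate :: "bool \<Rightarrow> couple \<Rightarrow> real \<times> real \<Rightarrow> real" where
  "half_rate sic c (P1, Pu) =
     (if sic \<and> half_uses_sic c then shannon c (P1 * h_d c / noise c)
      else shannon c (P1 * h_d c / (Pu * h_d2u c + noise c)))"

definition hd_value :: "bool \<Rightarrow> couple \<Rightarrow> ereal" where
  "hd_value sic c =
     ereal (1/2) * opt_value (half_set sic (swap_devices c)) (half_rate sic (swap_devices c)) +
     ereal (1/2) * opt_value (half_set sic c) (half_rate sic c)"

subsection \<open>The four modes\<close>

datatype mode = FD_NoSIC | HD_NoSIC | HD_SIC | FD_SIC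

text \<open>The maximum achievable rate of a couple, that is, its entry in the table.\<close>

fun max_rate :: "mode \<Rightarrow> couple \<Rightarrow> ereal" where
  "max_rate FD_NoSIC c = opt_value (fd_nosic_set c) (fd_nosic_rate c)"
| "max_rate HD_NoSIC c = hd_value False c"
| "max_rate HD_SIC c = hd_value True c"
| "max_rate FD_SIC c =
     (if order1_possible c \<and> order2_possible c
      then max (opt_value (fd_sic_set1 c) (fd_sic_rate c)) (opt_value (fd_sic_set2 c) (fd_sic_rate c))
      else if order1_possible c then opt_value (fd_sic_set1 c) (fd_sic_rate c)
      else if order2_possible c then opt_value (fd_sic_set2 c) (fd_sic_rate c)
      else opt_value (fd_nosic_set c) (fd_nosic_rate c))"

text \<open>The power allocations that a mode admits on a couple, and the rate that they give; these are
  the powers that the joint problem ranges over.\<close>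

definition hd_powers :: "bool \<Rightarrow> couple \<Rightarrow> powers set" where
  "hd_powers sic c = {((P1, P2), (Pu, Pu')).
     (P1, Pu) \<in> half_set sic c \<and> (P2, Pu') \<in> half_set sic (swap_devices c)}"

fun hd_rate :: "bool \<Rightarrow> couple \<Rightarrow> powers \<Rightarrow> real" where
  "hd_rate sic c ((P1, P2), (Pu, Pu')) =
     1/2 * half_rate sic (swap_devices c) (P2, Pu') + 1/2 * half_rate sic c (P1, Pu)"

fun feasible_powers :: "mode \<Rightarrow> couple \<Rightarrow> powers set" where
  "feasible_powers FD_NoSIC c = fd_nosic_set c"
| "feasible_powers HD_NoSIC c = hd_powers False c"
| "feasible_powers HD_SIC c = hd_powers True c"
| "feasible_powers FD_SIC c =
     (if order1_possible c \<or> order2_possible c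
      then (if order1_possible c then fd_sic_set1 c else {}) \<union>
           (if order2_possible c then fd_sic_set2 c else {})
      else fd_nosic_set c)"

fun d2d_rate :: "mode \<Rightarrow> couple \<Rightarrow> powers \<Rightarrow> real" where
  "d2d_rate FD_NoSIC c p = fd_nosic_rate c p"
| "d2d_rate HD_NoSIC c p = hd_rate False c p"
| "d2d_rate HD_SIC c p = hd_rate True c p"
| "d2d_rate FD_SIC c p =
     (if order1_possible c \<or> order2_possible c then fd_sic_rate c p else fd_nosic_rate c p)"

section \<open>The joint problem and the channel assignment problem\<close>

text \<open>Pairs are indexed by \<open>n \<in> {1..D}\<close>, cellular users and their channels by
  \<open>i \<in> {1..K}\<close>. The gains of the links from a D2D device may depend on the channel.\<close>

record network =
  net_bw :: real
  net_noise :: real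
  net_hd :: "nat \<Rightarrow> nat \<Rightarrow> real"
  net_hbu :: "nat \<Rightarrow> real"
  net_hbd1 :: "nat \<Rightarrow> nat \<Rightarrow> real"
  net_hbd2 :: "nat \<Rightarrow> nat \<Rightarrow> real"
  net_hd1u :: "nat \<Rightarrow> nat \<Rightarrow> real"
  net_hd2u :: "nat \<Rightarrow> nat \<Rightarrow> real"
  net_eta1 :: "nat \<Rightarrow> real"
  net_eta2 :: "nat \<Rightarrow> real"
  net_P1_max :: "nat \<Rightarrow> real"
  net_P2_max :: "nat \<Rightarrow> real"
  net_Pu_max :: "nat \<Rightarrow> real"
  net_Ru_min :: "nat \<Rightarrow> real"

definition couple_of :: "network \<Rightarrow> nat \<Rightarrow> nat \<Rightarrow> couple" where
  "couple_of N n i = \<lparr>bw = net_bw N, noise = net_noise N, h_d = net_hd N n i, h_bu = net_hbu N i,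
     h_bd1 = net_hbd1 N n i, h_bd2 = net_hbd2 N n i, h_d1u = net_hd1u N n i, h_d2u = net_hd2u N n i,
     eta1 = net_eta1 N n, eta2 = net_eta2 N n,
     P1_max = net_P1_max N n, P2_max = net_P2_max N n,
     Pu_max = net_Pu_max N i, Ru_min = net_Ru_min N i\<rparr>"

definition valid_network :: "network \<Rightarrow> nat \<Rightarrow> nat \<Rightarrow> bool" where
  "valid_network N D K \<longleftrightarrow> (\<forall>n\<in>{1..D}. \<forall>i\<in>{1..K}. valid_couple (couple_of N n i))"

definition assignments :: "nat \<Rightarrow> nat \<Rightarrow> (nat \<Rightarrow> nat \<Rightarrow> nat) set" where
  "assignments D K = {A. (\<forall>n\<in>{1..D}. \<forall>i\<in>{1..K}. A n i \<in> {0, 1}) \<and>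
     (\<forall>n\<in>{1..D}. (\<Sum>i=1..K. A n i) = 1) \<and> (\<forall>i\<in>{1..K}. (\<Sum>n=1..D. A n i) \<le> 1)}"

text \<open>An infeasible couple, with entry \<open>-\<infinity>\<close>, only matters when it is selected:
  \<open>0 * -\<infinity> = 0\<close> in \<open>ereal\<close>.\<close>

definition assignment_rate ::
  "nat \<Rightarrow> nat \<Rightarrow> (nat \<Rightarrow> nat \<Rightarrow> ereal) \<Rightarrow> (nat \<Rightarrow> nat \<Rightarrow> nat) \<Rightarrow> ereal" where
  "assignment_rate D K R A = (\<Sum>i=1..K. \<Sum>n=1..D. ereal (real (A n i)) * R n i)"

text \<open>The variables of the joint problem: the matrix, the powers \<open>(P1, P2)\<close> of every pair and the
  powers \<open>(Pu, Pu')\<close> of every cellular user. Only collocated couples constrain the powers.\<close>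

type_synonym joint_alloc =
  "(nat \<Rightarrow> nat \<Rightarrow> nat) \<times> (nat \<Rightarrow> real \<times> real) \<times> (nat \<Rightarrow> real \<times> real)"

definition joint_feasible :: "mode \<Rightarrow> network \<Rightarrow> nat \<Rightarrow> nat \<Rightarrow> joint_alloc set" where
  "joint_feasible m N D K = {(A, PD, PU). A \<in> assignments D K \<and>
     (\<forall>n\<in>{1..D}. \<forall>i\<in>{1..K}. A n i = 1 \<longrightarrow> (PD n, PU i) \<in> feasible_powers m (couple_of N n i))}"

fun joint_rate :: "mode \<Rightarrow> network \<Rightarrow> nat \<Rightarrow> nat \<Rightarrow> joint_alloc \<Rightarrow> real" where
  "joint_rate m N D K (A, PD, PU) =
     (\<Sum>i=1..K. \<Sum>n=1..D. real (A n i) * d2d_rate m (couple_of N n i) (PD n, PU i))"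

abbreviation joint_optimal :: "mode \<Rightarrow> network \<Rightarrow> nat \<Rightarrow> nat \<Rightarrow> joint_alloc \<Rightarrow> bool" where
  "joint_optimal m N D K \<equiv> is_arg_max (joint_rate m N D K) (\<lambda>x. x \<in> joint_feasible m N D K)"

abbreviation assignment_optimal ::
  "nat \<Rightarrow> nat \<Rightarrow> (nat \<Rightarrow> nat \<Rightarrow> ereal) \<Rightarrow> (nat \<Rightarrow> nat \<Rightarrow> nat) \<Rightarrow> bool" where
  "assignment_optimal D K R \<equiv> is_arg_max (assignment_rate D K R) (\<lambda>A. A \<in> assignments D K)"

section \<open>Cost model\<close>

text \<open>Real RAM: one time unit pays for a bounded number of elementary operations on numbers and of
  accesses to array cells (arrays are functions on indices). Every iteration of a loop and every
  operation of a closed-form expression is charged.\<close>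

datatype 'a timed = Timed (val: 'a) (cost: nat)

definition ret :: "'a \<Rightarrow> 'a timed" where
  "ret x = Timed x 0"

definition tick :: "'a timed \<Rightarrow> 'a timed" where
  "tick r = Timed (val r) (Suc (cost r))"

definition bind_timed :: "'a timed \<Rightarrow> ('a \<Rightarrow> 'b timed) \<Rightarrow> 'b timed" where
  "bind_timed r f = Timed (val (f (val r))) (cost r + cost (f (val r)))"

adhoc_overloading Monad_Syntax.bind \<rightleftharpoons> bind_timed

primrec for_loop :: "'b list \<Rightarrow> ('b \<Rightarrow> 'a \<Rightarrow> 'a timed) \<Rightarrow> 'a \<Rightarrow> 'a timed" where
  "for_loop [] f s = ret s"
| "for_loop (x # xs) f s = tick (do { s' \<leftarrow> f x s; for_loop xs f s' })"

definition while_loop :: "('a \<Rightarrow> bool) \<Rightarrow> ('a \<Rightarrow> 'a timed) \<Rightarrow> 'a \<Rightarrow> 'a timed" where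
  "while_loop b f s = while (\<lambda>r. b (val r)) (\<lambda>r. tick (do { s' \<leftarrow> r; f s' })) (ret s)"

section \<open>Step 1: analytic solutions and the table\<close>

text \<open>Closed-form expressions with case distinctions in the parameters of a couple.\<close>

datatype param = Bw | Noise | Hd | Hbu | Hbd1 | Hbd2 | Hd1u | Hd2u | Eta1 | Eta2
  | P1Max | P2Max | PuMax | RuMin

fun param_value :: "couple \<Rightarrow> param \<Rightarrow> real" where
  "param_value c Bw = bw c"
| "param_value c Noise = noise c"
| "param_value c Hd = h_d c"
| "param_value c Hbu = h_bu c"
| "param_value c Hbd1 = h_bd1 c"
| "param_value c Hbd2 = h_bd2 c"
| "param_value c Hd1u = h_d1u c"
| "param_value c Hd2u = h_d2u c"
| "param_value c Eta1 = eta1 c"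
| "param_value c Eta2 = eta2 c"
| "param_value c P1Max = P1_max c"
| "param_value c P2Max = P2_max c"
| "param_value c PuMax = Pu_max c"
| "param_value c RuMin = Ru_min c"

datatype closed_form = Param param | Num int
  | Plus closed_form closed_form | Minus closed_form closed_form
  | Times closed_form closed_form | Divide closed_form closed_form
  | Sqrt closed_form | Log2 closed_form | Exp2 closed_form
  | IfLe closed_form closed_form closed_form closed_form

primrec eval_cf :: "closed_form \<Rightarrow> couple \<Rightarrow> real timed" where
  "eval_cf (Param a) c = tick (ret (param_value c a))"
| "eval_cf (Num k) c = tick (ret (of_int k))"
| "eval_cf (Plus e f) c = tick (do { x \<leftarrow> eval_cf e c; y \<leftarrow> eval_cf f c; ret (x + y) })"
| "eval_cf (Minus e f) c = tick (do { x \<leftarrow> eval_cf e c; y \<leftarrow> eval_cf f c; ret (x - y) })"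
| "eval_cf (Times e f) c = tick (do { x \<leftarrow> eval_cf e c; y \<leftarrow> eval_cf f c; ret (x * y) })"
| "eval_cf (Divide e f) c = tick (do { x \<leftarrow> eval_cf e c; y \<leftarrow> eval_cf f c; ret (x / y) })"
| "eval_cf (Sqrt e) c = tick (do { x \<leftarrow> eval_cf e c; ret (sqrt x) })"
| "eval_cf (Log2 e) c = tick (do { x \<leftarrow> eval_cf e c; ret (log 2 x) })"
| "eval_cf (Exp2 e) c = tick (do { x \<leftarrow> eval_cf e c; ret (2 powr x) })"
| "eval_cf (IfLe e f g h) c = tick (do { x \<leftarrow> eval_cf e c; y \<leftarrow> eval_cf f c;
     (if x \<le> y then eval_cf g c else eval_cf h c) })"

text \<open>The couple is declared infeasible if \<open>sol_margin\<close> is negative.\<close>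

record solver =
  sol_margin :: closed_form
  sol_rate :: closed_form
  sol_P1 :: closed_form
  sol_P2 :: closed_form
  sol_Pu :: closed_form
  sol_Pu' :: closed_form

definition solve :: "solver \<Rightarrow> couple \<Rightarrow> (real \<times> powers) option timed" where
  "solve S c = do {
     g \<leftarrow> eval_cf (sol_margin S) c;
     (if g < 0 then ret None else do {
       r \<leftarrow> eval_cf (sol_rate S) c;
       P1 \<leftarrow> eval_cf (sol_P1 S) c;
       P2 \<leftarrow> eval_cf (sol_P2 S) c;
       Pu \<leftarrow> eval_cf (sol_Pu S) c;
       Pu' \<leftarrow> eval_cf (sol_Pu' S) c;
       ret (Some (r, ((P1, P2), (Pu, Pu')))) }) }"

text \<open>The returned powers give the maximum achievable rate. They are feasible whenever some feasible
  powers attain this rate; otherwise they are a limit of feasible powers.\<close>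

definition is_solution :: "mode \<Rightarrow> couple \<Rightarrow> (real \<times> powers) option \<Rightarrow> bool" where
  "is_solution m c s = (case s of
     None \<Rightarrow> feasible_powers m c = {} \<and> max_rate m c = -\<infinity>
   | Some (r, p) \<Rightarrow> max_rate m c = ereal r \<and>
       p \<in> closure (feasible_powers m c) \<and> d2d_rate m c p = r \<and>
       ((\<exists>q\<in>feasible_powers m c. d2d_rate m c q = r) \<longrightarrow> p \<in> feasible_powers m c))"

type_synonym table = "nat \<Rightarrow> nat \<Rightarrow> ereal \<times> powers"

definition fill_table :: "solver \<Rightarrow> network \<Rightarrow> nat \<Rightarrow> nat \<Rightarrow> table timed" where
  "fill_table S N D K =
     for_loop [1..<D+1] (\<lambda>n. for_loop [1..<K+1] (\<lambda>i T. do {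
       s \<leftarrow> solve S (couple_of N n i);
       (let e = (case s of None \<Rightarrow> (-\<infinity>, ((0, 0), (0, 0))) | Some (r, p) \<Rightarrow> (ereal r, p))
        in ret (T(n := (T n)(i := e)))) }))
     (\<lambda>n i. (-\<infinity>, ((0, 0), (0, 0))))"

section \<open>Step 2: the Kuhn--Munkres algorithm\<close>

text \<open>Shortest-augmenting-path form, for a \<open>D\<close> by \<open>K\<close> matrix \<open>a\<close> of costs to be
  minimized; a cost \<open>\<infinity>\<close> forbids a couple. Row potentials \<open>pot_r\<close>, column potentials
  \<open>pot_c\<close>, \<open>mate j\<close> is the row matched with column \<open>j\<close> (0 if none). Column 0 is a
  fictitious column holding the row being inserted. \<open>slack j\<close> is the least reduced cost from a
  row of the alternating tree to column \<open>j\<close>, reached from column \<open>pred j\<close>.\<close>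

record hungarian_state =
  pot_r :: "nat \<Rightarrow> real"
  pot_c :: "nat \<Rightarrow> real"
  mate :: "nat \<Rightarrow> nat"
  pred :: "nat \<Rightarrow> nat"
  slack :: "nat \<Rightarrow> ereal"
  used :: "nat \<Rightarrow> bool"
  cur :: nat
  nxt :: nat
  delta :: ereal
  stuck :: bool

definition relax_column :: "(nat \<Rightarrow> nat \<Rightarrow> ereal) \<Rightarrow> nat \<Rightarrow> hungarian_state \<Rightarrow> hungarian_state" where
  "relax_column a j s =
     (if used s j then s else
      let i = mate s (cur s);
          r = a i j - ereal (pot_r s i + pot_c s j);
          s' = (if r < slack s j
                then s\<lparr>slack := (slack s)(j := r), pred := (pred s)(j := cur s)\<rparr> else s)
      in if slack s' j < delta s' then s'\<lparr>delta := slack s' j, nxt := j\<rparr> else s')"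

definition shift_column :: "nat \<Rightarrow> hungarian_state \<Rightarrow> hungarian_state" where
  "shift_column j s =
     (let d = real_of_ereal (delta s); i = mate s j in
      if used s j
      then s\<lparr>pot_r := (pot_r s)(i := pot_r s i + d), pot_c := (pot_c s)(j := pot_c s j - d)\<rparr>
      else s\<lparr>slack := (slack s)(j := slack s j - ereal d)\<rparr>)"

definition grow_tree :: "nat \<Rightarrow> (nat \<Rightarrow> nat \<Rightarrow> ereal) \<Rightarrow> hungarian_state \<Rightarrow> hungarian_state timed" where
  "grow_tree K a s = do {
     s1 \<leftarrow> for_loop [1..<K+1] (\<lambda>j s. ret (relax_column a j s))
             (s\<lparr>used := (used s)(cur s := True), delta := \<infinity>\<rparr>);
     (if delta s1 = \<infinity> then ret (s1\<lparr>stuck := True\<rparr>) else do {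
        s2 \<leftarrow> for_loop [0..<K+1] (\<lambda>j s. ret (shift_column j s)) s1;
        ret (s2\<lparr>cur := nxt s2\<rparr>) }) }"

definition augment :: "hungarian_state \<Rightarrow> hungarian_state timed" where
  "augment = while_loop (\<lambda>s. cur s \<noteq> 0) (\<lambda>s.
     let j = pred s (cur s) in ret (s\<lparr>mate := (mate s)(cur s := mate s j), cur := j\<rparr>))"

definition insert_row ::
  "nat \<Rightarrow> (nat \<Rightarrow> nat \<Rightarrow> ereal) \<Rightarrow> nat \<Rightarrow> hungarian_state \<Rightarrow> hungarian_state timed" where
  "insert_row K a i s =
     (if stuck s then ret s else do {
        s1 \<leftarrow> for_loop [0..<K+1]
                (\<lambda>j s. ret (s\<lparr>slack := (slack s)(j := \<infinity>), used := (used s)(j := False)\<rparr>))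
                (s\<lparr>mate := (mate s)(0 := i), cur := 0\<rparr>);
        s2 \<leftarrow> while_loop (\<lambda>s. \<not> stuck s \<and> mate s (cur s) \<noteq> 0) (grow_tree K a) s1;
        (if stuck s2 then ret s2 else augment s2) })"

text \<open>The result gives the row matched with every column, 0 for an unmatched column; it is
  \<open>None\<close> if the rows cannot all be matched at finite cost.\<close>

definition hungarian :: "nat \<Rightarrow> nat \<Rightarrow> (nat \<Rightarrow> nat \<Rightarrow> ereal) \<Rightarrow> (nat \<Rightarrow> nat) option timed" where
  "hungarian D K a = do {
     s0 \<leftarrow> ret \<lparr>pot_r = (\<lambda>_. 0), pot_c = (\<lambda>_. 0), mate = (\<lambda>_. 0), pred = (\<lambda>_. 0),
               slack = (\<lambda>_. \<infinity>), used = (\<lambda>_. False), cur = 0, nxt = 0, delta = \<infinity>, stuck = False\<rparr>;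
     s1 \<leftarrow> for_loop [0..<D+1] (\<lambda>n s. ret (s\<lparr>pot_r := (pot_r s)(n := 0)\<rparr>)) s0;
     s2 \<leftarrow> for_loop [0..<K+1]
             (\<lambda>j s. ret (s\<lparr>pot_c := (pot_c s)(j := 0), mate := (mate s)(j := 0)\<rparr>)) s1;
     s3 \<leftarrow> for_loop [1..<D+1] (insert_row K a) s2;
     ret (if stuck s3 then None else Some (mate s3)) }"

definition matrix_of :: "(nat \<Rightarrow> nat) \<Rightarrow> nat \<Rightarrow> nat \<Rightarrow> nat" where
  "matrix_of r n i = (if r i = n then 1 else 0)"

section \<open>The two-step procedure\<close>

definition select_powers ::
  "nat \<Rightarrow> table \<Rightarrow> (nat \<Rightarrow> nat) \<Rightarrow> ((nat \<Rightarrow> real \<times> real) \<times> (nat \<Rightarrow> real \<times> real)) timed" where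
  "select_powers K T r =
     for_loop [1..<K+1] (\<lambda>i (PD, PU). ret
       (if r i = 0 then (PD, PU)
        else (PD(r i := fst (snd (T (r i) i))), PU(i := snd (snd (T (r i) i))))))
     (\<lambda>_. (0, 0), \<lambda>_. (0, 0))"

definition two_step :: "solver \<Rightarrow> network \<Rightarrow> nat \<Rightarrow> nat \<Rightarrow> joint_alloc option timed" where
  "two_step S N D K = do {
     T \<leftarrow> fill_table S N D K;
     r \<leftarrow> hungarian D K (\<lambda>n i. - fst (T n i));
     (case r of None \<Rightarrow> ret None
      | Some r \<Rightarrow> do {
          (PD, PU) \<leftarrow> select_powers K T r;
          ret (Some (matrix_of r, PD, PU)) }) }"

end

theory Submission
  imports Defs
begin

text \<open>The joint problem separates because the powers of a D2D pair and of the cellular user whose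
  channel it reuses occur in one couple only: for a fixed matrix the supremum of the sum is the sum of
  the suprema.

  A couple is infeasible exactly if \<open>Pu_m > Pu_max\<close>. In full duplex, eliminating
  \<open>Pu\<close> leaves a polygon in the plane of \<open>(P1, P2)\<close>, on which
  \<open>1 + SINR\<close> of one device times that of the other is to be maximized. This product increases
  along rays, so that its maximum lies on an edge, and on a line it is a quotient of quadratic
  polynomials whose derivative has a quadratic numerator. Hence the maximum is found among the vertices
  and at most two points of every edge line, all given by closed forms. The half-duplex problems are
  monotone in the power of the device. The strict conditions of the SIC modes are relaxed to weak
  ones; the relaxed optimum is a limit of feasible powers.

  For the Kuhn--Munkres algorithm, the potentials stay dual feasible and tight on matched couples; the
  insertion of a row visits every matched column at most once, and either augments the matching or
  exhibits a set of rows with too few columns of finite cost.\<close>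

section \<open>The Kuhn--Munkres algorithm\<close>

text \<open>Two demands shape the development. First, one expression of couple-independent cost must
  solve all couples, so every case distinction, including the choice of the best candidate, has to
  be a closed form itself. The optimum is therefore sought in a list of fixed length whose members
  may be meaningless (parallel lines, negative discriminants) and are filtered by membership in the
  polygon.

  Second, under strict conditions the optimum need not be attained, yet the returned powers must be
  feasible whenever it is. The polygon may have several maximizers, only some of which come from
  strict solutions. Ties are broken towards these, and a strictly feasible maximizer has to be shown
  to belong to the list. It could be missed only on an edge along which the objective is constant;
  but a strict solution lies on no edges other than the power caps of the devices, and there the
  objective is not constant.

  Optimality of the matching is linear programming duality, with the potentials as dual
  variables.\<close>

lemma val_ret [simp]: "val (ret x) = x" and cost_ret [simp]: "cost (ret x) = 0"
  by (simp_all add: ret_def)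

lemma val_tick [simp]: "val (tick r) = val r" and cost_tick [simp]: "cost (tick r) = Suc (cost r)"
  by (simp_all add: tick_def)

lemma val_bind_timed [simp]: "val (bind_timed r f) = val (f (val r))"
  and cost_bind_timed [simp]: "cost (bind_timed r f) = cost r + cost (f (val r))"
  by (simp_all add: bind_timed_def)

lemma bind_timed_ret [simp]: "bind_timed (ret x) f = f x"
  by (simp add: ret_def bind_timed_def)

text \<open>\<open>I j\<close> describes the state before the iteration with index \<open>j\<close>,
  so \<open>I b\<close> holds at the exit. \<open>Suc C\<close> is the body plus the tick charged by
  the loop.\<close>

lemma for_loop_upt:
  assumes "a \<le> b" "I a s"
    and "\<And>j s. a \<le> j \<Longrightarrow> j < b \<Longrightarrow> I j s \<Longrightarrow> I (Suc j) (val (f j s)) \<and> cost (f j s) \<le> C"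
  shows "I b (val (for_loop [a..<b] f s)) \<and> cost (for_loop [a..<b] f s) \<le> (b - a) * Suc C"
  using assms
proof (induction "b - a" arbitrary: a s)
  case 0
  then show ?case by simp
next
  case (Suc k)
  then have ab: "a < b" by linarith
  have step: "I (Suc a) (val (f a s)) \<and> cost (f a s) \<le> C"
    using Suc.prems ab by blast
  have "I b (val (for_loop [Suc a..<b] f (val (f a s)))) \<and>
        cost (for_loop [Suc a..<b] f (val (f a s))) \<le> (b - Suc a) * Suc C"
    using Suc.hyps(2) ab step Suc.prems(3) by (intro Suc.hyps(1)) auto
  moreover have "(b - a) * Suc C = Suc C + (b - Suc a) * Suc C"
    using ab by (simp flip: Suc_diff_Suc)
  moreover have "for_loop [a..<b] f s = tick (bind_timed (f a s) (for_loop [Suc a..<b] f))"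
    using ab by (simp add: upt_conv_Cons)
  ultimately show ?case using step by simp
qed

text \<open>\<open>while\<close> carries no guarantee of termination; the counter of
  \<open>I\<close>, bounded by \<open>B\<close>, supplies it. Its value at the exit counts the
  iterations and thereby bounds the cost.\<close>

lemma while_loop_rule:
  assumes "I 0 s"
    and "\<And>k s. I k s \<Longrightarrow> k \<le> B"
    and "\<And>k s. I k s \<Longrightarrow> b s \<Longrightarrow> I (Suc k) (val (f s)) \<and> cost (f s) \<le> C"
  obtains k where "I k (val (while_loop b f s))" "\<not> b (val (while_loop b f s))"
    "cost (while_loop b f s) \<le> k * Suc C"
proof -
  define w where "w = while (\<lambda>r. b (val r)) (\<lambda>r. tick (bind_timed r f))"
  \<comment> \<open>The loop runs on timed states that accumulate the cost, so the induction needs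
    an arbitrary start whose cost already fits \<open>k\<close> iterations.\<close>
  have "\<exists>k'. I k' (val (w r)) \<and> \<not> b (val (w r)) \<and> cost (w r) \<le> k' * Suc C"
    if "I k (val r)" "cost r \<le> k * Suc C" for k r
    using that
  proof (induction "B - k" arbitrary: k r rule: less_induct)
    case less
    show ?case
    proof (cases "b (val r)")
      case True
      let ?r = "tick (bind_timed r f)"
      have w: "w r = w ?r"
        unfolding w_def by (subst while_unfold) (simp add: True)
      have step: "I (Suc k) (val (f (val r)))" "cost (f (val r)) \<le> C"
        using assms(3)[OF less.prems(1) True] by auto
      have "Suc k \<le> B" using assms(2)[OF step(1)] .
      then have "B - Suc k < B - k" by simp
      moreover have "cost ?r \<le> Suc k * Suc C"
        using step(2) less.prems(2) by simp
      ultimately show ?thesis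
        unfolding w using step(1) by (intro less.hyps[of "Suc k"]) simp_all
    next
      case False
      then have "w r = r" unfolding w_def by (subst while_unfold) simp
      then show ?thesis using False less.prems by auto
    qed
  qed
  from this[of 0 "ret s"] assms(1) that show thesis
    unfolding w_def while_loop_def by auto
qed

section \<open>Matchings, potentials and loop invariants\<close>

text \<open>0 encodes an unmatched column. The column set is a parameter because during an
  augmentation the fictitious column 0 counts as matched while another column is open.\<close>

definition matching :: "nat set \<Rightarrow> nat \<Rightarrow> (nat \<Rightarrow> nat) \<Rightarrow> bool" where
  "matching J n \<mu> \<longleftrightarrow> bij_betw \<mu> {j\<in>J. \<mu> j \<noteq> 0} {1..n}"

text \<open>The reduced cost of linear programming, in \<open>ereal\<close> so that a forbidden
  couple keeps the value \<infinity> under all real potentials.\<close>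

definition reduced :: "(nat \<Rightarrow> nat \<Rightarrow> ereal) \<Rightarrow> hungarian_state \<Rightarrow> nat \<Rightarrow> nat \<Rightarrow> ereal" where
  "reduced a s r j = a r j - ereal (pot_r s r + pot_c s j)"

definition feasible_row :: "nat \<Rightarrow> (nat \<Rightarrow> nat \<Rightarrow> ereal) \<Rightarrow> hungarian_state \<Rightarrow> nat \<Rightarrow> bool" where
  "feasible_row K a s r \<longleftrightarrow> (\<forall>j\<in>{1..K}. 0 \<le> reduced a s r j)"

text \<open>Column \<open>c\<close> is exempt: it is the one to be rematched during an augmentation.\<close>

definition comp_slack :: "nat \<Rightarrow> (nat \<Rightarrow> nat \<Rightarrow> ereal) \<Rightarrow> nat \<Rightarrow> hungarian_state \<Rightarrow> bool" where
  "comp_slack K a c s \<longleftrightarrow> (\<forall>j\<in>{1..K}. pot_c s j \<le> 0) \<and>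
     (\<forall>j\<in>{1..K} - {c}. if mate s j = 0 then pot_c s j = 0 else reduced a s (mate s j) j = 0)"

text \<open>The state between two insertions. The exempt column is 0, which is no real column, so
  complementary slackness holds everywhere.\<close>

definition opt_inv :: "nat \<Rightarrow> (nat \<Rightarrow> nat \<Rightarrow> ereal) \<Rightarrow> nat \<Rightarrow> hungarian_state \<Rightarrow> bool" where
  "opt_inv K a n s \<longleftrightarrow> \<not> stuck s \<and> matching {1..K} n (mate s) \<and> comp_slack K a 0 s \<and>
     (\<forall>r\<in>{1..n}. feasible_row K a s r)"

definition no_finite :: "nat \<Rightarrow> nat \<Rightarrow> (nat \<Rightarrow> nat \<Rightarrow> ereal) \<Rightarrow> bool" where
  "no_finite D K a \<longleftrightarrow>
     (\<forall>A\<in>assignments D K. \<exists>n\<in>{1..D}. \<exists>i\<in>{1..K}. A n i = 1 \<and> a n i = \<infinity>)"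

definition tree :: "nat \<Rightarrow> hungarian_state \<Rightarrow> nat set" where
  "tree K s = {j\<in>{0..K}. used s j}"

text \<open>A finite \<open>slack\<close> is thus the minimum over the rows of the tree, attained
  from \<open>pred\<close>; for the empty tree it must be \<infinity>.\<close>

definition slack_inv :: "nat \<Rightarrow> (nat \<Rightarrow> nat \<Rightarrow> ereal) \<Rightarrow> hungarian_state \<Rightarrow> bool" where
  "slack_inv K a s \<longleftrightarrow> (\<forall>j\<in>{1..K} - tree K s.
     (\<forall>j'\<in>tree K s. slack s j \<le> reduced a s (mate s j') j) \<and>
     (slack s j = \<infinity> \<or> (pred s j \<in> tree K s \<and> slack s j = reduced a s (mate s (pred s j)) j)))"

text \<open>The function \<open>rk\<close> numbers the columns in the order in which they enter the tree.\<close>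

definition rank_inv ::
  "nat \<Rightarrow> (nat \<Rightarrow> nat \<Rightarrow> ereal) \<Rightarrow> hungarian_state \<Rightarrow> (nat \<Rightarrow> nat) \<Rightarrow> bool" where
  "rank_inv K a s rk \<longleftrightarrow> (\<forall>j\<in>tree K s. rk j < rk (cur s)) \<and>
     (\<forall>j\<in>insert (cur s) (tree K s) - {0}. pred s j \<in> tree K s \<and> rk (pred s j) < rk j \<and>
        reduced a s (mate s (pred s j)) j = 0)"

text \<open>The new row \<open>Suc n\<close> enters with an arbitrary potential; it becomes dual feasible with the
  first shift, which may have a negative \<open>delta\<close>.\<close>

definition grow_inv ::
  "nat \<Rightarrow> (nat \<Rightarrow> nat \<Rightarrow> ereal) \<Rightarrow> nat \<Rightarrow> nat \<Rightarrow> hungarian_state \<Rightarrow> bool" where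
  "grow_inv K a n k s \<longleftrightarrow>
     \<not> stuck s \<and> mate s 0 = Suc n \<and> matching {1..K} n (mate s) \<and> comp_slack K a 0 s \<and>
     (\<forall>r\<in>{1..n}. feasible_row K a s r) \<and>
     card (tree K s) = k \<and> (\<forall>j\<in>tree K s. mate s j \<noteq> 0) \<and>
     cur s \<le> K \<and> cur s \<notin> tree K s \<and> (tree K s = {} \<longrightarrow> cur s = 0) \<and>
     (tree K s \<noteq> {} \<longrightarrow> 0 \<in> tree K s \<and> feasible_row K a s (Suc n)) \<and>
     slack_inv K a s \<and> (\<exists>rk. rank_inv K a s rk \<and> rk (cur s) = k)"

section \<open>The two inner loops of a growth step\<close>

text \<open>Each column is relaxed once and touches only its own \<open>slack\<close> and
  \<open>pred\<close>, so all comparisons can refer to the initial state \<open>s0\<close>.\<close>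

lemma relax_loop:
  fixes s0 K a
  defines "L \<equiv> for_loop [1..<K+1] (\<lambda>j s. ret (relax_column a j s)) s0"
  assumes delta: "delta s0 = \<infinity>"
  shows "\<exists>sl p d x. val L = s0\<lparr>slack := sl, pred := p, delta := d, nxt := x\<rparr> \<and>
    (\<forall>j. used s0 j \<longrightarrow> sl j = slack s0 j \<and> p j = pred s0 j) \<and>
    (\<forall>j\<in>{1..K}. \<not> used s0 j \<longrightarrow>
       (let r = reduced a s0 (mate s0 (cur s0)) j in
         (if r < slack s0 j then sl j = r \<and> p j = cur s0 else sl j = slack s0 j \<and> p j = pred s0 j)) \<and>
       d \<le> sl j) \<and>
    (d = \<infinity> \<or> (x \<in> {1..K} \<and> \<not> used s0 x \<and> d = sl x))" (is ?relaxed)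
    and "cost L \<le> K"
proof -
  \<comment> \<open>Columns from \<open>m\<close> on still carry their initial entries;
    \<open>d\<close> is a lower bound of the slacks relaxed so far, with \<open>x\<close> as its
    witness once it is finite.\<close>
  define I where "I = (\<lambda>m s. \<exists>sl p d x. s = s0\<lparr>slack := sl, pred := p, delta := d, nxt := x\<rparr> \<and>
    (\<forall>j. used s0 j \<or> m \<le> j \<longrightarrow> sl j = slack s0 j \<and> p j = pred s0 j) \<and>
    (\<forall>j\<in>{1..<m}. \<not> used s0 j \<longrightarrow>
       (let r = reduced a s0 (mate s0 (cur s0)) j in
         (if r < slack s0 j then sl j = r \<and> p j = cur s0 else sl j = slack s0 j \<and> p j = pred s0 j)) \<and>
       d \<le> sl j) \<and>
    (d = \<infinity> \<or> (x \<in> {1..<m} \<and> \<not> used s0 x \<and> d = sl x)))"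
  have "I 1 s0"
    unfolding I_def
    by (rule exI[of _ "slack s0"], rule exI[of _ "pred s0"], rule exI[of _ "\<infinity>"], rule exI[of _ "nxt s0"])
       (use delta in simp)
  moreover have "I (Suc m) (relax_column a m s)" if m: "1 \<le> m" and I: "I m s" for m s
  proof -
    obtain sl p d x where s: "s = s0\<lparr>slack := sl, pred := p, delta := d, nxt := x\<rparr>"
      and sl: "\<And>j. used s0 j \<or> m \<le> j \<Longrightarrow> sl j = slack s0 j \<and> p j = pred s0 j"
      and sl': "\<And>j. j\<in>{1..<m} \<Longrightarrow> \<not> used s0 j \<Longrightarrow>
       (let r = reduced a s0 (mate s0 (cur s0)) j in
         (if r < slack s0 j then sl j = r \<and> p j = cur s0 else sl j = slack s0 j \<and> p j = pred s0 j)) \<and>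
       d \<le> sl j"
      and d: "d = \<infinity> \<or> (x \<in> {1..<m} \<and> \<not> used s0 x \<and> d = sl x)"
      using I unfolding I_def by blast
    show ?thesis
    proof (cases "used s0 m")
      case True
      have eq: "relax_column a m s = s0\<lparr>slack := sl, pred := p, delta := d, nxt := x\<rparr>"
        by (simp add: relax_column_def s True)
      show ?thesis
        unfolding I_def
      proof (intro exI[of _ sl] exI[of _ p] exI[of _ d] exI[of _ x] conjI allI impI ballI)
        fix j assume j: "j \<in> {1..<Suc m}" "\<not> used s0 j"
        then have "j \<in> {1..<m}" using True by (cases "j = m") auto
        from sl'[OF this j(2)] show "let r = reduced a s0 (mate s0 (cur s0)) j in
         (if r < slack s0 j then sl j = r \<and> p j = cur s0 else sl j = slack s0 j \<and> p j = pred s0 j)"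
          "d \<le> sl j" by auto
      next
        fix j assume "used s0 j \<or> Suc m \<le> j"
        then show "sl j = slack s0 j" "p j = pred s0 j" using sl[of j] by auto
      next
        show "d = \<infinity> \<or> (x \<in> {1..<Suc m} \<and> \<not> used s0 x \<and> d = sl x)" using d by auto
      qed (rule eq)
    next
      case False
      define r where "r = reduced a s0 (mate s0 (cur s0)) m"
      define sl1 where "sl1 = (if r < sl m then sl(m := r) else sl)"
      define p1 where "p1 = (if r < sl m then p(m := cur s0) else p)"
      define d1 where "d1 = (if sl1 m < d then sl1 m else d)"
      define x1 where "x1 = (if sl1 m < d then m else x)"
      have eq: "relax_column a m s = s0\<lparr>slack := sl1, pred := p1, delta := d1, nxt := x1\<rparr>"
        by (simp add: relax_column_def s False r_def reduced_def sl1_def p1_def d1_def x1_def Let_def)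
      have slm: "sl m = slack s0 m" "p m = pred s0 m" using sl[of m] by auto
      have sl1: "sl1 j = sl j" "p1 j = p j" if "j \<noteq> m" for j
        using that by (auto simp: sl1_def p1_def)
      have sl1m: "if r < slack s0 m then sl1 m = r \<and> p1 m = cur s0
                   else sl1 m = slack s0 m \<and> p1 m = pred s0 m"
        using slm by (simp add: sl1_def p1_def)
      have d1: "d1 \<le> d" "d1 \<le> sl1 m" by (auto simp: d1_def)
      have dx: "d1 = \<infinity> \<or> (x1 \<in> {1..<Suc m} \<and> \<not> used s0 x1 \<and> d1 = sl1 x1)"
      proof (cases "sl1 m < d")
        case True then show ?thesis using m False by (auto simp: d1_def x1_def)
      next
        case nl: False
        then show ?thesis using d sl1[of x] by (auto simp: d1_def x1_def)
      qed
      show ?thesis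
        unfolding I_def eq
      proof (intro exI[of _ sl1] exI[of _ p1] exI[of _ d1] exI[of _ x1] conjI allI impI ballI)
        fix j assume "used s0 j \<or> Suc m \<le> j"
        then show "sl1 j = slack s0 j" "p1 j = pred s0 j"
          using sl[of j] sl1[of j] False by (cases "j = m"; auto)+
      next
        fix j assume j: "j \<in> {1..<Suc m}" "\<not> used s0 j"
        show "let r = reduced a s0 (mate s0 (cur s0)) j in
         (if r < slack s0 j then sl1 j = r \<and> p1 j = cur s0 else sl1 j = slack s0 j \<and> p1 j = pred s0 j)"
          using j sl1m sl'[of j] sl1[of j] by (cases "j = m") (auto simp: r_def Let_def)
        show "d1 \<le> sl1 j"
          using j sl'[of j] sl1[of j] d1 by (cases "j = m") (auto intro: order_trans)
      qed (use dx in auto)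
    qed
  qed
  ultimately have "I (K+1) (val L) \<and> cost L \<le> (K + 1 - 1) * Suc 0"
    unfolding L_def by (intro for_loop_upt[where I = I]) auto
  then have I: "I (K+1) (val L)" and "cost L \<le> K" by simp_all
  have eq: "{1..<K+1} = {1..K}" by auto
  show "cost L \<le> K" by fact
  show ?relaxed
    using I unfolding I_def eq by blast
qed

text \<open>Row potentials are reached through the columns of the tree; injectivity of
  \<open>mate\<close> there keeps a row from being raised twice.\<close>

lemma shift_loop:
  fixes s0 and K
  defines "L \<equiv> for_loop [0..<K+1] (\<lambda>j s. ret (shift_column j s)) s0"
    and "d \<equiv> real_of_ereal (delta s0)"
  assumes inj: "inj_on (mate s0) (tree K s0)"
  shows "\<exists>u v sl. val L = s0\<lparr>pot_r := u, pot_c := v, slack := sl\<rparr> \<and>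
    (\<forall>j\<in>{0..K}. if used s0 j then v j = pot_c s0 j - d else v j = pot_c s0 j \<and> sl j = slack s0 j - ereal d) \<and>
    (\<forall>r. u r = (if r \<in> mate s0 ` tree K s0 then pot_r s0 r + d else pot_r s0 r))" (is ?shifted)
    and "cost L \<le> K + 1"
proof -
  \<comment> \<open>The tree columns already visited; exactly their rows have been raised.\<close>
  define U where "U = (\<lambda>m. {j\<in>{0..<m}. used s0 j})"
  define I where "I = (\<lambda>m s. \<exists>u v sl. s = s0\<lparr>pot_r := u, pot_c := v, slack := sl\<rparr> \<and>
    (\<forall>j. if j < m then (if used s0 j then v j = pot_c s0 j - d else v j = pot_c s0 j \<and> sl j = slack s0 j - ereal d)
       else v j = pot_c s0 j \<and> sl j = slack s0 j) \<and>
    (\<forall>r. u r = (if r \<in> mate s0 ` U m then pot_r s0 r + d else pot_r s0 r)))"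
  have "I 0 s0"
    unfolding I_def
    by (rule exI[of _ "pot_r s0"], rule exI[of _ "pot_c s0"], rule exI[of _ "slack s0"])
       (simp add: U_def)
  moreover have "I (Suc m) (shift_column m s)" if m: "m < K + 1" and I: "I m s" for m s
  proof -
    obtain u v sl where s: "s = s0\<lparr>pot_r := u, pot_c := v, slack := sl\<rparr>"
      and v: "\<forall>j. if j < m then (if used s0 j then v j = pot_c s0 j - d else v j = pot_c s0 j \<and> sl j = slack s0 j - ereal d)
       else v j = pot_c s0 j \<and> sl j = slack s0 j"
      and u: "\<forall>r. u r = (if r \<in> mate s0 ` U m then pot_r s0 r + d else pot_r s0 r)"
      using I unfolding I_def by blast
    show ?thesis
    proof (cases "used s0 m")
      case True
      have UU: "U (Suc m) = insert m (U m)" using True by (auto simp: U_def)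
      have new: "mate s0 m \<notin> mate s0 ` U m"
      proof
        assume "mate s0 m \<in> mate s0 ` U m"
        then obtain x where "x < m" "used s0 x" "mate s0 m = mate s0 x" by (auto simp: U_def)
        then show False using inj_onD[OF inj, of m x] True m by (auto simp: tree_def)
      qed
      have eq: "shift_column m s = s0\<lparr>pot_r := u(mate s0 m := u (mate s0 m) + d),
          pot_c := v(m := v m - d), slack := sl\<rparr>"
        by (simp add: shift_column_def s True Let_def d_def)
      show ?thesis
        unfolding I_def eq
        by (rule exI, rule exI, rule exI, rule conjI, rule refl)
           (use True v u new in \<open>auto simp: UU less_Suc_eq split: if_splits\<close>)
    next
      case False
      have UU: "U (Suc m) = U m" using False by (auto simp: U_def less_Suc_eq)
      have eq: "shift_column m s = s0\<lparr>pot_r := u, pot_c := v, slack := sl(m := sl m - ereal d)\<rparr>"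
        by (simp add: shift_column_def s False Let_def d_def)
      show ?thesis
        unfolding I_def eq
        by (rule exI, rule exI, rule exI, rule conjI, rule refl)
           (use False v u in \<open>auto simp: UU less_Suc_eq split: if_splits\<close>)
    qed
  qed
  ultimately have "I (K+1) (val L) \<and> cost L \<le> (K + 1 - 0) * Suc 0"
    unfolding L_def by (intro for_loop_upt[where I = I]) auto
  moreover have "U (K+1) = tree K s0" by (auto simp: U_def tree_def)
  ultimately have I: "I (K+1) (val L)" and UK: "U (K+1) = tree K s0" and "cost L \<le> K + 1"
    by auto
  show "cost L \<le> K + 1" by fact
  show ?shifted
    using I unfolding I_def UK by (fastforce simp: less_Suc_eq_le)
qed

section \<open>Assignments, mates and Hall's condition\<close>

lemma assignments_row:
  assumes "A \<in> assignments D K" "n \<in> {1..D}"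
  obtains i where "i \<in> {1..K}" "A n i = 1"
proof -
  have "(\<Sum>i=1..K. A n i) = 1" and 01: "\<forall>i\<in>{1..K}. A n i \<in> {0, 1}"
    using assms by (auto simp: assignments_def)
  then have "\<exists>i\<in>{1..K}. A n i \<noteq> 0" by (metis sum.neutral zero_neq_one)
  then show thesis using 01 that by auto
qed

lemma assignments_column_inj:
  assumes "A \<in> assignments D K" "i \<in> {1..K}" "n \<in> {1..D}" "n' \<in> {1..D}" "A n i = 1" "A n' i = 1"
  shows "n = n'"
proof (rule ccontr)
  assume "n \<noteq> n'"
  then have "(\<Sum>n\<in>{n, n'}. A n i) = 2" using assms by simp
  moreover have "(\<Sum>n\<in>{n, n'}. A n i) \<le> (\<Sum>n=1..D. A n i)"
    using assms by (intro sum_mono2) auto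
  moreover have "(\<Sum>n=1..D. A n i) \<le> 1" using assms by (auto simp: assignments_def)
  ultimately show False by linarith
qed

text \<open>With the new row parked in column 0 the mates stay distinct, since real columns hold
  rows up to \<open>n\<close> only.\<close>

lemma tree_mates:
  assumes "mate s 0 = Suc n" "matching {1..K} n (mate s)"
  shows "inj_on (mate s) {j\<in>{0..K}. mate s j \<noteq> 0}"
    and "\<And>j. j \<le> K \<Longrightarrow> mate s j \<le> Suc n"
    and "\<And>j. j \<in> {1..K} \<Longrightarrow> mate s j \<le> n"
proof -
  have img: "mate s j \<le> n" if "j \<in> {1..K}" for j
  proof (cases "mate s j = 0")
    case False
    then have "mate s j \<in> mate s ` {j\<in>{1..K}. mate s j \<noteq> 0}" using that by blast
    then show ?thesis using assms(2) unfolding matching_def bij_betw_def by simp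
  qed simp
  show "\<And>j. j \<in> {1..K} \<Longrightarrow> mate s j \<le> n" by (rule img)
  show "mate s j \<le> Suc n" if "j \<le> K" for j
    using img[of j] assms(1) that by (cases "j = 0") auto
  have inj: "inj_on (mate s) {j\<in>{1..K}. mate s j \<noteq> 0}"
    using assms(2) by (simp add: matching_def bij_betw_def)
  have eq: "{j\<in>{0..K}. mate s j \<noteq> 0} = insert 0 {j\<in>{1..K}. mate s j \<noteq> 0}"
    using assms(1) by (auto simp: not_le)
  show "inj_on (mate s) {j\<in>{0..K}. mate s j \<noteq> 0}"
    unfolding eq inj_on_insert using inj assms(1) img by (auto simp: image_iff) (metis Suc_n_not_le_n)
qed

text \<open>Pigeonhole: an assignment of finite cost would send the \<open>card T\<close> rows
  injectively into the real columns of \<open>T\<close>, of which there is one fewer because column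
  0 is fictitious.\<close>

lemma hall_violation:
  assumes "T \<subseteq> {0..K}" "0 \<in> T" "inj_on \<mu> T" "\<mu> ` T \<subseteq> {1..D}"
    and inf: "\<And>j j'. j \<in> T \<Longrightarrow> j' \<in> {1..K} - T \<Longrightarrow> a (\<mu> j) j' = \<infinity>"
  shows "no_finite D K a"
  unfolding no_finite_def
proof (rule ballI, rule ccontr)
  fix A assume A: "A \<in> assignments D K"
    and "\<not> (\<exists>n\<in>{1..D}. \<exists>i\<in>{1..K}. A n i = 1 \<and> a n i = \<infinity>)"
  then have fin: "a n i \<noteq> \<infinity>" if "n \<in> {1..D}" "i \<in> {1..K}" "A n i = 1" for n i
    using that by blast
  have "\<exists>i. i \<in> {1..K} \<and> A (\<mu> j) i = 1" if "j \<in> T" for j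
    using assignments_row[OF A, of "\<mu> j"] assms(4) that by blast
  then obtain \<sigma> where \<sigma>: "\<And>j. j \<in> T \<Longrightarrow> \<sigma> j \<in> {1..K} \<and> A (\<mu> j) (\<sigma> j) = 1" by metis
  have "inj_on \<sigma> T"
  proof (rule inj_onI)
    fix j j' assume *: "j \<in> T" "j' \<in> T" "\<sigma> j = \<sigma> j'"
    have "\<mu> j = \<mu> j'"
      by (rule assignments_column_inj[OF A, of "\<sigma> j"]) (use * \<sigma>[of j] \<sigma>[of j'] assms(4) in auto)
    then show "j = j'" using assms(3) * by (meson inj_onD)
  qed
  moreover have "\<sigma> ` T \<subseteq> T - {0}"
  proof
    fix i assume "i \<in> \<sigma> ` T"
    then obtain j where j: "j \<in> T" "i = \<sigma> j" by blast
    have "a (\<mu> j) i \<noteq> \<infinity>" using fin[of "\<mu> j" i] \<sigma>[OF j(1)] assms(4) j by blast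
    then show "i \<in> T - {0}" using inf[OF j(1), of i] \<sigma>[OF j(1)] j by fastforce
  qed
  moreover have "finite T" using assms(1) finite_subset by blast
  ultimately have "card T \<le> card (T - {0})" by (metis card_inj_on_le finite_Diff)
  then show False using \<open>finite T\<close> assms(2) by (metis card_Diff1_less not_le)
qed

section \<open>Growth of the tree, augmentation, insertion of a row\<close>

text \<open>The shift lowers the reduced costs from tree rows to outer columns by \<open>d\<close>,
  which is at most their least value, raises those from outer rows to tree columns by
  \<open>d\<close>, and keeps the others. Row and column of a matched couple lie both inside or both
  outside, so matched couples stay tight.\<close>

lemma grow_tree_step:
  assumes inv: "grow_inv K a n k s" and cur: "mate s (cur s) \<noteq> 0"
    and a: "\<And>r j. r \<in> {1..D} \<Longrightarrow> j \<in> {1..K} \<Longrightarrow> a r j \<noteq> -\<infinity>" and n: "Suc n \<le> D"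
  defines "s' \<equiv> val (grow_tree K a s)"
  shows "cost (grow_tree K a s) \<le> 2 * K + 1"
    and "(stuck s' \<and> no_finite D K a) \<or> grow_inv K a n (Suc k) s'"
proof -
  define T where "T = tree K s"
  define T' where "T' = insert (cur s) T"
  define s0 where "s0 = s\<lparr>used := (used s)(cur s := True), delta := \<infinity>\<rparr>"
  define L where "L = for_loop [1..<K+1] (\<lambda>j s. ret (relax_column a j s)) s0"
  from inv have i1: "\<not> stuck s" "mate s 0 = Suc n" "matching {1..K} n (mate s)" "comp_slack K a 0 s"
    and feas: "\<And>r. r \<in> {1..n} \<Longrightarrow> feasible_row K a s r"
    and card: "card T = k" and mT: "\<And>j. j \<in> T \<Longrightarrow> mate s j \<noteq> 0"
    and curK: "cur s \<le> K" "cur s \<notin> T" "T = {} \<Longrightarrow> cur s = 0"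
    and T0: "T \<noteq> {} \<Longrightarrow> 0 \<in> T" "T \<noteq> {} \<Longrightarrow> feasible_row K a s (Suc n)"
    and slk: "slack_inv K a s"
    unfolding grow_inv_def T_def by auto
  from inv obtain rk where rk: "rank_inv K a s rk" "rk (cur s) = k"
    unfolding grow_inv_def by blast
  have TK: "T \<subseteq> {0..K}" "finite T" by (auto simp: T_def tree_def)
  have T': "T' \<subseteq> {0..K}" "finite T'" "0 \<in> T'" "\<And>j. j \<in> T' \<Longrightarrow> mate s j \<noteq> 0"
    using TK curK T0 mT cur by (auto simp: T'_def)
  have tree0: "tree K s0 = T'" using curK by (auto simp: tree_def s0_def T'_def T_def)
  note mates = tree_mates[OF i1(2,3)]
  have inj: "inj_on (mate s) T'"
    by (rule inj_on_subset[OF mates(1)]) (use T' in auto)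
  have mate_iff: "mate s j \<in> mate s ` T' \<longleftrightarrow> j \<in> T'" if "j \<le> K" "mate s j \<noteq> 0" for j
    using inj_onD[OF mates(1)] T' that by fastforce
  have mT'K: "mate s ` T' \<subseteq> {1..Suc n}"
    using mates(2) T' by (auto simp: Suc_le_eq)
  have red0: "reduced a s0 = reduced a s" by (simp add: fun_eq_iff reduced_def s0_def)
  obtain sl p d x where L: "val L = s0\<lparr>slack := sl, pred := p, delta := d, nxt := x\<rparr>"
    and slu: "\<And>j. used s0 j \<Longrightarrow> sl j = slack s0 j \<and> p j = pred s0 j"
    and sl: "\<And>j. j\<in>{1..K} \<Longrightarrow> \<not> used s0 j \<Longrightarrow>
       (let r = reduced a s0 (mate s0 (cur s0)) j in
         (if r < slack s0 j then sl j = r \<and> p j = cur s0 else sl j = slack s0 j \<and> p j = pred s0 j)) \<and>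
       d \<le> sl j"
    and d: "d = \<infinity> \<or> (x \<in> {1..K} \<and> \<not> used s0 x \<and> d = sl x)"
    using relax_loop(1)[of s0 K a] unfolding L_def[symmetric] by (auto simp: s0_def)
  have used0: "used s0 j \<longleftrightarrow> j \<in> T'" if "j \<le> K" for j
    using that tree0 by (auto simp: tree_def)
  have slT: "sl j \<le> reduced a s (mate s j') j" if "j \<in> {1..K} - T'" "j' \<in> T'" for j j'
  proof -
    have nu: "\<not> used s0 j" using that used0 by auto
    have "slack s j \<le> reduced a s (mate s j') j" if "j' \<in> T"
      using slk \<open>j \<in> {1..K} - T'\<close> that by (auto simp: slack_inv_def T_def T'_def)
    then show ?thesis
      using sl[of j] nu that by (auto simp: T'_def s0_def reduced_def Let_def split: if_splits)
  qed
  have slP: "sl j = \<infinity> \<or> (p j \<in> T' \<and> sl j = reduced a s (mate s (p j)) j)"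
    if "j \<in> {1..K} - T'" for j
  proof -
    have nu: "\<not> used s0 j" using that used0 by auto
    have "slack s j = \<infinity> \<or> (pred s j \<in> T \<and> slack s j = reduced a s (mate s (pred s j)) j)"
      using slk that by (auto simp: slack_inv_def T_def T'_def)
    then show ?thesis
      using sl[of j] nu that by (auto simp: T'_def s0_def reduced_def Let_def split: if_splits)
  qed
  have dle: "d \<le> sl j" if "j \<in> {1..K} - T'" for j
    using sl[of j] that used0[of j] by auto
  have gt: "grow_tree K a s = bind_timed L (\<lambda>s1.
      if delta s1 = \<infinity> then ret (s1\<lparr>stuck := True\<rparr>)
      else bind_timed (for_loop [0..<K+1] (\<lambda>j s. ret (shift_column j s)) s1)
             (\<lambda>s2. ret (s2\<lparr>cur := nxt s2\<rparr>)))"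
    unfolding grow_tree_def s0_def L_def by (rule refl)
  show "cost (grow_tree K a s) \<le> 2 * K + 1"
  proof -
    have "cost L \<le> K" unfolding L_def by (rule relax_loop(2)) (simp add: s0_def)
    moreover have "cost (for_loop [0..<K+1] (\<lambda>j s. ret (shift_column j s)) (val L)) \<le> K + 1"
      by (rule shift_loop(2)) (use inj tree0 in \<open>simp add: L tree_def s0_def\<close>)
    ultimately show ?thesis by (simp add: gt del: upt_Suc)
  qed
  show "(stuck s' \<and> no_finite D K a) \<or> grow_inv K a n (Suc k) s'"
  proof (cases "d = \<infinity>")
    case True
    have "s' = (val L)\<lparr>stuck := True\<rparr>"
      by (simp add: s'_def gt L True)
    \<comment> \<open>Every cost from a row of the tree to a column outside is infinite, so
      \<open>T'\<close> violates Hall's condition.\<close>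
    moreover have "no_finite D K a"
    proof (rule hall_violation[of T' K "mate s"])
      fix j j' assume *: "j \<in> T'" "j' \<in> {1..K} - T'"
      then have "reduced a s (mate s j) j' = \<infinity>"
        using slT[OF *(2,1)] dle[OF *(2)] True by auto
      then show "a (mate s j) j' = \<infinity>" by (cases "a (mate s j) j'") (auto simp: reduced_def)
    qed (use T' inj mT'K n in auto)
    ultimately show ?thesis by simp
  next
    case False
    then have x: "x \<in> {1..K} - T'" "d = sl x" using d used0[of x] by auto
    have px: "p x \<in> T'" "d = reduced a s (mate s (p x)) x" using slP[OF x(1)] x(2) False by auto
    have "mate s (p x) \<in> {1..D}" using px(1) mT'K n by fastforce
    then have "a (mate s (p x)) x \<noteq> -\<infinity>" using a x(1) by blast
    then have "d \<noteq> -\<infinity>" using px(2) by (cases "a (mate s (p x)) x") (auto simp: reduced_def)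
    then obtain \<delta> where \<delta>: "d = ereal \<delta>" using False by (cases d) auto
    have feas': "0 \<le> reduced a s r j" if "r \<in> {1..Suc n}" "j \<in> {1..K}" "T \<noteq> {}" for r j
      using feas[of r] T0(2) that by (cases "r = Suc n") (auto simp: feasible_row_def)
    \<comment> \<open>If the old tree is nonempty, the new row is already dual feasible. In the
      first step \<open>\<delta>\<close> may be negative.\<close>
    have \<delta>0: "0 \<le> \<delta>" if "T \<noteq> {}"
    proof -
      have "mate s (p x) \<in> {1..Suc n}" using px(1) mT'K by blast
      from feas'[OF this _ that, of x] have "0 \<le> ereal \<delta>" using px(2) x(1) \<delta> by simp
      then show ?thesis by simp
    qed
    have inj1: "inj_on (mate (val L)) (tree K (val L))"
      using inj tree0 by (simp add: L tree_def s0_def)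
    obtain u v sl2 where
      L2: "val (for_loop [0..<K+1] (\<lambda>j s. ret (shift_column j s)) (val L)) =
             (val L)\<lparr>pot_r := u, pot_c := v, slack := sl2\<rparr>"
      and v: "\<forall>j\<in>{0..K}. if used (val L) j then v j = pot_c (val L) j - real_of_ereal (delta (val L))
         else v j = pot_c (val L) j \<and> sl2 j = slack (val L) j - ereal (real_of_ereal (delta (val L)))"
      and u: "\<forall>r. u r = (if r \<in> mate (val L) ` tree K (val L)
         then pot_r (val L) r + real_of_ereal (delta (val L)) else pot_r (val L) r)"
      using shift_loop(1)[OF inj1] by blast
    have treeL: "tree K (val L) = T'" using tree0 by (simp add: L tree_def)
    have v: "v j = (if j \<in> T' then pot_c s j - \<delta> else pot_c s j)"
      and sl2: "j \<notin> T' \<Longrightarrow> sl2 j = sl j - ereal \<delta>" if "j \<le> K" for j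
      using v[rule_format, of j] used0[OF that] that by (auto simp: L s0_def \<delta>)
    have u: "u r = (if r \<in> mate s ` T' then pot_r s r + \<delta> else pot_r s r)" for r
      using u[rule_format, of r] treeL by (simp add: L s0_def \<delta>)
    have s': "s' = s\<lparr>used := (used s)(cur s := True), slack := sl2, pred := p, delta := d, nxt := x,
        pot_r := u, pot_c := v, cur := x\<rparr>"
      unfolding s'_def gt
      using False L2 by (simp add: L s0_def del: upt_Suc)
    have tree': "tree K s' = T'" using tree0 by (simp add: s' tree_def s0_def)
    have red': "reduced a s' r j = (if r \<in> mate s ` T'
        then (if j \<in> T' then reduced a s r j else reduced a s r j - ereal \<delta>)
        else (if j \<in> T' then reduced a s r j + ereal \<delta> else reduced a s r j))" if "j \<le> K" for r j
      using v[OF that] u[of r] by (cases "a r j") (auto simp: reduced_def s')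
    \<comment> \<open>In the first step the new tree is column 0 alone. Hence
      \<open>\<delta>\<close> is nonnegative whenever a real column belongs to the tree.\<close>
    have Tne: "T \<noteq> {}" if "j \<in> T'" "j \<noteq> 0" for j
      using that curK(3) by (auto simp: T'_def)
    have cs: "comp_slack K a 0 s'"
      unfolding comp_slack_def
    proof (intro conjI ballI)
      fix j assume j: "j \<in> {1..K}"
      have "pot_c s j \<le> 0" using i1(4) j by (auto simp: comp_slack_def)
      then show "pot_c s' j \<le> 0"
        using v[of j] j \<delta>0 Tne[of j] by (auto simp: s')
    next
      fix j assume j: "j \<in> {1..K} - {0}"
      then have *: "if mate s j = 0 then pot_c s j = 0 else reduced a s (mate s j) j = 0"
        using i1(4) unfolding comp_slack_def by blast
      have m: "mate s' j = mate s j" by (simp add: s')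
      show "if mate s' j = 0 then pot_c s' j = 0 else reduced a s' (mate s' j) j = 0"
      proof (cases "mate s j = 0")
        case True
        then have "j \<notin> T'" using T'(4) by blast
        then show ?thesis using True * v[of j] j by (simp add: s')
      next
        case mj: False
        then show ?thesis
          using * red'[of j "mate s j"] mate_iff[of j] j by (simp add: m)
      qed
    qed
    have feas2: "feasible_row K a s' r" if r: "r \<in> {1..Suc n}" for r
      unfolding feasible_row_def
    proof
      fix j assume j: "j \<in> {1..K}"
      show "0 \<le> reduced a s' r j"
      proof (cases "r \<in> mate s ` T'")
        case rT: True
        show ?thesis
        proof (cases "j \<in> T'")
          case True
          then show ?thesis using rT red'[of j r] j feas'[OF r j] Tne[of j] by auto
        next
          case False
          then have "d \<le> reduced a s r j"
            using rT slT[of j] dle[of j] j by (auto intro: order_trans)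
          then show ?thesis using rT False red'[of j r] j \<delta>
            by (cases "reduced a s r j") auto
        qed
      next
        case rT: False
        have "mate s 0 \<in> mate s ` T'" using T'(3) by blast
        then have "r \<noteq> Suc n" using rT i1(2) by auto
        then have f: "0 \<le> reduced a s r j" using feas[of r] r j by (auto simp: feasible_row_def)
        show ?thesis
          using rT red'[of j r] j f \<delta>0 Tne[of j] by auto
      qed
    qed
    have sinv: "slack_inv K a s'"
      unfolding slack_inv_def tree'
    proof (intro ballI conjI)
      fix j j' assume j: "j \<in> {1..K} - T'" and "j' \<in> T'"
      then show "slack s' j \<le> reduced a s' (mate s' j') j"
        using slT[of j j'] red'[of j "mate s j'"] sl2[of j] by (auto simp: s' intro: ereal_minus_mono)
    next
      fix j assume j: "j \<in> {1..K} - T'"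
      show "slack s' j = \<infinity> \<or> (pred s' j \<in> T' \<and> slack s' j = reduced a s' (mate s' (pred s' j)) j)"
        using slP[OF j] red'[of j "mate s (p j)"] sl2[of j] j by (auto simp: s')
    qed
    \<comment> \<open>The next column is numbered last. The edge from its predecessor attained
      \<open>d\<close>, so it is tight after the shift.\<close>
    have rinv: "rank_inv K a s' (rk(x := Suc k))"
    proof -
      have cx: "cur s' = x" and ms: "mate s' = mate s" and ps: "pred s' = p" by (simp_all add: s')
      have lt: "(rk(x := Suc k)) j < Suc k" if "j \<in> T'" for j
      proof -
        have "j \<noteq> x" using that x(1) by blast
        moreover have "rk j \<le> k"
          using rk that by (auto simp: rank_inv_def T'_def T_def intro: less_imp_le)
        ultimately show ?thesis by simp
      qed
      show ?thesis
        unfolding rank_inv_def tree' cx ms ps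
      proof (intro conjI ballI)
        fix j assume "j \<in> T'" then show "(rk(x := Suc k)) j < (rk(x := Suc k)) x" using lt by simp
      next
        fix j assume j: "j \<in> insert x T' - {0}"
        have "p j \<in> T' \<and> (rk(x := Suc k)) (p j) < (rk(x := Suc k)) j \<and> reduced a s' (mate s (p j)) j = 0"
        proof (cases "j = x")
          case True
          then show ?thesis using px lt red'[of x "mate s (p x)"] x(1) \<delta> by auto
        next
          case jx: False
          then have jT: "j \<in> T'" "j \<noteq> 0" using j by auto
          have "p j = pred s j" using slu[of j] used0[of j] jT T'(1) by (auto simp: s0_def)
          moreover have "pred s j \<in> T" "rk (pred s j) < rk j" "reduced a s (mate s (pred s j)) j = 0"
            using rk(1) jT unfolding rank_inv_def T'_def T_def by auto
          moreover have "pred s j \<noteq> x" using \<open>pred s j \<in> T\<close> x(1) by (auto simp: T'_def)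
          ultimately show ?thesis
            using red'[of j "mate s (pred s j)"] jT T'(1) jx by (auto simp: T'_def)
        qed
        then show "p j \<in> T'" "(rk(x := Suc k)) (p j) < (rk(x := Suc k)) j"
          "reduced a s' (mate s (p j)) j = 0" by auto
      qed
    qed
    have "grow_inv K a n (Suc k) s'"
      unfolding grow_inv_def tree'
    proof (intro conjI)
      show "\<not> stuck s'" "mate s' 0 = Suc n" "matching {1..K} n (mate s')"
        using i1 by (simp_all add: s')
      show "card T' = Suc k" using card curK TK by (simp add: T'_def)
      show "\<forall>j\<in>T'. mate s' j \<noteq> 0" using T'(4) by (simp add: s')
      show "cur s' \<le> K" "cur s' \<notin> T'" using x by (auto simp: s')
      show "\<exists>rk. rank_inv K a s' rk \<and> rk (cur s') = Suc k"
        using rinv by (intro exI[of _ "rk(x := Suc k)"]) (simp add: s')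
    qed (use cs feas2 sinv T'(3) in auto)
    then show ?thesis by simp
  qed
qed

text \<open>The open column \<open>c\<close> moves back along \<open>pred\<close> towards column 0,
  each time receiving the row of its predecessor along a tight edge. Ranks decrease on the way,
  which bounds the number of steps by the rank \<open>k\<close> of the start.\<close>

lemma augment_matching:
  assumes s: "grow_inv K a n k s" "mate s (cur s) = 0"
  defines "s' \<equiv> val (augment s)"
  shows "opt_inv K a (Suc n) s'" and "cost (augment s) \<le> k"
proof -
  define T where "T = tree K s"
  from s(1) have i1: "\<not> stuck s" "mate s 0 = Suc n" "matching {1..K} n (mate s)" "comp_slack K a 0 s"
    and feas: "\<And>r. r \<in> {1..n} \<Longrightarrow> feasible_row K a s r"
    and mT: "\<And>j. j \<in> T \<Longrightarrow> mate s j \<noteq> 0"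
    and curK: "cur s \<le> K" "T = {} \<longrightarrow> cur s = 0"
    and T0: "T \<noteq> {} \<Longrightarrow> feasible_row K a s (Suc n)"
    unfolding grow_inv_def T_def by auto
  have feas2: "feasible_row K a s r" if "r \<in> {1..Suc n}" for r
    using that feas T0 curK(2) s(2) i1(2) by (cases "r = Suc n") auto
  obtain rk where "rank_inv K a s rk" "rk (cur s) = k"
    using s(1) unfolding grow_inv_def by blast
  then have rk: "\<And>j. j\<in>T \<Longrightarrow> rk j < k" "rk (cur s) = k"
     and pred: "\<And>j. j\<in>insert (cur s) T - {0} \<Longrightarrow> pred s j \<in> T \<and> rk (pred s j) < rk j \<and>
        reduced a s (mate s (pred s j)) j = 0"
    unfolding rank_inv_def T_def by auto
  define J where "J = (\<lambda>c. {0..K} - {c})"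
  \<comment> \<open>Columns of smaller rank still hold their original rows, so the tightness
    recorded in \<open>rank_inv\<close> applies to the next exchange.\<close>
  define I where "I = (\<lambda>m t. \<exists>\<mu> c. t = s\<lparr>mate := \<mu>, cur := c\<rparr> \<and> m + rk c \<le> k \<and>
     c \<in> insert (cur s) T \<and> matching (J c) (Suc n) \<mu> \<and> comp_slack K a c t \<and>
     (\<forall>j\<in>T. rk j < rk c \<longrightarrow> \<mu> j = mate s j))"
  have TK: "T \<subseteq> {0..K}" by (auto simp: T_def tree_def)
  define body where "body = (\<lambda>s :: hungarian_state. let j = pred s (cur s) in
     ret (s\<lparr>mate := (mate s)(cur s := mate s j), cur := j\<rparr>))"
  have aug: "augment s = while_loop (\<lambda>s. cur s \<noteq> 0) body s"
    unfolding augment_def body_def by (rule refl)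
  have "I 0 s"
  proof -
    have "{j\<in>{0..K} - {cur s}. mate s j \<noteq> 0} = insert 0 {j\<in>{1..K}. mate s j \<noteq> 0}"
      using s(2) i1(2) by (auto simp: not_le)
    moreover have "{1..Suc n} = insert (Suc n) {1..n}" by auto
    moreover have "bij_betw (mate s) (insert 0 {j\<in>{1..K}. mate s j \<noteq> 0}) (insert (Suc n) {1..n})"
      using i1(3) unfolding matching_def
      by (intro bij_betw_combine[of _ "{0}" "{Suc n}", simplified]) (auto simp: i1(2) bij_betw_def)
    ultimately have "matching (J (cur s)) (Suc n) (mate s)"
      by (simp add: matching_def J_def)
    moreover have "comp_slack K a (cur s) s" using i1(4) by (auto simp: comp_slack_def)
    ultimately show ?thesis
      unfolding I_def using rk
      by (intro exI[of _ "mate s"] exI[of _ "cur s"]) auto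
  qed
  moreover have "m \<le> k" if "I m t" for m t
    using that by (auto simp: I_def)
  moreover have "I (Suc m) (val (body t)) \<and> cost (body t) \<le> 0"
    if I: "I m t" and "cur t \<noteq> 0" for m t
  proof -
    from I obtain \<mu> c where t: "t = s\<lparr>mate := \<mu>, cur := c\<rparr>" and m: "m + rk c \<le> k"
      and c: "c \<in> insert (cur s) T" and ma: "matching (J c) (Suc n) \<mu>" and cs: "comp_slack K a c t"
      and old: "\<And>j. j\<in>T \<Longrightarrow> rk j < rk c \<Longrightarrow> \<mu> j = mate s j"
      unfolding I_def by blast
    have c0: "c \<noteq> 0" using \<open>cur t \<noteq> 0\<close> by (simp add: t)
    define p where "p = pred s c"
    have p: "p \<in> T" "rk p < rk c" "reduced a s (mate s p) c = 0"
      using pred[of c] c c0 by (auto simp: p_def)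
    have pc: "p \<noteq> c" using p(2) by auto
    have \<mu>p: "\<mu> p = mate s p" "\<mu> p \<noteq> 0" using old p mT by auto
    have cK: "c \<le> K" "p \<le> K" using c curK TK p(1) by auto
    define \<mu>' where "\<mu>' = \<mu>(c := \<mu> p)"
    have eq: "val (body t) = s\<lparr>mate := \<mu>', cur := p\<rparr>"
      by (simp add: body_def t Let_def p_def \<mu>'_def)
    have ma': "matching (J p) (Suc n) \<mu>'"
    proof -
      \<comment> \<open>The columns not involved in the exchange; the row of \<open>p\<close> passes
        to \<open>c\<close>, so the image is unchanged.\<close>
      define R where "R = {j\<in>{0..K} - {c, p}. \<mu> j \<noteq> 0}"
      have A: "{j\<in>J c. \<mu> j \<noteq> 0} = insert p R"
        and B: "{j\<in>J p. \<mu>' j \<noteq> 0} = insert c R"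
        using cK pc \<mu>p by (auto simp: J_def R_def \<mu>'_def)
      have "bij_betw \<mu> (insert p R) {1..Suc n}" using ma A by (simp add: matching_def)
      moreover have "\<mu> ` insert p R = \<mu>' ` insert c R"
        using pc by (auto simp: \<mu>'_def R_def)
      moreover have "inj_on \<mu>' (insert c R)" if "inj_on \<mu> (insert p R)"
      proof -
        have R: "\<mu>' x = \<mu> x" if "x \<in> R" for x using that by (simp add: \<mu>'_def R_def)
        have "inj_on \<mu>' R = inj_on \<mu> R" using R by (rule inj_on_cong)
        moreover have "\<mu>' ` R = \<mu> ` R" using R by (rule image_cong[OF refl])
        moreover have "R - {c} = R" "R - {p} = R" by (auto simp: R_def)
        ultimately show ?thesis using that unfolding inj_on_insert by (simp add: \<mu>'_def)
      qed
      ultimately show ?thesis unfolding matching_def B bij_betw_def by simp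
    qed
    have cs': "comp_slack K a p (s\<lparr>mate := \<mu>', cur := p\<rparr>)"
      unfolding comp_slack_def
    proof (intro conjI ballI)
      fix j assume "j \<in> {1..K}"
      then show "pot_c (s\<lparr>mate := \<mu>', cur := p\<rparr>) j \<le> 0" using cs by (simp add: comp_slack_def t)
    next
      fix j assume j: "j \<in> {1..K} - {p}"
      have "if \<mu> j = 0 then pot_c s j = 0 else reduced a s (\<mu> j) j = 0" if "j \<noteq> c"
      proof -
        have "if mate t j = 0 then pot_c t j = 0 else reduced a t (mate t j) j = 0"
          using cs j that unfolding comp_slack_def by blast
        then show ?thesis by (auto simp: t reduced_def split: if_splits)
      qed
      then show "if mate (s\<lparr>mate := \<mu>', cur := p\<rparr>) j = 0 then pot_c (s\<lparr>mate := \<mu>', cur := p\<rparr>) j = 0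
        else reduced a (s\<lparr>mate := \<mu>', cur := p\<rparr>) (mate (s\<lparr>mate := \<mu>', cur := p\<rparr>) j) j = 0"
        using p(3) \<mu>p by (cases "j = c") (auto simp: \<mu>'_def reduced_def)
    qed
    have "I (Suc m) (s\<lparr>mate := \<mu>', cur := p\<rparr>)"
      unfolding I_def
      using m p ma' cs' old pc
      by (intro exI[of _ \<mu>'] exI[of _ p]) (auto simp: \<mu>'_def)
    then show ?thesis unfolding eq by (simp add: body_def Let_def)
  qed
  ultimately obtain m where m: "I m s'" "\<not> cur s' \<noteq> 0" "cost (augment s) \<le> m * Suc 0"
    unfolding s'_def aug by (rule while_loop_rule[of I s k "\<lambda>s. cur s \<noteq> 0" body 0])
  from m(1) obtain \<mu> c where s'c: "s' = s\<lparr>mate := \<mu>, cur := c\<rparr>" "m + rk c \<le> k"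
    "matching (J c) (Suc n) \<mu>" "comp_slack K a c s'"
    unfolding I_def by blast
  moreover have "c = 0" using m(2) s'c(1) by simp
  ultimately have s': "s' = s\<lparr>mate := \<mu>, cur := 0\<rparr>" and mk: "m \<le> k"
    and ma: "matching (J 0) (Suc n) \<mu>" and cs: "comp_slack K a 0 s'" by auto
  show "cost (augment s) \<le> k" using m(3) mk by simp
  have "J 0 = {1..K}" by (auto simp: J_def)
  then show "opt_inv K a (Suc n) s'"
    using ma cs i1(1) feas2 by (simp add: opt_inv_def s' feasible_row_def reduced_def)
qed

text \<open>Tree columns hold distinct rows, so the tree grows at most \<open>D\<close> times. The
  cost adds \<open>K + 1\<close> for the reset, \<open>D\<close> steps of \<open>2 * K + 2\<close>,
  and at most \<open>D\<close> for the augmentation.\<close>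

lemma insert_row_correct:
  assumes inv: "opt_inv K a n s" and n: "Suc n \<le> D"
    and a: "\<And>r j. r \<in> {1..D} \<Longrightarrow> j \<in> {1..K} \<Longrightarrow> a r j \<noteq> -\<infinity>"
  defines "s' \<equiv> val (insert_row K a (Suc n) s)"
  shows "(stuck s' \<and> no_finite D K a) \<or> opt_inv K a (Suc n) s'"
    and "cost (insert_row K a (Suc n) s) \<le> K + 1 + D * (2 * K + 3)"
proof -
  define s1 where "s1 = for_loop [0..<K+1]
     (\<lambda>j s. ret (s\<lparr>slack := (slack s)(j := \<infinity>), used := (used s)(j := False)\<rparr>))
     (s\<lparr>mate := (mate s)(0 := Suc n), cur := 0\<rparr>)"
  define I0 where "I0 = (\<lambda>m t. \<exists>sl u. t = s\<lparr>mate := (mate s)(0 := Suc n), cur := 0, slack := sl, used := u\<rparr>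
     \<and> (\<forall>j<m. sl j = \<infinity> \<and> \<not> u j))"
  have "I0 (K+1) (val s1) \<and> cost s1 \<le> (K+1-0) * Suc 0"
    unfolding s1_def
  proof (rule for_loop_upt)
    show "I0 0 (s\<lparr>mate := (mate s)(0 := Suc n), cur := 0\<rparr>)"
      unfolding I0_def by (rule exI[of _ "slack s"], rule exI[of _ "used s"]) simp
  next
    fix m t assume "I0 m t"
    then obtain sl u where "t = s\<lparr>mate := (mate s)(0 := Suc n), cur := 0, slack := sl, used := u\<rparr>"
      "\<forall>j<m. sl j = \<infinity> \<and> \<not> u j" unfolding I0_def by blast
    then have "I0 (Suc m) (t\<lparr>slack := (slack t)(m := \<infinity>), used := (used t)(m := False)\<rparr>)"
      unfolding I0_def
      by (intro exI[of _ "sl(m := \<infinity>)"] exI[of _ "u(m := False)"]) (auto simp: less_Suc_eq)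
    then show "I0 (Suc m) (val (ret (t\<lparr>slack := (slack t)(m := \<infinity>), used := (used t)(m := False)\<rparr>))) \<and>
       cost (ret (t\<lparr>slack := (slack t)(m := \<infinity>), used := (used t)(m := False)\<rparr>)) \<le> 0" by simp
  qed simp
  then obtain sl u where s1: "val s1 = s\<lparr>mate := (mate s)(0 := Suc n), cur := 0, slack := sl, used := u\<rparr>"
    and slu: "\<And>j. j \<le> K \<Longrightarrow> sl j = \<infinity> \<and> \<not> u j" and cost1: "cost s1 \<le> K + 1"
    unfolding I0_def by auto
  have tree1: "tree K (val s1) = {}" using slu by (auto simp: tree_def s1)
  define s2 where "s2 = while_loop (\<lambda>s. \<not> stuck s \<and> mate s (cur s) \<noteq> 0) (grow_tree K a) (val s1)"
  \<comment> \<open>A stuck state keeps no tree invariant from which its count could be bounded, so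
    \<open>k \<le> D\<close> is stored with it.\<close>
  define I where "I = (\<lambda>k t. (k \<le> D \<and> stuck t \<and> no_finite D K a) \<or> grow_inv K a n k t)"
  have inv': "\<not> stuck s" "matching {1..K} n (mate s)" "comp_slack K a 0 s"
     "\<forall>r\<in>{1..n}. feasible_row K a s r" using inv by (auto simp: opt_inv_def)
  have ms: "{j\<in>{1..K}. ((mate s)(0 := Suc n)) j \<noteq> 0} = {j\<in>{1..K}. mate s j \<noteq> 0}" by auto
  have "bij_betw ((mate s)(0 := Suc n)) {j\<in>{1..K}. mate s j \<noteq> 0} {1..n}
      \<longleftrightarrow> bij_betw (mate s) {j\<in>{1..K}. mate s j \<noteq> 0} {1..n}"
    by (rule bij_betw_cong) auto
  then have "matching {1..K} n ((mate s)(0 := Suc n))"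
    using inv'(2) unfolding matching_def ms by simp
  then have "grow_inv K a n 0 (val s1)"
    unfolding grow_inv_def tree1
    using inv' slu
    by (auto simp: s1 comp_slack_def feasible_row_def reduced_def slack_inv_def tree1[unfolded s1]
        rank_inv_def intro!: exI[of _ "\<lambda>_. 0"])
  then have "I 0 (val s1)" by (simp add: I_def)
  moreover have bound: "k \<le> D" if "I k t" for k t
  proof (cases "stuck t")
    case False
    then have g: "grow_inv K a n k t" using that by (simp add: I_def)
    have m: "mate t 0 = Suc n" "matching {1..K} n (mate t)" "card (tree K t) = k"
      and nz: "\<And>j. j \<in> tree K t \<Longrightarrow> mate t j \<noteq> 0"
      using g unfolding grow_inv_def by auto
    have "inj_on (mate t) (tree K t)"
      by (rule inj_on_subset[OF tree_mates(1)[OF m(1,2)]]) (use nz in \<open>auto simp: tree_def\<close>)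
    moreover have "mate t ` tree K t \<subseteq> {1..Suc n}"
      using tree_mates(2)[OF m(1,2)] nz by (auto simp: Suc_le_eq tree_def)
    ultimately have "card (tree K t) \<le> card {1..Suc n}" by (intro card_inj_on_le) auto
    then show ?thesis using m(3) n by simp
  qed (use that in \<open>auto simp: I_def grow_inv_def\<close>)
  moreover have "I (Suc k) (val (grow_tree K a t)) \<and> cost (grow_tree K a t) \<le> 2 * K + 1"
    if "I k t" and b: "\<not> stuck t \<and> mate t (cur t) \<noteq> 0" for k t
  proof -
    have g: "grow_inv K a n k t" using that by (simp add: I_def)
    note step = grow_tree_step[OF g conjunct2[OF b] a n]
    \<comment> \<open>The bound for the stuck state comes from the state before it: the old tree and
      \<open>cur t\<close> are \<open>Suc k\<close> columns with distinct rows.\<close>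
    have "Suc k \<le> D"
      if st: "stuck (val (grow_tree K a t))"
    proof -
      define T where "T = insert (cur t) (tree K t)"
      have m: "mate t 0 = Suc n" "matching {1..K} n (mate t)" "card (tree K t) = k"
        and nz: "\<And>j. j \<in> T \<Longrightarrow> mate t j \<noteq> 0" and c: "cur t \<le> K" "cur t \<notin> tree K t"
        using g b unfolding grow_inv_def T_def by auto
      have TK: "T \<subseteq> {0..K}" using c by (auto simp: T_def tree_def)
      then have "inj_on (mate t) T"
        by (intro inj_on_subset[OF tree_mates(1)[OF m(1,2)]]) (use nz in auto)
      moreover have "mate t ` T \<subseteq> {1..Suc n}"
        using tree_mates(2)[OF m(1,2)] nz TK by (auto simp: Suc_le_eq)
      ultimately have "card T \<le> card {1..Suc n}" by (intro card_inj_on_le) auto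
      moreover have "card T = Suc k" using m(3) c by (simp add: T_def tree_def)
      ultimately show ?thesis using n by simp
    qed
    then show ?thesis using step by (auto simp: I_def)
  qed
  ultimately obtain k where k: "I k (val s2)" "\<not> (\<not> stuck (val s2) \<and> mate (val s2) (cur (val s2)) \<noteq> 0)"
    "cost s2 \<le> k * Suc (2 * K + 1)"
    unfolding s2_def by (rule while_loop_rule[where I = I and B = D and C = "2 * K + 1"])
  have ir: "insert_row K a (Suc n) s =
     bind_timed s1 (\<lambda>s1. bind_timed (while_loop (\<lambda>s. \<not> stuck s \<and> mate s (cur s) \<noteq> 0) (grow_tree K a) s1)
       (\<lambda>s2. if stuck s2 then ret s2 else augment s2))"
    using inv'(1) by (simp add: insert_row_def s1_def del: upt_Suc)
  have kD: "k \<le> D" using bound[OF k(1)] .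
  have c2: "cost s2 \<le> D * (2 * K + 2)"
    using k(3) kD by (simp add: mult_le_mono1 order_trans del: mult_Suc_right)
  have s': "s' = (if stuck (val s2) then val s2 else val (augment (val s2)))"
    and cost': "cost (insert_row K a (Suc n) s) =
      cost s1 + (cost s2 + (if stuck (val s2) then 0 else cost (augment (val s2))))"
    by (simp_all add: s'_def ir s2_def)
  show "(stuck s' \<and> no_finite D K a) \<or> opt_inv K a (Suc n) s'"
    using k augment_matching(1)[of K a n k "val s2"] by (auto simp: I_def s' grow_inv_def)
  have "(if stuck (val s2) then 0 else cost (augment (val s2))) \<le> D"
    using k augment_matching(2)[of K a n k "val s2"] kD by (auto simp: I_def)
  then have "cost (insert_row K a (Suc n) s) \<le> K + 1 + (D * (2 * K + 2) + D)"
    unfolding cost' using cost1 c2 by linarith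
  then show "cost (insert_row K a (Suc n) s) \<le> K + 1 + D * (2 * K + 3)"
    by (simp add: algebra_simps)
qed

lemma hungarian_correct:
  assumes a: "\<And>r j. r \<in> {1..D} \<Longrightarrow> j \<in> {1..K} \<Longrightarrow> a r j \<noteq> -\<infinity>"
  shows "case val (hungarian D K a) of None \<Rightarrow> no_finite D K a
     | Some r \<Rightarrow> \<exists>s. opt_inv K a D s \<and> mate s = r"
    and "D \<ge> 1 \<Longrightarrow> K \<ge> 1 \<Longrightarrow> cost (hungarian D K a) \<le> 12 * (D\<^sup>2 * K)"
proof -
  define s0 where "s0 = \<lparr>pot_r = (\<lambda>_. 0), pot_c = (\<lambda>_. 0), mate = (\<lambda>_. 0), pred = (\<lambda>_. 0),
               slack = (\<lambda>_. \<infinity>), used = (\<lambda>_. False), cur = 0, nxt = 0, delta = \<infinity>, stuck = False\<rparr>"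
  define s1 where "s1 = for_loop [0..<D+1] (\<lambda>n s. ret (s\<lparr>pot_r := (pot_r s)(n := 0)\<rparr>)) s0"
  define s2 where "s2 = for_loop [0..<K+1]
             (\<lambda>j s. ret (s\<lparr>pot_c := (pot_c s)(j := 0), mate := (mate s)(j := 0)\<rparr>)) (val s1)"
  define s3 where "s3 = for_loop [1..<D+1] (insert_row K a) (val s2)"
  have s1: "val s1 = s0 \<and> cost s1 \<le> (D + 1 - 0) * Suc 0"
    unfolding s1_def by (rule for_loop_upt[where I = "\<lambda>_ s. s = s0"]) (auto simp: s0_def)
  have s2: "val s2 = s0 \<and> cost s2 \<le> (K + 1 - 0) * Suc 0"
    unfolding s2_def by (rule for_loop_upt[where I = "\<lambda>_ s. s = s0"]) (auto simp: s1, auto simp: s0_def)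
  \<comment> \<open>\<open>n\<close> is the next row to insert, hence \<open>n - 1\<close> rows are
    matched.\<close>
  define I where "I = (\<lambda>n s. (stuck s \<and> no_finite D K a) \<or> opt_inv K a (n - 1) s)"
  have "I (D+1) (val s3) \<and> cost s3 \<le> (D + 1 - 1) * Suc (K + 1 + D * (2 * K + 3))"
    unfolding s3_def
  proof (rule for_loop_upt)
    show "I 1 (val s2)"
      using s2 by (simp add: I_def opt_inv_def s0_def matching_def comp_slack_def bij_betw_def)
  next
    fix n s assume n: "1 \<le> n" "n < D + 1" and I: "I n s"
    show "I (Suc n) (val (insert_row K a n s)) \<and> cost (insert_row K a n s) \<le> K + 1 + D * (2 * K + 3)"
    proof (cases "stuck s")
      case True
      then show ?thesis using I by (simp add: I_def insert_row_def opt_inv_def)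
    next
      case False
      then have "opt_inv K a (n - 1) s" using I by (simp add: I_def)
      from insert_row_correct[OF this _ a, where ?D = D] show ?thesis using n by (simp add: I_def)
    qed
  qed simp
  then have s3: "I (D+1) (val s3)" "cost s3 \<le> D * Suc (K + 1 + D * (2 * K + 3))" by simp_all
  have h: "hungarian D K a = bind_timed s1 (\<lambda>s1. bind_timed (for_loop [0..<K+1]
             (\<lambda>j s. ret (s\<lparr>pot_c := (pot_c s)(j := 0), mate := (mate s)(j := 0)\<rparr>)) s1)
       (\<lambda>s2. bind_timed (for_loop [1..<D+1] (insert_row K a) s2)
       (\<lambda>s3. ret (if stuck s3 then None else Some (mate s3)))))"
    by (simp add: hungarian_def s1_def s0_def del: upt_Suc)
  have v: "val (hungarian D K a) = (if stuck (val s3) then None else Some (mate (val s3)))"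
    and c: "cost (hungarian D K a) = cost s1 + (cost s2 + cost s3)"
    by (simp_all add: h s2_def s3_def)
  show "case val (hungarian D K a) of None \<Rightarrow> no_finite D K a
     | Some r \<Rightarrow> \<exists>s. opt_inv K a D s \<and> mate s = r"
    using s3(1) by (auto simp: v I_def opt_inv_def)
  assume DK: "D \<ge> 1" "K \<ge> 1"
  have "cost (hungarian D K a) \<le> (D + 1) + (K + 1) + D * (K + 2 + D * (2 * K + 3))"
    using s1 s2 s3(2) by (simp add: c)
  also have "\<dots> \<le> 12 * (D\<^sup>2 * K)"
  proof -
    \<comment> \<open>In \<open>d\<close> and \<open>k\<close> the inequality holds coefficient by
      coefficient. At \<open>D = K = 1\<close> it is an equality, which is where 12 comes
      from.\<close>
    obtain d k where "D = Suc d" "K = Suc k" using DK by (metis Suc_le_D One_nat_def)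
    then show ?thesis by (simp add: power2_eq_square algebra_simps)
  qed
  finally show "cost (hungarian D K a) \<le> 12 * (D\<^sup>2 * K)" .
qed

section \<open>Linear programming duality for the assignment problem\<close>

text \<open>Weak duality. Row sums equal 1, so \<open>u\<close> may have any sign; a column may stay
  empty, so \<open>v\<close> has to be nonnegative.\<close>

lemma assignment_rate_le:
  assumes A: "A \<in> assignments D K"
    and le: "\<And>n i. n \<in> {1..D} \<Longrightarrow> i \<in> {1..K} \<Longrightarrow> R n i \<le> ereal (u n + v i)"
    and v: "\<And>i. i \<in> {1..K} \<Longrightarrow> 0 \<le> v i"
  shows "assignment_rate D K R A \<le> ereal ((\<Sum>n=1..D. u n) + (\<Sum>i=1..K. v i))"
proof -
  have "assignment_rate D K R A \<le> (\<Sum>i=1..K. \<Sum>n=1..D. ereal (real (A n i)) * ereal (u n + v i))"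
    unfolding assignment_rate_def using le by (intro sum_mono ereal_mult_left_mono) auto
  also have "\<dots> = ereal (\<Sum>i=1..K. \<Sum>n=1..D. real (A n i) * (u n + v i))" by simp
  also have "(\<Sum>i=1..K. \<Sum>n=1..D. real (A n i) * (u n + v i)) =
     (\<Sum>i=1..K. \<Sum>n=1..D. real (A n i) * u n) + (\<Sum>i=1..K. v i * real (\<Sum>n=1..D. A n i))"
    by (simp add: sum.distrib sum_distrib_left algebra_simps)
  also have "(\<Sum>i=1..K. \<Sum>n=1..D. real (A n i) * u n) = (\<Sum>n=1..D. u n * real (\<Sum>i=1..K. A n i))"
    by (subst sum.swap) (simp add: sum_distrib_left mult.commute)
  also have "\<dots> = (\<Sum>n=1..D. u n)"
    using A by (intro sum.cong refl) (simp add: assignments_def del: of_nat_sum)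
  also have "(\<Sum>i=1..K. v i * real (\<Sum>n=1..D. A n i)) \<le> (\<Sum>i=1..K. v i * 1)"
    using A v by (intro sum_mono mult_left_mono) (auto simp: assignments_def simp del: of_nat_sum)
  finally show ?thesis by simp
qed

lemma matrix_of_assignment:
  assumes ma: "matching {1..K} D r"
  shows "matrix_of r \<in> assignments D K"
    and "\<And>i. i \<in> {1..K} \<Longrightarrow> (\<Sum>n=1..D. matrix_of r n i) = (if r i = 0 then 0 else 1)"
proof -
  have b: "bij_betw r {j\<in>{1..K}. r j \<noteq> 0} {1..D}" using ma by (simp add: matching_def)
  have rle: "r i \<in> {1..D}" if "i \<in> {1..K}" "r i \<noteq> 0" for i
    using bij_betwE[OF b] that by auto
  show col: "(\<Sum>n=1..D. matrix_of r n i) = (if r i = 0 then 0 else 1)" if "i \<in> {1..K}" for i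
    using rle[OF that] by (cases "r i = 0") (simp_all add: matrix_of_def del: One_nat_def)
  have row: "(\<Sum>i=1..K. matrix_of r n i) = 1" if n: "n \<in> {1..D}" for n
  proof -
    have "n \<in> r ` {j\<in>{1..K}. r j \<noteq> 0}" using b n by (simp only: bij_betw_def)
    then obtain j where j: "j \<in> {1..K}" "r j = n" by blast
    have "matrix_of r n i = (if i = j then 1 else 0)" if "i \<in> {1..K}" for i
    proof -
      have "i = j" if "r i = n"
        by (rule inj_onD[OF bij_betw_imp_inj_on[OF b]])
           (use that j n \<open>i \<in> {1..K}\<close> in simp_all)
      then have "r i = n \<longleftrightarrow> i = j" using j by blast
      then show ?thesis by (simp only: matrix_of_def)
    qed
    then have "(\<Sum>i=1..K. matrix_of r n i) = (\<Sum>i=1..K. if i = j then 1 else 0)"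
      by (intro sum.cong) auto
    then show ?thesis using j by simp
  qed
  show "matrix_of r \<in> assignments D K"
    unfolding assignments_def using row col by (auto simp: matrix_of_def)
qed

text \<open>Costs are negated rates, so the negated potentials are a dual solution. Matched couples
  are tight and empty columns have potential 0, hence the matching reaches the dual value
  \<open>V\<close>. Tightness against real potentials also makes the selected entries
  finite.\<close>

lemma opt_inv_optimal:
  assumes inv: "opt_inv K a D s"
    and R: "\<And>n i. n \<in> {1..D} \<Longrightarrow> i \<in> {1..K} \<Longrightarrow> a n i = - R n i"
  shows "assignment_optimal D K R (matrix_of (mate s))"
    and "\<And>n i. n \<in> {1..D} \<Longrightarrow> i \<in> {1..K} \<Longrightarrow> mate s i = n \<Longrightarrow> \<bar>R n i\<bar> \<noteq> \<infinity>"
proof -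
  define V where "V = (\<Sum>n=1..D. - pot_r s n) + (\<Sum>i=1..K. - pot_c s i)"
  have ma: "matching {1..K} D (mate s)" and cs: "comp_slack K a 0 s"
    and feas: "\<And>r. r \<in> {1..D} \<Longrightarrow> feasible_row K a s r"
    using inv by (auto simp: opt_inv_def)
  note M = matrix_of_assignment[OF ma]
  have le: "R n i \<le> ereal (- pot_r s n + - pot_c s i)" if "n \<in> {1..D}" "i \<in> {1..K}" for n i
  proof -
    have "0 \<le> reduced a s n i" using feas[OF that(1)] that(2) by (simp add: feasible_row_def)
    then show ?thesis using R[OF that] by (cases "R n i") (auto simp: reduced_def)
  qed
  have eq: "R n i = ereal (- pot_r s n + - pot_c s i)"
    if "n \<in> {1..D}" "i \<in> {1..K}" "mate s i = n" for n i
  proof -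
    have "reduced a s n i = 0" using cs that by (auto simp: comp_slack_def)
    then show ?thesis using R[OF that(1,2)] by (cases "R n i") (auto simp: reduced_def)
  qed
  show "\<And>n i. n \<in> {1..D} \<Longrightarrow> i \<in> {1..K} \<Longrightarrow> mate s i = n \<Longrightarrow> \<bar>R n i\<bar> \<noteq> \<infinity>"
    using eq by simp
  have up: "assignment_rate D K R A \<le> ereal V" if "A \<in> assignments D K" for A
    unfolding V_def using le cs by (intro assignment_rate_le that) (auto simp: comp_slack_def)
  have "assignment_rate D K R (matrix_of (mate s)) = ereal V"
  proof -
    let ?A = "matrix_of (mate s)"
    have "assignment_rate D K R ?A =
       (\<Sum>i=1..K. \<Sum>n=1..D. ereal (real (?A n i)) * ereal (- pot_r s n + - pot_c s i))"
      unfolding assignment_rate_def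
      using eq by (intro sum.cong refl) (auto simp: matrix_of_def zero_ereal_def[symmetric])
    also have "\<dots> = ereal (\<Sum>i=1..K. \<Sum>n=1..D. real (?A n i) * (- pot_r s n + - pot_c s i))" by simp
    also have "(\<Sum>i=1..K. \<Sum>n=1..D. real (?A n i) * (- pot_r s n + - pot_c s i)) =
       (\<Sum>i=1..K. \<Sum>n=1..D. real (?A n i) * - pot_r s n) +
       (\<Sum>i=1..K. - pot_c s i * real (\<Sum>n=1..D. ?A n i))"
      by (simp add: sum.distrib sum_distrib_left algebra_simps sum_subtractf sum_negf)
    also have "(\<Sum>i=1..K. \<Sum>n=1..D. real (?A n i) * - pot_r s n) =
       (\<Sum>n=1..D. - pot_r s n * real (\<Sum>i=1..K. ?A n i))"
      by (subst sum.swap) (simp add: sum_distrib_left mult.commute sum_negf)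
    also have "\<dots> = (\<Sum>n=1..D. - pot_r s n)"
      using M(1) by (intro sum.cong refl) (simp add: assignments_def del: of_nat_sum)
    also have "(\<Sum>i=1..K. - pot_c s i * real (\<Sum>n=1..D. ?A n i)) = (\<Sum>i=1..K. - pot_c s i)"
    proof (intro sum.cong refl)
      fix i assume i: "i \<in> {1..K}"
      have "mate s i = 0 \<Longrightarrow> pot_c s i = 0" using cs i by (auto simp: comp_slack_def)
      then show "- pot_c s i * real (\<Sum>n=1..D. ?A n i) = - pot_c s i"
        unfolding M(2)[OF i] by auto
    qed
    finally show ?thesis by (simp add: V_def)
  qed
  then show "assignment_optimal D K R (matrix_of (mate s))"
    using M(1) up by (auto simp: is_arg_max_def not_less)
qed

section \<open>Assignments that select an infeasible couple\<close>

text \<open>In \<open>ereal\<close>, \<infinity> + -\<infinity> is \<infinity>; excluding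
  \<infinity> from all terms is what lets a single -\<infinity> decide the sum.\<close>

lemma ereal_sum_eq_MInfty:
  fixes f :: "'a \<Rightarrow> ereal"
  assumes "finite I" "i \<in> I" "f i = -\<infinity>" "\<And>j. j \<in> I \<Longrightarrow> f j \<noteq> \<infinity>"
  shows "sum f I = -\<infinity>"
proof -
  have "sum f (I - {i}) \<noteq> \<infinity>" using assms(4) by (auto simp: sum_Pinfty)
  then show ?thesis
    by (simp add: sum.remove[OF assms(1,2)] assms(3))
qed

lemma assignment_rate_MInfty:
  assumes fin: "\<And>n i. n \<in> {1..D} \<Longrightarrow> i \<in> {1..K} \<Longrightarrow> R n i \<noteq> \<infinity>"
    and ni: "n \<in> {1..D}" "i \<in> {1..K}" "A n i = 1" "R n i = -\<infinity>"
  shows "assignment_rate D K R A = -\<infinity>"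
proof -
  have neq: "ereal (real (A n i)) * R n i \<noteq> \<infinity>" if "n \<in> {1..D}" "i \<in> {1..K}" for n i
    using fin[OF that] by (cases "R n i") (auto simp: ereal_mult_eq_PInfty)
  have "(\<Sum>n=1..D. ereal (real (A n i)) * R n i) = -\<infinity>"
    by (rule ereal_sum_eq_MInfty[of _ n])
       (use ni neq in \<open>auto simp: one_ereal_def[symmetric]\<close>)
  moreover have "(\<Sum>n=1..D. ereal (real (A n i)) * R n i) \<noteq> \<infinity>" if "i \<in> {1..K}" for i
    unfolding sum_Pinfty using neq that by auto
  ultimately show ?thesis
    unfolding assignment_rate_def
    by (intro ereal_sum_eq_MInfty[where i = i and I = "{1..K}"]) (use ni(2) in auto)
qed

lemma no_finite_rate:
  assumes nf: "no_finite D K a" and A: "A \<in> assignments D K"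
    and R: "\<And>n i. n \<in> {1..D} \<Longrightarrow> i \<in> {1..K} \<Longrightarrow> a n i = - R n i"
    and fin: "\<And>n i. n \<in> {1..D} \<Longrightarrow> i \<in> {1..K} \<Longrightarrow> R n i \<noteq> \<infinity>"
  shows "assignment_rate D K R A = -\<infinity>"
proof -
  obtain n i where ni: "n \<in> {1..D}" "i \<in> {1..K}" "A n i = 1" "a n i = \<infinity>"
    using nf A unfolding no_finite_def by blast
  then have "R n i = -\<infinity>" using R[OF ni(1,2)] by (cases "R n i") auto
  then show ?thesis using ni by (intro assignment_rate_MInfty[OF fin])
qed

section \<open>Closed-form solutions\<close>

text \<open>Syntax trees of the solver are never written down: it suffices that the functions of a couple
  that have one are closed under the operations needed.\<close>

definition cf_fun :: "(couple \<Rightarrow> real) \<Rightarrow> bool" where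
  "cf_fun g \<longleftrightarrow> (\<exists>e. \<forall>c. val (eval_cf e c) = g c)"

text \<open>Expressions are real-valued, so a condition is represented by its indicator, which
  \<open>IfLe\<close> can compare with 1.\<close>

definition cf_pred :: "(couple \<Rightarrow> bool) \<Rightarrow> bool" where
  "cf_pred Q \<longleftrightarrow> cf_fun (\<lambda>c. if Q c then 1 else 0)"

definition cf_pair :: "(couple \<Rightarrow> real \<times> real) \<Rightarrow> bool" where
  "cf_pair p \<longleftrightarrow> cf_fun (\<lambda>c. fst (p c)) \<and> cf_fun (\<lambda>c. snd (p c))"

definition cf_triple :: "(couple \<Rightarrow> real \<times> real \<times> real) \<Rightarrow> bool" where
  "cf_triple l \<longleftrightarrow> cf_fun (\<lambda>c. fst (l c)) \<and> cf_pair (\<lambda>c. snd (l c))"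

lemma cf_param: "cf_fun (\<lambda>c. param_value c a)"
  unfolding cf_fun_def by (rule exI[of _ "Param a"]) simp

lemmas cf_params =
  cf_param[of Bw, simplified] cf_param[of Noise, simplified] cf_param[of Hd, simplified]
  cf_param[of Hbu, simplified] cf_param[of Hbd1, simplified] cf_param[of Hbd2, simplified]
  cf_param[of Hd1u, simplified] cf_param[of Hd2u, simplified] cf_param[of Eta1, simplified]
  cf_param[of Eta2, simplified] cf_param[of P1Max, simplified] cf_param[of P2Max, simplified]
  cf_param[of PuMax, simplified] cf_param[of RuMin, simplified]

lemma cf_of_int: "cf_fun (\<lambda>c. of_int k)"
  unfolding cf_fun_def by (rule exI[of _ "Num k"]) simp

lemma cf_zero: "cf_fun (\<lambda>c. 0)" and cf_one: "cf_fun (\<lambda>c. 1)"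
  and cf_numeral: "cf_fun (\<lambda>c. numeral w)"
  using cf_of_int[of 0] cf_of_int[of 1] cf_of_int[of "numeral w"] by simp_all

lemma cf_plus: "cf_fun f \<Longrightarrow> cf_fun g \<Longrightarrow> cf_fun (\<lambda>c. f c + g c)"
  unfolding cf_fun_def by (elim exE, rule_tac x = "Plus e ea" in exI) simp

lemma cf_minus: "cf_fun f \<Longrightarrow> cf_fun g \<Longrightarrow> cf_fun (\<lambda>c. f c - g c)"
  unfolding cf_fun_def by (elim exE, rule_tac x = "Minus e ea" in exI) simp

lemma cf_times: "cf_fun f \<Longrightarrow> cf_fun g \<Longrightarrow> cf_fun (\<lambda>c. f c * g c)"
  unfolding cf_fun_def by (elim exE, rule_tac x = "Times e ea" in exI) simp

lemma cf_divide: "cf_fun f \<Longrightarrow> cf_fun g \<Longrightarrow> cf_fun (\<lambda>c. f c / g c)"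
  unfolding cf_fun_def by (elim exE, rule_tac x = "Divide e ea" in exI) simp

lemma cf_sqrt: "cf_fun f \<Longrightarrow> cf_fun (\<lambda>c. sqrt (f c))"
  unfolding cf_fun_def by (elim exE, rule_tac x = "Sqrt e" in exI) simp

lemma cf_log: "cf_fun f \<Longrightarrow> cf_fun (\<lambda>c. log 2 (f c))"
  unfolding cf_fun_def by (elim exE, rule_tac x = "Log2 e" in exI) simp

lemma cf_powr: "cf_fun f \<Longrightarrow> cf_fun (\<lambda>c. 2 powr f c)"
  unfolding cf_fun_def by (elim exE, rule_tac x = "Exp2 e" in exI) simp

lemma cf_uminus: "cf_fun f \<Longrightarrow> cf_fun (\<lambda>c. - f c)"
  using cf_minus[OF cf_zero] by simp

lemma cf_if:
  assumes "cf_pred Q" "cf_fun f" "cf_fun g"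
  shows "cf_fun (\<lambda>c. if Q c then f c else g c)"
proof -
  obtain q e e' where "\<And>c. val (eval_cf q c) = (if Q c then 1 else 0)"
    "\<And>c. val (eval_cf e c) = f c" "\<And>c. val (eval_cf e' c) = g c"
    using assms unfolding cf_pred_def cf_fun_def by blast
  then show ?thesis
    unfolding cf_fun_def by (intro exI[of _ "IfLe (Num 1) q e e'"]) simp
qed

lemma cf_le: "cf_fun f \<Longrightarrow> cf_fun g \<Longrightarrow> cf_pred (\<lambda>c. f c \<le> g c)"
  unfolding cf_pred_def cf_fun_def
  by (elim exE, rule_tac x = "IfLe e ea (Num 1) (Num 0)" in exI) simp

lemma cf_not: "cf_pred Q \<Longrightarrow> cf_pred (\<lambda>c. \<not> Q c)"
  using cf_if[OF _ cf_zero cf_one, of Q] unfolding cf_pred_def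
  by (rule back_subst[of cf_fun]) auto

lemma cf_conj: "cf_pred Q \<Longrightarrow> cf_pred R \<Longrightarrow> cf_pred (\<lambda>c. Q c \<and> R c)"
  using cf_if[OF _ _ cf_zero, of Q "\<lambda>c. if R c then 1 else 0"] unfolding cf_pred_def
  by (rule back_subst[of cf_fun]) auto

lemma cf_disj: "cf_pred Q \<Longrightarrow> cf_pred R \<Longrightarrow> cf_pred (\<lambda>c. Q c \<or> R c)"
  using cf_not[OF cf_conj[OF cf_not cf_not], of Q R] by simp

lemma cf_less: "cf_fun f \<Longrightarrow> cf_fun g \<Longrightarrow> cf_pred (\<lambda>c. f c < g c)"
  using cf_not[OF cf_le, of g f] by (simp add: not_le)

lemma cf_eq: "cf_fun f \<Longrightarrow> cf_fun g \<Longrightarrow> cf_pred (\<lambda>c. f c = g c)"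
  using cf_conj[OF cf_le cf_le, of f g g f] by (simp add: order_eq_iff)

lemma cf_True: "cf_pred (\<lambda>c. True)" and cf_False: "cf_pred (\<lambda>c. False)"
  using cf_one cf_zero by (simp_all add: cf_pred_def)

lemma cf_max: "cf_fun f \<Longrightarrow> cf_fun g \<Longrightarrow> cf_fun (\<lambda>c. max (f c) (g c))"
  unfolding max_def by (intro cf_if cf_le)

lemma cf_min: "cf_fun f \<Longrightarrow> cf_fun g \<Longrightarrow> cf_fun (\<lambda>c. min (f c) (g c))"
  unfolding min_def by (intro cf_if cf_le)

lemma cf_fst: "cf_pair p \<Longrightarrow> cf_fun (\<lambda>c. fst (p c))" and cf_snd: "cf_pair p \<Longrightarrow> cf_fun (\<lambda>c. snd (p c))"
  by (simp_all add: cf_pair_def)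

lemma cf_pairI: "cf_fun f \<Longrightarrow> cf_fun g \<Longrightarrow> cf_pair (\<lambda>c. (f c, g c))"
  by (simp add: cf_pair_def)

lemma cf_pair_if: "cf_pred Q \<Longrightarrow> cf_pair p \<Longrightarrow> cf_pair q \<Longrightarrow> cf_pair (\<lambda>c. if Q c then p c else q c)"
  using cf_if[of Q "\<lambda>c. fst (p c)" "\<lambda>c. fst (q c)"] cf_if[of Q "\<lambda>c. snd (p c)" "\<lambda>c. snd (q c)"]
  unfolding cf_pair_def by (auto simp: if_distrib)

lemma cf_triple1: "cf_triple l \<Longrightarrow> cf_fun (\<lambda>c. fst (l c))"
  and cf_triple2: "cf_triple l \<Longrightarrow> cf_fun (\<lambda>c. fst (snd (l c)))"
  and cf_triple3: "cf_triple l \<Longrightarrow> cf_fun (\<lambda>c. snd (snd (l c)))"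
  by (simp_all add: cf_triple_def cf_pair_def)

lemma cf_tripleI: "cf_fun f \<Longrightarrow> cf_fun g \<Longrightarrow> cf_fun h \<Longrightarrow> cf_triple (\<lambda>c. (f c, g c, h c))"
  by (simp add: cf_triple_def cf_pair_def)

lemmas cf_intros = cf_params cf_zero cf_one cf_numeral cf_plus cf_minus cf_times cf_divide cf_uminus
  cf_sqrt cf_log cf_powr cf_if cf_le cf_less cf_eq cf_not cf_conj cf_disj cf_True cf_False cf_max cf_min
  cf_fst cf_snd cf_pairI cf_pair_if cf_triple1 cf_triple2 cf_triple3 cf_tripleI

text \<open>Exchanging the devices permutes the parameters, so it can be carried out at the leaves.
  This yields the second half of the slot from the first one, and order 2 from order 1.\<close>

lemma cf_swap:
  assumes "cf_fun f"
  shows "cf_fun (\<lambda>c. f (swap_devices c))"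
proof -
  obtain e where e: "\<And>c. val (eval_cf e c) = f c" using assms unfolding cf_fun_def by blast
  have "cf_fun (\<lambda>c. val (eval_cf e (swap_devices c)))"
  proof (induction e)
    case (Param a)
    show ?case by (cases a) (simp_all add: swap_devices_def cf_params)
  next
    case (IfLe e1 e2 e3 e4)
    then have "cf_fun (\<lambda>c. if val (eval_cf e1 (swap_devices c)) \<le> val (eval_cf e2 (swap_devices c))
       then val (eval_cf e3 (swap_devices c)) else val (eval_cf e4 (swap_devices c)))"
      by (intro cf_if cf_le)
    then show ?case by (auto elim!: back_subst[of cf_fun])
  qed (simp_all add: cf_intros cf_of_int)
  then show ?thesis by (simp add: e)
qed

lemma cf_pair_swap: "cf_pair p \<Longrightarrow> cf_pair (\<lambda>c. p (swap_devices c))"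
  unfolding cf_pair_def by (auto dest: cf_swap)

lemma bounded_cost:
  fixes f g :: "'a \<Rightarrow> nat" and D :: nat
  shows "\<exists>C. \<forall>c. f c \<le> C \<Longrightarrow> \<exists>C. \<forall>c. g c \<le> C \<Longrightarrow> \<exists>C. \<forall>c. f c + g c \<le> C"
    and "\<exists>C. \<forall>c. f c \<le> C \<Longrightarrow> \<exists>C. \<forall>c. Suc (f c) \<le> C"
    and "\<exists>C. \<forall>c. f c \<le> C \<Longrightarrow> \<exists>C. \<forall>c. g c \<le> C \<Longrightarrow> \<exists>C. \<forall>c. (if P c then f c else g c) \<le> C"
    and "\<exists>C. \<forall>c::'a. D \<le> C"
proof -
  show "\<exists>C. \<forall>c. f c \<le> C \<Longrightarrow> \<exists>C. \<forall>c. g c \<le> C \<Longrightarrow> \<exists>C. \<forall>c. f c + g c \<le> C"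
    by (meson add_mono)
  show "\<exists>C. \<forall>c. f c \<le> C \<Longrightarrow> \<exists>C. \<forall>c. Suc (f c) \<le> C" by (meson Suc_le_mono)
  show "\<exists>C. \<forall>c. f c \<le> C \<Longrightarrow> \<exists>C. \<forall>c. g c \<le> C \<Longrightarrow> \<exists>C. \<forall>c. (if P c then f c else g c) \<le> C"
  proof -
    assume "\<exists>C. \<forall>c. f c \<le> C" "\<exists>C. \<forall>c. g c \<le> C"
    then obtain C C' where "\<And>c. f c \<le> C" "\<And>c. g c \<le> C'" by blast
    then show ?thesis by (intro exI[of _ "max C C'"]) (simp add: max.coboundedI1 max.coboundedI2)
  qed
qed blast

text \<open>The couple influences the cost only through the branches taken, so a fixed expression
  takes bounded time.\<close>

lemma eval_cf_cost: "\<exists>C. \<forall>c. cost (eval_cf e c) \<le> C"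
  by (induction e; simp only: eval_cf.simps cost_tick cost_bind_timed cost_ret if_distrib[of cost])
     (assumption | rule bounded_cost)+

text \<open>Ties are resolved in favour of the elements of \<open>G\<close>.\<close>

primrec pick :: "('a \<Rightarrow> bool) \<Rightarrow> ('a \<Rightarrow> bool) \<Rightarrow> ('a \<Rightarrow> real) \<Rightarrow> 'a \<Rightarrow> 'a list \<Rightarrow> 'a" where
  "pick C G f d [] = d"
| "pick C G f d (p # ps) = (let q = pick C G f d ps in
     if C p \<and> (\<not> C q \<or> f q < f p \<or> (f q = f p \<and> G p)) then p else q)"

lemma pick_best:
  assumes "p \<in> set ps" "C p"
  shows "C (pick C G f d ps) \<and> f p \<le> f (pick C G f d ps) \<and>
    (f p = f (pick C G f d ps) \<longrightarrow> G p \<longrightarrow> G (pick C G f d ps))"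
  using assms by (induction ps) (auto simp: Let_def)

lemma cf_pick:
  assumes "\<And>p. p \<in> set ps \<Longrightarrow> cf_pair p" "cf_pair d"
    and "\<And>p. cf_pair p \<Longrightarrow> cf_pred (\<lambda>c. C c (p c))"
    and "\<And>p. cf_pair p \<Longrightarrow> cf_pred (\<lambda>c. G c (p c))"
    and "\<And>p. cf_pair p \<Longrightarrow> cf_fun (\<lambda>c. f c (p c))"
  shows "cf_pair (\<lambda>c. pick (C c) (G c) (f c) (d c) (map (\<lambda>p. p c) ps))"
  using assms(1)
proof (induction ps)
  case Nil
  then show ?case using assms(2) by simp
next
  case (Cons p ps)
  then have "cf_pair p" and q: "cf_pair (\<lambda>c. pick (C c) (G c) (f c) (d c) (map (\<lambda>p. p c) ps))"
    by auto
  then show ?case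
    unfolding list.map pick.simps Let_def
    by (intro cf_pair_if cf_conj cf_disj cf_not cf_less cf_eq assms(3,4,5))
qed

section \<open>Maximization over a polygon\<close>

text \<open>A triple \<open>(a, b, c)\<close> stands for the half-plane \<open>a * x + b * y \<le> c\<close> or for the
  affine function \<open>a * x + b * y + c\<close>.\<close>

type_synonym triple = "real \<times> real \<times> real"

abbreviation "on_line l p \<equiv> fst l * fst p + fst (snd l) * snd p = snd (snd l)"
abbreviation "direction l \<equiv> (- fst (snd l), fst l)"

definition polygon :: "(triple) list \<Rightarrow> (real \<times> real) set" where
  "polygon H = {p. \<forall>l\<in>set H. fst l * fst p + fst (snd l) * snd p \<le> snd (snd l)}"

definition affine_at :: "triple \<Rightarrow> real \<times> real \<Rightarrow> real" where
  "affine_at A p = fst A * fst p + fst (snd A) * snd p + snd (snd A)"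

definition sinr_prod ::
  "real \<Rightarrow> triple \<Rightarrow> triple \<Rightarrow> real \<times> real \<Rightarrow> real" where
  "sinr_prod h A B p = (1 + h * snd p / affine_at A p) * (1 + h * fst p / affine_at B p)"

text \<open>Cramer's rule. Parallel lines give \<open>(0, 0)\<close> through division by 0; as a
  candidate it is filtered like any other point.\<close>

definition vertex :: "triple \<Rightarrow> triple \<Rightarrow> real \<times> real" where
  "vertex l l' = ((snd (snd l) * fst (snd l') - snd (snd l') * fst (snd l)) /
      (fst l * fst (snd l') - fst l' * fst (snd l)),
    (fst l * snd (snd l') - fst l' * snd (snd l)) / (fst l * fst (snd l') - fst l' * fst (snd l)))"

text \<open>The foot of the perpendicular from the origin, moved by \<open>s\<close> times
  \<open>direction l\<close>.\<close>

definition line_point :: "triple \<Rightarrow> real \<Rightarrow> real \<times> real" where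
  "line_point l s =
    (fst l * snd (snd l) / (fst l * fst l + fst (snd l) * fst (snd l)) - s * fst (snd l),
     fst (snd l) * snd (snd l) / (fst l * fst l + fst (snd l) * fst (snd l)) + s * fst l)"

text \<open>The derivative of the affine function \<open>A\<close> along
  \<open>direction l\<close>.\<close>

definition slope :: "triple \<Rightarrow> triple \<Rightarrow> real" where
  "slope A l = fst (snd A) * fst l - fst A * fst (snd l)"

text \<open>Coefficients of the numerator of the derivative of
  \<open>(n0 + n1 * s) * (m0 + m1 * s) / ((a0 + a1 * s) * (b0 + b1 * s))\<close>, whose cubic term vanishes.\<close>

definition ratio_crit where
  "ratio_crit n0 n1 m0 m1 a0 a1 b0 b1 =
    ((n0 * m1 + n1 * m0) * (a0 * b0) - (n0 * m0) * (a0 * b1 + a1 * b0),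
     2 * ((n1 * m1) * (a0 * b0) - (n0 * m0) * (a1 * b1)),
     (n1 * m1) * (a0 * b1 + a1 * b0) - (n0 * m1 + n1 * m0) * (a1 * b1) :: real)"

definition line_crit ::
  "real \<Rightarrow> triple \<Rightarrow> triple \<Rightarrow> triple \<Rightarrow> triple" where
  "line_crit h A B l =
    ratio_crit (affine_at A (line_point l 0) + h * snd (line_point l 0)) (slope A l + h * fst l)
      (affine_at B (line_point l 0) + h * fst (line_point l 0)) (slope B l - h * fst (snd l))
      (affine_at A (line_point l 0)) (slope A l) (affine_at B (line_point l 0)) (slope B l)"

text \<open>With a zero leading coefficient the equation is linear. The sign of the discriminant is
  not tested, since a spurious value only adds a candidate.\<close>

definition quad_root :: "real \<Rightarrow> triple \<Rightarrow> real" where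
  "quad_root e q = (if snd (snd q) = 0 then - fst q / fst (snd q)
     else (- fst (snd q) + e * sqrt (fst (snd q) * fst (snd q) - 4 * snd (snd q) * fst q)) /
       (2 * snd (snd q)))"

definition candidates ::
  "real \<Rightarrow> triple \<Rightarrow> triple \<Rightarrow> (triple) list \<Rightarrow> (real \<times> real) list" where
  "candidates h A B H = [vertex l l'. l \<leftarrow> H, l' \<leftarrow> H] @
     [line_point l (quad_root 1 (line_crit h A B l)). l \<leftarrow> H] @
     [line_point l (quad_root (-1) (line_crit h A B l)). l \<leftarrow> H]"

section \<open>Critical points of a quotient of quadratic polynomials\<close>

lemma quad_rootI:
  fixes s :: real
  assumes "fst q + fst (snd q) * s + snd (snd q) * s\<^sup>2 = 0" "q \<noteq> (0, 0, 0)"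
  shows "s = quad_root 1 q \<or> s = quad_root (-1) q"
proof -
  obtain q0 q1 q2 where q: "q = (q0, q1, q2)" by (metis prod_cases3)
  have e: "q0 + q1 * s + q2 * s\<^sup>2 = 0" using assms(1) q by simp
  show ?thesis
  proof (cases "q2 = 0")
    case True
    then have "q1 \<noteq> 0" using assms(2) e q by auto
    then show ?thesis using e True q by (simp add: quad_root_def field_simps)
  next
    case False
    define w where "w = 2 * q2 * s + q1"
    have "w * w = q1 * q1 - 4 * q2 * q0 + 4 * q2 * (q0 + q1 * s + q2 * s\<^sup>2)"
      by (simp add: w_def algebra_simps power2_eq_square)
    then have "w\<^sup>2 = q1 * q1 - 4 * q2 * q0" using e by (simp add: power2_eq_square)
    then have "\<bar>w\<bar> = sqrt (q1 * q1 - 4 * q2 * q0)" by (metis real_sqrt_abs)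
    moreover have "s = (- q1 + w) / (2 * q2)" using False by (simp add: w_def)
    ultimately show ?thesis using False q by (auto simp: quad_root_def abs_if split: if_splits)
  qed
qed

text \<open>If \<open>M\<close> is the maximal quotient, then \<open>N - M * D\<close> has a local
  maximum at \<open>s\<close>, so only a polynomial is differentiated; eliminating \<open>M\<close>
  leaves the quadratic equation.\<close>

lemma ratio_crit_root:
  fixes n0 n1 m0 m1 a0 a1 b0 b1 s :: real
  defines "N \<equiv> \<lambda>t. (n0 + n1 * t) * (m0 + m1 * t)" and "D \<equiv> \<lambda>t. (a0 + a1 * t) * (b0 + b1 * t)"
  assumes e: "0 < e" and max: "\<And>t. \<bar>t - s\<bar> < e \<Longrightarrow> 0 < D t \<and> N t / D t \<le> N s / D s"
  defines "q \<equiv> ratio_crit n0 n1 m0 m1 a0 a1 b0 b1"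
  shows "fst q + fst (snd q) * s + snd (snd q) * s\<^sup>2 = 0"
proof -
  define M where "M = N s / D s"
  have Ds: "0 < D s" using max[of s] e by simp
  define N' where "N' = n0 * m1 + n1 * m0 + 2 * (n1 * m1) * s"
  define D' where "D' = a0 * b1 + a1 * b0 + 2 * (a1 * b1) * s"
  have "((\<lambda>t. N t - M * D t) has_real_derivative (N' - M * D')) (at s)"
    unfolding N_def D_def N'_def D'_def
    by (auto intro!: derivative_eq_intros simp: algebra_simps)
  moreover have "N t - M * D t \<le> N s - M * D s" if "\<bar>s - t\<bar> < e" for t
  proof -
    have "0 < D t" "N t / D t \<le> M" using max[of t] that by (simp_all add: M_def abs_minus_commute)
    moreover have "N s = M * D s" using Ds by (simp add: M_def)
    ultimately show ?thesis by (simp add: pos_divide_le_eq)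
  qed
  ultimately have "N' - M * D' = 0" using e by (intro DERIV_local_max) auto
  then have "N' * D s - N s * D' = 0" using Ds by (simp add: M_def field_simps)
  moreover have "fst q + fst (snd q) * s + snd (snd q) * s\<^sup>2 = N' * D s - N s * D'"
    by (simp add: q_def ratio_crit_def N'_def D'_def N_def D_def algebra_simps power2_eq_square)
  ultimately show ?thesis by simp
qed

text \<open>Up to a factor 2 in the middle one, the three coefficients are the 2 by 2 minors of the
  coefficient vectors of \<open>N\<close> and \<open>D\<close>. Where they vanish, these vectors are
  linearly dependent.\<close>

lemma ratio_crit_zero:
  fixes n0 n1 m0 m1 a0 a1 b0 b1 s t :: real
  defines "N \<equiv> \<lambda>t. (n0 + n1 * t) * (m0 + m1 * t)" and "D \<equiv> \<lambda>t. (a0 + a1 * t) * (b0 + b1 * t)"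
  assumes q: "ratio_crit n0 n1 m0 m1 a0 a1 b0 b1 = (0, 0, 0)"
  shows "N t * D s = N s * D t"
proof -
  have z: "(n0 * m1 + n1 * m0) * (a0 * b0) - (n0 * m0) * (a0 * b1 + a1 * b0) = 0"
    "(n1 * m1) * (a0 * b0) - (n0 * m0) * (a1 * b1) = 0"
    "(n1 * m1) * (a0 * b1 + a1 * b0) - (n0 * m1 + n1 * m0) * (a1 * b1) = 0"
    using q by (simp_all add: ratio_crit_def)
  have "N t * D s - N s * D t =
     (t - s) * ((n0 * m1 + n1 * m0) * (a0 * b0) - (n0 * m0) * (a0 * b1 + a1 * b0)) +
     (t\<^sup>2 - s\<^sup>2) * ((n1 * m1) * (a0 * b0) - (n0 * m0) * (a1 * b1)) +
     (t\<^sup>2 * s - s\<^sup>2 * t) * ((n1 * m1) * (a0 * b1 + a1 * b0) - (n0 * m1 + n1 * m0) * (a1 * b1))"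
    unfolding N_def D_def by algebra
  then show ?thesis unfolding z by simp
qed

section \<open>Where the maximizers of a polygon lie\<close>

text \<open>Active constraints stay equalities along \<open>d\<close>; the finitely many others hold
  strictly at \<open>q\<close> and survive small moves in both directions.\<close>

lemma polygon_move:
  assumes q: "q \<in> polygon H"
    and d: "\<And>l. l \<in> set H \<Longrightarrow> on_line l q \<Longrightarrow>
      fst l * fst d + fst (snd l) * snd d = 0"
  obtains e where "e > 0" "\<And>s. \<bar>s\<bar> < e \<Longrightarrow> q + s *\<^sub>R d \<in> polygon H"
proof -
  have "eventually (\<lambda>s. fst l * fst (q + s *\<^sub>R d) + fst (snd l) * snd (q + s *\<^sub>R d) \<le> snd (snd l)) (nhds 0)"
    if l: "l \<in> set H" for l
  proof (cases "on_line l q")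
    case True
    have "fst l * fst (q + s *\<^sub>R d) + fst (snd l) * snd (q + s *\<^sub>R d) = snd (snd l)" for s
    proof -
      have "fst l * fst (q + s *\<^sub>R d) + fst (snd l) * snd (q + s *\<^sub>R d) =
        (fst l * fst q + fst (snd l) * snd q) + s * (fst l * fst d + fst (snd l) * snd d)"
        by (simp add: algebra_simps)
      then show ?thesis using True d[OF l True] by simp
    qed
    then show ?thesis by simp
  next
    case False
    then have lt: "fst l * fst q + fst (snd l) * snd q < snd (snd l)"
      using q l by (force simp: polygon_def)
    have "((\<lambda>s. fst l * fst (q + s *\<^sub>R d) + fst (snd l) * snd (q + s *\<^sub>R d)) \<longlongrightarrow>
       fst l * fst (q + 0 *\<^sub>R d) + fst (snd l) * snd (q + 0 *\<^sub>R d)) (nhds 0)"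
      by (intro tendsto_intros filterlim_ident)
    then have "eventually (\<lambda>s. fst l * fst (q + s *\<^sub>R d) + fst (snd l) * snd (q + s *\<^sub>R d) < snd (snd l)) (nhds 0)"
      using lt by (auto dest: order_tendstoD(2))
    then show ?thesis by (rule eventually_mono) simp
  qed
  then have "eventually (\<lambda>s. \<forall>l\<in>set H. fst l * fst (q + s *\<^sub>R d) + fst (snd l) * snd (q + s *\<^sub>R d) \<le> snd (snd l)) (nhds 0)"
    by (intro eventually_ball_finite) auto
  then show thesis
    using that unfolding eventually_nhds_metric by (auto simp: polygon_def dist_real_def)
qed

lemma closed_polygon: "closed (polygon H)"
proof -
  have "polygon H = (\<Inter>l\<in>set H. {p. fst l * fst p + fst (snd l) * snd p \<le> snd (snd l)})"
    by (auto simp: polygon_def)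
  moreover have "closed {p :: real \<times> real. fst l * fst p + fst (snd l) * snd p \<le> snd (snd l)}" for l :: "triple"
    by (intro closed_Collect_le continuous_intros)
  ultimately show ?thesis by (metis (no_types, lifting) closed_INT)
qed

lemma vertexI:
  assumes "on_line l q"
    and "on_line l' q"
    and "fst l * fst (snd l') - fst l' * fst (snd l) \<noteq> 0"
  shows "q = vertex l l'"
  using assms(3) unfolding vertex_def assms(1,2)[symmetric]
  by (intro prod_eqI) (simp_all add: field_simps)

text \<open>The common setting of both full-duplex modes. Nonnegative slopes with a positive
  constant term keep the denominators positive on the quadrant and make the objective grow along
  rays.\<close>

locale sinr_polygon =
  fixes h :: real and A B :: "triple" and H :: "(triple) list"
  assumes h: "0 < h"
    and A: "0 \<le> fst A" "0 \<le> fst (snd A)" "0 < snd (snd A)"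
    and B: "0 \<le> fst B" "0 \<le> fst (snd B)" "0 < snd (snd B)"
    and quadrant: "\<And>p. p \<in> polygon H \<Longrightarrow> 0 \<le> fst p \<and> 0 \<le> snd p"
    and bounded: "bounded (polygon H)"
begin

lemma affine_pos:
  assumes "p \<in> polygon H"
  shows "0 < affine_at A p" "0 < affine_at B p"
  using quadrant[OF assms] A B by (auto simp: affine_at_def intro!: add_nonneg_pos)

lemma sinr_prod_eq:
  assumes "p \<in> polygon H"
  shows "sinr_prod h A B p = (affine_at A p + h * snd p) * (affine_at B p + h * fst p) /
    (affine_at A p * affine_at B p)"
  using affine_pos[OF assms] by (simp add: sinr_prod_def field_simps)

lemma sinr_line:
  defines "N \<equiv> \<lambda>l t. ((affine_at A (line_point l 0) + h * snd (line_point l 0)) + (slope A l + h * fst l) * t) *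
      ((affine_at B (line_point l 0) + h * fst (line_point l 0)) + (slope B l - h * fst (snd l)) * t)"
    and "D \<equiv> \<lambda>l t. (affine_at A (line_point l 0) + slope A l * t) * (affine_at B (line_point l 0) + slope B l * t)"
  assumes "line_point l t \<in> polygon H"
  shows "0 < D l t" "sinr_prod h A B (line_point l t) = N l t / D l t"
proof -
  have *: "affine_at A (line_point l t) = affine_at A (line_point l 0) + slope A l * t"
    "affine_at B (line_point l t) = affine_at B (line_point l 0) + slope B l * t"
    "snd (line_point l t) = snd (line_point l 0) + fst l * t"
    "fst (line_point l t) = fst (line_point l 0) - fst (snd l) * t"
    by (simp_all add: affine_at_def line_point_def slope_def algebra_simps)
  show "0 < D l t" using affine_pos[OF assms(3)] by (simp add: D_def *)
  show "sinr_prod h A B (line_point l t) = N l t / D l t"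
    unfolding sinr_prod_eq[OF assms(3)] N_def D_def * by (simp add: algebra_simps)
qed

lemma line_param:
  assumes "on_line l q" "(fst l, fst (snd l)) \<noteq> (0, 0)"
  obtains s where "\<And>t. line_point l (s + t) = q + t *\<^sub>R direction l"
proof -
  define w where "w = fst l * fst l + fst (snd l) * fst (snd l)"
  have w: "w \<noteq> 0" using assms(2) by (auto simp: w_def add_nonneg_eq_0_iff)
  define s where "s = (fst l * snd q - fst (snd l) * fst q) / w"
  have "fst l * snd (snd l) / w - s * fst (snd l) = fst q"
    unfolding assms(1)[symmetric] s_def using w by (simp add: field_simps) (simp add: w_def algebra_simps)
  moreover have "fst (snd l) * snd (snd l) / w + s * fst l = snd q"
    unfolding assms(1)[symmetric] s_def using w by (simp add: field_simps) (simp add: w_def algebra_simps)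
  ultimately have "line_point l (s + t) = q + t *\<^sub>R direction l" for t
    unfolding line_point_def w_def[symmetric] by (intro prod_eqI) (simp_all add: algebra_simps)
  then show thesis by (rule that)
qed

lemma maximizer_active:
  assumes q: "q \<in> polygon H" and max: "\<And>p. p \<in> polygon H \<Longrightarrow> sinr_prod h A B p \<le> sinr_prod h A B q"
  obtains l where "l \<in> set H" "(fst l, fst (snd l)) \<noteq> (0, 0)"
    "on_line l q"
proof -
  have "\<exists>l\<in>set H. (fst l, fst (snd l)) \<noteq> (0, 0) \<and> on_line l q"
  proof (rule ccontr)
    assume "\<not> ?thesis"
    \<comment> \<open>Degenerate constraints with zero normal vector do not restrict a move; they do
      occur, for instance in \<open>sic_H\<close>.\<close>
    then have "fst l * fst q + fst (snd l) * snd q \<noteq> snd (snd l) \<or> (fst l = 0 \<and> fst (snd l) = 0)"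
      if "l \<in> set H" for l
      using that by auto
    then have mv: "\<exists>e>0. \<forall>s. \<bar>s\<bar> < e \<longrightarrow> q + s *\<^sub>R d \<in> polygon H" for d
      using polygon_move[OF q, of d] by (metis add.right_neutral mult_zero_left)
    \<comment> \<open>Room in the direction \<open>(-1, -1)\<close> shows that both coordinates are
      positive, which makes the growth along the ray strict.\<close>
    obtain e where "e > 0" "\<And>s. \<bar>s\<bar> < e \<Longrightarrow> q + s *\<^sub>R (-1, -1) \<in> polygon H" using mv by blast
    then have "q + (e/2) *\<^sub>R (-1, -1) \<in> polygon H" by simp
    from quadrant[OF this] have pos: "0 < fst q" "0 < snd q" using \<open>e > 0\<close> by auto
    obtain e where e: "e > 0" "\<And>s. \<bar>s\<bar> < e \<Longrightarrow> q + s *\<^sub>R q \<in> polygon H" using mv by blast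
    define t where "t = 1 + e / 2"
    have t: "t > 1" using e by (simp add: t_def)
    have "q + (e/2) *\<^sub>R q \<in> polygon H" using e by simp
    then have tq: "t *\<^sub>R q \<in> polygon H" by (simp add: t_def scaleR_add_left)
    \<comment> \<open>The numerator grows by the factor \<open>t\<close>, the denominator by less
      because of its positive constant term.\<close>
    have lt: "h * z / affine_at W q < h * (t * z) / affine_at W (t *\<^sub>R q)"
      if "0 < z" "0 < affine_at W q" "0 < affine_at W (t *\<^sub>R q)" "0 < snd (snd W)" for z W
    proof -
      have "affine_at W (t *\<^sub>R q) = t * affine_at W q - (t - 1) * snd (snd W)"
        by (simp add: affine_at_def algebra_simps)
      moreover have "0 < (t - 1) * snd (snd W)" using t that by simp
      ultimately have "h * z * affine_at W (t *\<^sub>R q) < h * z * (t * affine_at W q)"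
        using that h by (intro mult_strict_left_mono) auto
      then show ?thesis using that by (simp add: field_simps)
    qed
    have "sinr_prod h A B q < sinr_prod h A B (t *\<^sub>R q)"
      unfolding sinr_prod_def
      using lt[of "snd q" A] lt[of "fst q" B] affine_pos[OF q] affine_pos[OF tq] A B pos h t
      by (intro mult_strict_mono) (auto intro!: add_pos_nonneg divide_nonneg_pos mult_nonneg_nonneg)
    then show False using max[OF tq] by simp
  qed
  then show thesis using that by blast
qed

text \<open>If the critical polynomial of an edge vanishes, the objective is constant on that line, and the
  maximizer can be moved to the end of the edge.\<close>

lemma maximizer_candidate:
  assumes q: "q \<in> polygon H" and max: "\<And>p. p \<in> polygon H \<Longrightarrow> sinr_prod h A B p \<le> sinr_prod h A B q"
  shows "q \<in> set (candidates h A B H) \<or>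
    (\<exists>l\<in>set H. on_line l q \<and> (fst l, fst (snd l)) \<noteq> (0, 0) \<and>
       line_crit h A B l = (0, 0, 0) \<and>
       (\<exists>v\<in>set (candidates h A B H) \<inter> polygon H. sinr_prod h A B v = sinr_prod h A B q))"
proof -
  obtain l where l: "l \<in> set H" "(fst l, fst (snd l)) \<noteq> (0, 0)"
    "on_line l q"
    using maximizer_active[OF q max] by blast
  obtain s where s: "\<And>t. line_point l (s + t) = q + t *\<^sub>R direction l"
    using line_param[OF l(3,2)] by blast
  \<comment> \<open>Either another active edge crosses \<open>l\<close> at \<open>p\<close>, or all
    active edges are parallel to \<open>l\<close> and \<open>p\<close> can move both ways along
    it.\<close>
  have vert: "p \<in> set (candidates h A B H) \<or>
      (\<exists>e>0. \<forall>t. \<bar>t\<bar> < e \<longrightarrow> p + t *\<^sub>R direction l \<in> polygon H)"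
    if p: "p \<in> polygon H" "on_line l p" for p
  proof (cases "\<exists>l'\<in>set H. on_line l' p \<and>
      fst l * fst (snd l') - fst l' * fst (snd l) \<noteq> 0")
    case True
    then obtain l' where l': "l' \<in> set H" "on_line l' p"
      "fst l * fst (snd l') - fst l' * fst (snd l) \<noteq> 0" by blast
    have "p = vertex l l'" by (rule vertexI[OF p(2) l'(2,3)])
    then show ?thesis using l(1) l'(1) by (auto simp: candidates_def)
  next
    case False
    then show ?thesis
      using polygon_move[OF p(1), of "direction l"] by (auto simp: algebra_simps)
  qed
  show ?thesis
  proof (cases "q \<in> set (candidates h A B H)")
    case False
    then obtain e where e: "e > 0" "\<And>t. \<bar>t\<bar> < e \<Longrightarrow> line_point l (s + t) \<in> polygon H"
      using vert[OF q l(3)] s by auto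
    have sq: "line_point l s = q" using s[of 0] by (simp add: zero_prod_def[symmetric])
    let ?q = "line_crit h A B l"
    have root: "fst ?q + fst (snd ?q) * s + snd (snd ?q) * s\<^sup>2 = 0"
      unfolding line_crit_def
    proof (rule ratio_crit_root[OF e(1)])
      fix t assume "\<bar>t - s\<bar> < e"
      then have t: "line_point l t \<in> polygon H" using e(2)[of "t - s"] by simp
      have s': "line_point l s \<in> polygon H" using sq q by simp
      show "0 < (affine_at A (line_point l 0) + slope A l * t) * (affine_at B (line_point l 0) + slope B l * t) \<and>
        (affine_at A (line_point l 0) + h * snd (line_point l 0) + (slope A l + h * fst l) * t) *
        (affine_at B (line_point l 0) + h * fst (line_point l 0) + (slope B l - h * fst (snd l)) * t) /
        ((affine_at A (line_point l 0) + slope A l * t) * (affine_at B (line_point l 0) + slope B l * t))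
        \<le> (affine_at A (line_point l 0) + h * snd (line_point l 0) + (slope A l + h * fst l) * s) *
        (affine_at B (line_point l 0) + h * fst (line_point l 0) + (slope B l - h * fst (snd l)) * s) /
        ((affine_at A (line_point l 0) + slope A l * s) * (affine_at B (line_point l 0) + slope B l * s))"
        using sinr_line(1)[OF t] max[OF t]
        unfolding sq[symmetric] sinr_line(2)[OF t] sinr_line(2)[OF s'] by blast
    qed
    have "?q = (0, 0, 0)"
    proof (rule ccontr)
      assume "?q \<noteq> (0, 0, 0)"
      from quad_rootI[OF root this] have "q \<in> set (candidates h A B H)"
        using l(1) unfolding candidates_def sq[symmetric] by auto
      then show False using False by simp
    qed
    moreover have "\<exists>v\<in>set (candidates h A B H) \<inter> polygon H. sinr_prod h A B v = sinr_prod h A B q"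
    proof -
      \<comment> \<open>The part of the edge on one side of \<open>q\<close>. It is compact, and its
        last point cannot be moved further, so it must be a candidate.\<close>
      define T where "T = {t. 0 \<le> t \<and> line_point l (s + t) \<in> polygon H}"
      have cont: "continuous_on UNIV (\<lambda>t. line_point l (s + t))"
        unfolding line_point_def by (intro continuous_intros)
      have "closed T"
        unfolding T_def
        by (intro closed_Collect_conj closed_Collect_le continuous_intros)
           (use closed_vimage[OF closed_polygon cont, of H] in \<open>simp add: vimage_def\<close>)
      moreover have "bounded T"
      proof -
        obtain b where b: "\<And>p. p \<in> polygon H \<Longrightarrow> norm p \<le> b"
          using bounded unfolding bounded_iff by blast
        define d where "d = direction l"
        have d: "norm d > 0" using l(2) by (auto simp: zero_prod_def d_def)
        have "norm t \<le> 2 * b / norm d" if "t \<in> T" for t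
        proof -
          have "norm (t *\<^sub>R d) = norm ((q + t *\<^sub>R d) - q)" by simp
          also have "\<dots> \<le> norm (q + t *\<^sub>R d) + norm q" by (rule norm_triangle_ineq4)
          also have "\<dots> \<le> b + b"
            using b[OF q] b[of "q + t *\<^sub>R d"] that s[of t] by (simp add: T_def d_def)
          finally have "\<bar>t\<bar> * norm d \<le> b + b" by (simp only: norm_scaleR)
          then show ?thesis using d by (simp add: field_simps)
        qed
        then show ?thesis unfolding bounded_iff by blast
      qed
      ultimately have "compact T" by (simp add: compact_eq_bounded_closed)
      moreover have "0 \<in> T" using q sq by (simp add: T_def)
      ultimately obtain t where t: "t \<in> T" "\<And>t'. t' \<in> T \<Longrightarrow> t' \<le> t"
        using compact_attains_sup[of T] by blast
      define v where "v = line_point l (s + t)"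
      have v: "v \<in> polygon H" "0 \<le> t" using t by (simp_all add: T_def v_def)
      have vl: "on_line l v"
        using l(3) unfolding v_def s by (simp add: algebra_simps)
      have "v \<in> set (candidates h A B H)"
      proof (rule ccontr)
        assume "v \<notin> set (candidates h A B H)"
        then obtain e where e: "e > 0" "\<And>u. \<bar>u\<bar> < e \<Longrightarrow> v + u *\<^sub>R direction l \<in> polygon H"
          using vert[OF v(1) vl] by blast
        have "v + (e/2) *\<^sub>R direction l = line_point l (s + (t + e / 2))"
          unfolding v_def s by (simp add: algebra_simps)
        then have "t + e / 2 \<in> T" using e(1) e(2)[of "e/2"] v(2) by (simp add: T_def)
        then show False using t(2) e(1) by fastforce
      qed
      moreover have "sinr_prod h A B v = sinr_prod h A B q"
      proof -
        have v': "line_point l (s + t) \<in> polygon H" and q': "line_point l s \<in> polygon H"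
          using v q sq by (simp_all add: v_def)
        show ?thesis
          using sinr_line(1)[OF v'] sinr_line(1)[OF q']
            ratio_crit_zero[OF \<open>?q = (0, 0, 0)\<close>[unfolded line_crit_def], of "s + t" s]
          unfolding v_def sq[symmetric] sinr_line(2)[OF v'] sinr_line(2)[OF q']
          by (subst frac_eq_eq) auto
      qed
      ultimately show ?thesis using v(1) by blast
    qed
    ultimately show ?thesis using l by blast
  qed simp
qed

lemma maximizer_exists:
  assumes "polygon H \<noteq> {}"
  obtains q where "q \<in> polygon H" "\<And>p. p \<in> polygon H \<Longrightarrow> sinr_prod h A B p \<le> sinr_prod h A B q"
proof -
  have "compact (polygon H)" using bounded closed_polygon by (simp add: compact_eq_bounded_closed)
  moreover have "continuous_on (polygon H) (sinr_prod h A B)"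
    unfolding sinr_prod_def affine_at_def
    using affine_pos unfolding affine_at_def
    by (intro continuous_intros) (auto simp: less_imp_neq[symmetric])
  ultimately show thesis using continuous_attains_sup[of "polygon H"] assms that by blast
qed

lemma sinr_prod_ge_1:
  assumes "p \<in> polygon H"
  shows "1 \<le> sinr_prod h A B p"
proof -
  have "1 * 1 \<le> sinr_prod h A B p"
    unfolding sinr_prod_def
    using affine_pos[OF assms] quadrant[OF assms] h by (intro mult_mono) auto
  then show ?thesis by simp
qed

text \<open>The third claim serves the strict modes: if no edge through a maximizer \<open>p\<close>
  has a vanishing critical polynomial, then \<open>p\<close> is itself a candidate, and the
  tie-breaking returns a point of \<open>G\<close> whenever \<open>p\<close> is one.\<close>

lemma pick_maximizer:
  fixes G d
  assumes ne: "polygon H \<noteq> {}"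
  defines "b \<equiv> pick (\<lambda>p. p \<in> polygon H) G (sinr_prod h A B) d (candidates h A B H)"
  shows "b \<in> polygon H"
    and "p \<in> polygon H \<Longrightarrow> sinr_prod h A B p \<le> sinr_prod h A B b"
    and "p \<in> polygon H \<Longrightarrow> G p \<Longrightarrow> sinr_prod h A B p = sinr_prod h A B b \<Longrightarrow>
      (\<And>l. l \<in> set H \<Longrightarrow> on_line l p \<Longrightarrow>
         (fst l, fst (snd l)) \<noteq> (0, 0) \<Longrightarrow> line_crit h A B l \<noteq> (0, 0, 0)) \<Longrightarrow> G b"
proof -
  obtain q where q: "q \<in> polygon H" "\<And>p. p \<in> polygon H \<Longrightarrow> sinr_prod h A B p \<le> sinr_prod h A B q"
    using maximizer_exists[OF ne] by blast
  then obtain v where v: "v \<in> set (candidates h A B H)" "v \<in> polygon H"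
    "sinr_prod h A B v = sinr_prod h A B q"
    using maximizer_candidate[OF q] by blast
  note P = pick_best[where C = "\<lambda>p. p \<in> polygon H" and f = "sinr_prod h A B" and G = G and d = d
      and ps = "candidates h A B H", folded b_def]
  show b: "b \<in> polygon H" using P[OF v(1,2)] by blast
  show bmax: "sinr_prod h A B p \<le> sinr_prod h A B b" if "p \<in> polygon H" for p
    using P[OF v(1,2)] q(2)[OF that] v(3) by simp
  assume p: "p \<in> polygon H" "G p" "sinr_prod h A B p = sinr_prod h A B b"
    and cr: "\<And>l. l \<in> set H \<Longrightarrow> on_line l p \<Longrightarrow>
         (fst l, fst (snd l)) \<noteq> (0, 0) \<Longrightarrow> line_crit h A B l \<noteq> (0, 0, 0)"
  have "p \<in> set (candidates h A B H)"
    using maximizer_candidate[OF p(1)] bmax p(3) cr by fastforce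
  then show "G b" using P[of p] p by blast
qed

end

section \<open>Closed forms for the candidates\<close>

lemma cf_line_point: "cf_triple l \<Longrightarrow> cf_fun s \<Longrightarrow> cf_pair (\<lambda>c. line_point (l c) (s c))"
  unfolding line_point_def by (intro cf_intros)

lemma cf_vertex: "cf_triple l \<Longrightarrow> cf_triple l' \<Longrightarrow> cf_pair (\<lambda>c. vertex (l c) (l' c))"
  unfolding vertex_def by (intro cf_intros)

lemma cf_affine_at: "cf_triple l \<Longrightarrow> cf_pair p \<Longrightarrow> cf_fun (\<lambda>c. affine_at (l c) (p c))"
  unfolding affine_at_def by (intro cf_intros)

lemma cf_slope: "cf_triple l \<Longrightarrow> cf_triple l' \<Longrightarrow> cf_fun (\<lambda>c. slope (l c) (l' c))"
  unfolding slope_def by (intro cf_intros)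

lemma cf_ratio_crit:
  assumes "cf_fun n0" "cf_fun n1" "cf_fun m0" "cf_fun m1" "cf_fun a0" "cf_fun a1" "cf_fun b0" "cf_fun b1"
  shows "cf_triple (\<lambda>c. ratio_crit (n0 c) (n1 c) (m0 c) (m1 c) (a0 c) (a1 c) (b0 c) (b1 c))"
  unfolding ratio_crit_def by (intro cf_intros assms)

lemma cf_quad_root: "cf_triple q \<Longrightarrow> cf_fun e \<Longrightarrow> cf_fun (\<lambda>c. quad_root (e c) (q c))"
  unfolding quad_root_def by (intro cf_intros)

lemma cf_sinr_prod:
  "cf_fun h \<Longrightarrow> cf_triple A \<Longrightarrow> cf_triple B \<Longrightarrow> cf_pair p \<Longrightarrow>
   cf_fun (\<lambda>c. sinr_prod (h c) (A c) (B c) (p c))"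
  unfolding sinr_prod_def by (intro cf_intros cf_affine_at)

lemma cf_line_crit:
  assumes "cf_fun h" "cf_triple A" "cf_triple B" "cf_triple l"
  shows "cf_triple (\<lambda>c. line_crit (h c) (A c) (B c) (l c))"
  unfolding line_crit_def
  by (intro cf_ratio_crit cf_plus cf_minus cf_times cf_affine_at cf_slope cf_line_point cf_fst cf_snd
      cf_triple1 cf_triple2 cf_zero assms)

lemma cf_polygon:
  assumes "\<And>l. l \<in> set Hs \<Longrightarrow> cf_triple l" "cf_pair p"
  shows "cf_pred (\<lambda>c. p c \<in> polygon (map (\<lambda>l. l c) Hs))"
  using assms(1)
proof (induction Hs)
  case Nil
  then show ?case by (simp add: polygon_def cf_True)
next
  case (Cons l Hs)
  have "cf_pred (\<lambda>c. fst (l c) * fst (p c) + fst (snd (l c)) * snd (p c) \<le> snd (snd (l c)) \<and>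
      p c \<in> polygon (map (\<lambda>l. l c) Hs))"
    using Cons by (intro cf_intros assms(2)) auto
  then show ?case by (simp add: polygon_def)
qed

text \<open>The edges are functions of the couple in a list of fixed length, so the candidates are
  too, and the selection unfolds to one expression.\<close>

lemma cf_polygon_pick:
  assumes h: "cf_fun h" "cf_triple A" "cf_triple B" and H: "\<And>l. l \<in> set Hs \<Longrightarrow> cf_triple l"
    and G: "\<And>p. cf_pair p \<Longrightarrow> cf_pred (\<lambda>c. G c (p c))"
  shows "cf_pair (\<lambda>c. pick (\<lambda>p. p \<in> polygon (map (\<lambda>l. l c) Hs)) (G c) (sinr_prod (h c) (A c) (B c)) (0, 0)
    (candidates (h c) (A c) (B c) (map (\<lambda>l. l c) Hs)))"
proof -
  define ps where "ps = [\<lambda>c. vertex (l c) (l' c). l \<leftarrow> Hs, l' \<leftarrow> Hs] @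
     [\<lambda>c. line_point (l c) (quad_root 1 (line_crit (h c) (A c) (B c) (l c))). l \<leftarrow> Hs] @
     [\<lambda>c. line_point (l c) (quad_root (-1) (line_crit (h c) (A c) (B c) (l c))). l \<leftarrow> Hs]"
  have "candidates (h c) (A c) (B c) (map (\<lambda>l. l c) Hs) = map (\<lambda>p. p c) ps" for c
    by (simp add: candidates_def ps_def map_concat comp_def)
  moreover have "cf_pair p" if "p \<in> set ps" for p
    using that H h unfolding ps_def
    by (auto intro!: cf_vertex cf_line_point cf_quad_root cf_line_crit cf_one cf_uminus)
  ultimately show ?thesis
    by (simp only:) (intro cf_pick cf_intros cf_polygon cf_sinr_prod assms)
qed

section \<open>Power allocation in the four modes\<close>

text \<open>The condition of \<open>is_solution\<close> for a feasible couple, freed from the modes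
  so that it can be transported along images, unions and products.\<close>

definition solves :: "'p::topological_space set \<Rightarrow> ('p \<Rightarrow> real) \<Rightarrow> 'p \<Rightarrow> bool" where
  "solves F r p \<longleftrightarrow> p \<in> closure F \<and> opt_value F r = ereal (r p) \<and>
     ((\<exists>q\<in>F. r q = r p) \<longrightarrow> p \<in> F)"

lemma opt_value_eq_ereal_iff:
  "opt_value F r = ereal v \<longleftrightarrow> (\<forall>q\<in>F. r q \<le> v) \<and> (\<forall>e>0. \<exists>q\<in>F. v - e < r q)"
proof
  assume *: "opt_value F r = ereal v"
  have "r q \<le> v" if "q \<in> F" for q
    using SUP_upper[OF that, of "\<lambda>p. ereal (r p)"] * by (simp add: opt_value_def)
  moreover have "\<exists>q\<in>F. v - e < r q" if "e > 0" for e
  proof -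
    have "ereal (v - e) < opt_value F r" using * that by simp
    then show ?thesis unfolding opt_value_def less_SUP_iff by simp
  qed
  ultimately show "(\<forall>q\<in>F. r q \<le> v) \<and> (\<forall>e>0. \<exists>q\<in>F. v - e < r q)" by blast
next
  assume *: "(\<forall>q\<in>F. r q \<le> v) \<and> (\<forall>e>0. \<exists>q\<in>F. v - e < r q)"
  show "opt_value F r = ereal v"
  proof (rule antisym)
    show "opt_value F r \<le> ereal v" unfolding opt_value_def using * by (auto intro: SUP_least)
    show "ereal v \<le> opt_value F r"
    proof (rule ereal_le_epsilon2)
      fix e :: real assume "0 < e"
      then obtain q where q: "q \<in> F" "v - e < r q" using * by blast
      then have "ereal v \<le> ereal (r q) + ereal e" by simp
      also have "\<dots> \<le> opt_value F r + ereal e"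
        unfolding opt_value_def using q(1) by (intro add_right_mono SUP_upper)
      finally show "ereal v \<le> opt_value F r + ereal e" .
    qed
  qed
qed

lemma solvesD:
  assumes "solves F r p"
  shows "p \<in> closure F" "\<And>q. q \<in> F \<Longrightarrow> r q \<le> r p" "\<And>e. e > 0 \<Longrightarrow> \<exists>q\<in>F. r p - e < r q"
    "\<And>q. q \<in> F \<Longrightarrow> r q = r p \<Longrightarrow> p \<in> F"
  using assms unfolding solves_def opt_value_eq_ereal_iff by blast+

lemma solves_memI:
  assumes "p \<in> F" "\<And>q. q \<in> F \<Longrightarrow> r q \<le> r p"
  shows "solves F r p"
proof -
  have "opt_value F r = ereal (r p)"
    unfolding opt_value_eq_ereal_iff using assms by (auto intro: bexI[of _ p])
  then show ?thesis using assms(1) closure_subset unfolding solves_def by blast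
qed

text \<open>For strict conditions: the optimum may lie on the boundary and is approached by feasible
  points.\<close>

lemma solves_limI:
  fixes p :: "'p::metric_space"
  assumes X: "\<And>n::nat. X n \<in> F" "X \<longlonglongrightarrow> p" "(\<lambda>n. r (X n)) \<longlonglongrightarrow> r p"
    and "\<And>q. q \<in> F \<Longrightarrow> r q \<le> r p" "\<And>q. q \<in> F \<Longrightarrow> r q = r p \<Longrightarrow> p \<in> F"
  shows "solves F r p"
proof -
  have "\<exists>q\<in>F. r p - e < r q" if "e > 0" for e
  proof -
    have "eventually (\<lambda>n. r p - e < r (X n)) sequentially"
      using order_tendstoD(1)[OF X(3), of "r p - e"] that by simp
    then show ?thesis using X(1) unfolding eventually_sequentially by blast
  qed
  then have "opt_value F r = ereal (r p)" unfolding opt_value_eq_ereal_iff using assms(4) by blast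
  moreover have "p \<in> closure F" using X(1,2) unfolding closure_sequential by blast
  ultimately show ?thesis unfolding solves_def using assms(5) by blast
qed

lemma opt_value_image: "opt_value (\<sigma> ` F) r = opt_value F (\<lambda>q. r (\<sigma> q))"
  unfolding opt_value_def by (simp add: image_image)

lemma opt_value_Un: "opt_value (F \<union> F') r = max (opt_value F r) (opt_value F' r)"
  unfolding opt_value_def by (simp add: SUP_union sup_max)

lemma solves_image:
  fixes \<sigma> :: "'p::topological_space \<Rightarrow> 'q::topological_space"
  assumes "continuous_on UNIV \<sigma>" "solves F (\<lambda>q. r (\<sigma> q)) p"
  shows "solves (\<sigma> ` F) r (\<sigma> p)"
proof -
  have "\<sigma> ` closure F \<subseteq> closure (\<sigma> ` F)"
    using assms(1) by (intro image_closure_subset) (auto intro: continuous_on_subset closure_subset[THEN subsetD])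
  then show ?thesis using assms(2) unfolding solves_def opt_value_image by blast
qed

text \<open>A tie goes to \<open>p\<close> only if \<open>p\<close> is feasible. Otherwise the
  common value is not attained in \<open>F\<close>, so any point attaining it lies in
  \<open>F'\<close> and makes \<open>p'\<close> feasible.\<close>

lemma solves_Un:
  assumes "solves F r p" "solves F' r p'"
  shows "solves (F \<union> F') r (if r p' < r p \<or> (r p' = r p \<and> p \<in> F) then p else p')"
proof -
  note D = solvesD[OF assms(1)] and D' = solvesD[OF assms(2)]
  have "opt_value (F \<union> F') r = ereal (max (r p) (r p'))"
    using assms unfolding opt_value_Un solves_def by simp
  then show ?thesis
    using D(1,4) D'(1,4) D(2) D'(2) unfolding solves_def closure_Un
    by (auto simp: max_def split: if_splits) fastforce+
qed

lemma solves_prod: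
  fixes F :: "'p::topological_space set" and F' :: "'q::topological_space set"
  assumes "solves F r p" "solves F' r' p'"
  shows "solves (F \<times> F') (\<lambda>q. 1/2 * r' (snd q) + 1/2 * r (fst q)) (p, p')"
proof -
  note D = solvesD[OF assms(1)] and D' = solvesD[OF assms(2)]
  have "opt_value (F \<times> F') (\<lambda>q. 1/2 * r' (snd q) + 1/2 * r (fst q)) = ereal (1/2 * r' p' + 1/2 * r p)"
    unfolding opt_value_eq_ereal_iff
  proof (intro conjI ballI allI impI)
    fix q assume "q \<in> F \<times> F'"
    then show "1/2 * r' (snd q) + 1/2 * r (fst q) \<le> 1/2 * r' p' + 1/2 * r p"
      using D(2)[of "fst q"] D'(2)[of "snd q"] by auto
  next
    fix e :: real assume "e > 0"
    then obtain q q' where "q \<in> F" "q' \<in> F'" "r p - e < r q" "r' p' - e < r' q'"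
      using D(3) D'(3) by meson
    then show "\<exists>q\<in>F \<times> F'. 1/2 * r' p' + 1/2 * r p - e < 1/2 * r' (snd q) + 1/2 * r (fst q)"
      by (intro bexI[of _ "(q, q')"]) auto
  qed
  \<comment> \<open>Neither component can exceed its supremum, so attaining the average means
    attaining both.\<close>
  moreover have "(p, p') \<in> F \<times> F'"
    if q: "q \<in> F \<times> F'" "1/2 * r' (snd q) + 1/2 * r (fst q) = 1/2 * r' p' + 1/2 * r p" for q
  proof -
    have m: "fst q \<in> F" "snd q \<in> F'" using q(1) by auto
    have "r (fst q) = r p" "r' (snd q) = r' p'" using D(2)[OF m(1)] D'(2)[OF m(2)] q(2) by linarith+
    then show ?thesis using D(4)[OF m(1)] D'(4)[OF m(2)] by simp
  qed
  ultimately show ?thesis using D(1) D'(1) unfolding solves_def closure_Times by auto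
qed

subsection \<open>Rates of a valid couple\<close>

lemma valid_coupleD:
  assumes "valid_couple c"
  shows "0 < bw c" "0 < noise c" "0 < h_d c" "0 < h_bu c" "0 < h_bd1 c" "0 < h_bd2 c"
    "0 < h_d1u c" "0 < h_d2u c" "0 \<le> eta1 c" "0 \<le> eta2 c" "0 < P1_max c" "0 < P2_max c"
    "0 < Pu_max c" "0 \<le> Ru_min c"
  using assms by (simp_all add: valid_couple_def)

lemma Pu_m_nonneg: "valid_couple c \<Longrightarrow> 0 \<le> Pu_m c"
  using valid_coupleD[of c] by (auto simp: Pu_m_def ge_one_powr_ge_zero intro!: mult_nonneg_nonneg divide_nonneg_pos)

lemma cf_Pu_m: "cf_fun Pu_m"
  unfolding Pu_m_def by (intro cf_intros)

lemma swap_simps [simp]: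
  "bw (swap_devices c) = bw c" "noise (swap_devices c) = noise c" "h_d (swap_devices c) = h_d c"
  "h_bu (swap_devices c) = h_bu c" "h_bd1 (swap_devices c) = h_bd2 c" "h_bd2 (swap_devices c) = h_bd1 c"
  "h_d1u (swap_devices c) = h_d2u c" "h_d2u (swap_devices c) = h_d1u c"
  "eta1 (swap_devices c) = eta2 c" "eta2 (swap_devices c) = eta1 c"
  "P1_max (swap_devices c) = P2_max c" "P2_max (swap_devices c) = P1_max c"
  "Pu_max (swap_devices c) = Pu_max c" "Ru_min (swap_devices c) = Ru_min c"
  "Pu_m (swap_devices c) = Pu_m c" "valid_couple (swap_devices c) = valid_couple c"
  by (auto simp: swap_devices_def Pu_m_def valid_couple_def)

text \<open>The rate formula solved for the power. Here \<open>d\<close> is interference plus noise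
  at the base station; for \<open>d = noise c\<close> the bound is \<open>Pu_m c\<close>.\<close>

lemma shannon_ge_Ru_min_iff:
  assumes c: "valid_couple c" and "0 \<le> x" "0 < d"
  shows "Ru_min c \<le> shannon c (x * h_bu c / d) \<longleftrightarrow> Pu_m c * d / noise c \<le> x"
proof -
  note v = valid_coupleD[OF c]
  have pos: "0 < 1 + x * h_bu c / d" using assms v by (intro add_pos_nonneg) auto
  have "Ru_min c \<le> shannon c (x * h_bu c / d) \<longleftrightarrow> Ru_min c / bw c \<le> log 2 (1 + x * h_bu c / d)"
    using v by (simp add: shannon_def field_simps)
  also have "\<dots> \<longleftrightarrow> 2 powr (Ru_min c / bw c) \<le> 1 + x * h_bu c / d"
    using pos by (simp add: le_log_iff)
  also have "\<dots> \<longleftrightarrow> (2 powr (Ru_min c / bw c) - 1) * d / h_bu c \<le> x"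
    using v assms(3) by (simp add: field_simps)
  also have "(2 powr (Ru_min c / bw c) - 1) * d / h_bu c = Pu_m c * d / noise c"
    using v by (simp add: Pu_m_def)
  finally show ?thesis .
qed

lemma shannon_mono: "0 < bw c \<Longrightarrow> 0 \<le> x \<Longrightarrow> x \<le> y \<Longrightarrow> shannon c x \<le> shannon c y"
  by (simp add: shannon_def)

lemma shannon_mono_iff: "0 < bw c \<Longrightarrow> 0 \<le> x \<Longrightarrow> 0 \<le> y \<Longrightarrow> shannon c x \<le> shannon c y \<longleftrightarrow> x \<le> y"
  by (simp add: shannon_def)

text \<open>Maximizing the sum of the two rates thus means maximizing
  \<open>sinr_prod\<close>.\<close>

lemma shannon_add:
  "0 \<le> x \<Longrightarrow> 0 \<le> y \<Longrightarrow> shannon c x + shannon c y = bw c * log 2 ((1 + x) * (1 + y))"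
  using log_mult_pos[of "1 + x" "1 + y" 2] unfolding shannon_def by (simp only: distrib_left)

lemma cf_shannon: "cf_fun f \<Longrightarrow> cf_fun (\<lambda>c. shannon c (f c))"
  unfolding shannon_def by (intro cf_intros)

text \<open>\<open>att\<close> marks the modes with weak constraints only, where the optimum is
  always attained. The feasibility test is the same in all modes. \<open>R\<close> is separate
  because the rate, too, must be a closed form.\<close>

definition solvable :: "bool \<Rightarrow> (couple \<Rightarrow> powers set) \<Rightarrow> (couple \<Rightarrow> powers \<Rightarrow> real) \<Rightarrow> bool" where
  "solvable att F r \<longleftrightarrow> (\<exists>P R. cf_pair (\<lambda>c. fst (P c)) \<and> cf_pair (\<lambda>c. snd (P c)) \<and> cf_fun R \<and>
     (\<forall>c. valid_couple c \<longrightarrow>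
        (if Pu_m c \<le> Pu_max c
         then solves (F c) (r c) (P c) \<and> r c (P c) = R c \<and> (att \<longrightarrow> P c \<in> F c) else F c = {})))"

subsection \<open>Full duplex without interference cancellation\<close>

text \<open>The least power of the cellular user that meets its target; any more only disturbs the
  devices.\<close>

definition nosic_Pu :: "couple \<Rightarrow> real \<times> real \<Rightarrow> real" where
  "nosic_Pu c p = Pu_m c * (fst p * h_bd1 c + snd p * h_bd2 c + noise c) / noise c"

text \<open>Interference plus noise at \<open>d1\<close> after substituting \<open>nosic_Pu\<close>;
  \<open>nosic_B\<close> is the same at \<open>d2\<close>.\<close>

definition nosic_A :: "couple \<Rightarrow> triple" where
  "nosic_A c = (Pu_m c * h_bd1 c / noise c * h_d1u c + eta1 c, Pu_m c * h_bd2 c / noise c * h_d1u c,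
     Pu_m c * h_d1u c + noise c)"

definition nosic_B :: "couple \<Rightarrow> triple" where
  "nosic_B c = (Pu_m c * h_bd1 c / noise c * h_d2u c, Pu_m c * h_bd2 c / noise c * h_d2u c + eta2 c,
     Pu_m c * h_d2u c + noise c)"

definition nosic_H :: "(couple \<Rightarrow> triple) list" where
  "nosic_H = [\<lambda>c. (-1, 0, 0), \<lambda>c. (0, -1, 0), \<lambda>c. (1, 0, P1_max c), \<lambda>c. (0, 1, P2_max c),
     \<lambda>c. (Pu_m c * h_bd1 c / noise c, Pu_m c * h_bd2 c / noise c, Pu_max c - Pu_m c)]"

abbreviation nosic_obj :: "couple \<Rightarrow> real \<times> real \<Rightarrow> real" where
  "nosic_obj c \<equiv> sinr_prod (h_d c) (nosic_A c) (nosic_B c)"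

lemma nosic_H_iff:
  assumes "valid_couple c"
  shows "p \<in> polygon (map (\<lambda>l. l c) nosic_H) \<longleftrightarrow>
    0 \<le> fst p \<and> fst p \<le> P1_max c \<and> 0 \<le> snd p \<and> snd p \<le> P2_max c \<and> nosic_Pu c p \<le> Pu_max c"
proof -
  have "nosic_Pu c p = Pu_m c * h_bd1 c / noise c * fst p + Pu_m c * h_bd2 c / noise c * snd p + Pu_m c"
    using valid_coupleD(2)[OF assms] by (simp add: nosic_Pu_def field_simps)
  then show ?thesis by (auto simp: polygon_def nosic_H_def)
qed

lemma bounded_polygon_box:
  assumes "\<And>p. p \<in> polygon H \<Longrightarrow> 0 \<le> fst p \<and> fst p \<le> a \<and> 0 \<le> snd p \<and> snd p \<le> b"
  shows "bounded (polygon H)"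
proof (rule bounded_subset)
  show "bounded ({0..a} \<times> {0..b})" by (intro bounded_Times bounded_closed_interval)
  show "polygon H \<subseteq> {0..a} \<times> {0..b}" using assms by (auto simp: mem_Times_iff)
qed

lemma solvable_fd_nosic: "solvable True fd_nosic_set fd_nosic_rate"
proof -
  define H where "H = (\<lambda>c. map (\<lambda>l. l c) nosic_H)"
  define p where "p = (\<lambda>c. pick (\<lambda>p. p \<in> polygon (H c)) (\<lambda>_. True)
     (nosic_obj c) (0, 0) (candidates (h_d c) (nosic_A c) (nosic_B c) (H c)))"
  define P where "P = (\<lambda>c. (p c, (nosic_Pu c (p c), nosic_Pu c (p c))))"
  define R where "R = (\<lambda>c. bw c * log 2 (nosic_obj c (p c)))"
  have cfA: "cf_triple nosic_A" and cfB: "cf_triple nosic_B"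
    unfolding nosic_A_def nosic_B_def by (intro cf_intros cf_Pu_m)+
  have cfp: "cf_pair p"
    unfolding p_def H_def
    by (intro cf_polygon_pick cf_params cfA cfB)
       (auto simp: nosic_H_def intro!: cf_intros cf_Pu_m)
  have "cf_pair (\<lambda>c. fst (P c))" "cf_pair (\<lambda>c. snd (P c))" "cf_fun R"
    unfolding P_def R_def nosic_Pu_def fst_conv snd_conv
    by (intro cf_intros cf_Pu_m cf_sinr_prod cfA cfB cfp)+
  moreover have "if Pu_m c \<le> Pu_max c
      then solves (fd_nosic_set c) (fd_nosic_rate c) (P c) \<and> fd_nosic_rate c (P c) = R c \<and>
        (True \<longrightarrow> P c \<in> fd_nosic_set c)
      else fd_nosic_set c = {}" if c: "valid_couple c" for c
  proof -
    note v = valid_coupleD[OF c] and m0 = Pu_m_nonneg[OF c]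
    have F: "((x, y), (u, u')) \<in> fd_nosic_set c \<longleftrightarrow> u' = u \<and> 0 \<le> x \<and> x \<le> P1_max c \<and> 0 \<le> y \<and> y \<le> P2_max c \<and>
        0 \<le> u \<and> u \<le> Pu_max c \<and> nosic_Pu c (x, y) \<le> u" for x y u u'
    proof (cases "0 \<le> x \<and> 0 \<le> y \<and> 0 \<le> u")
      case True
      then have "0 < x * h_bd1 c + y * h_bd2 c + noise c" using v by (intro add_nonneg_pos) auto
      then show ?thesis
        using True shannon_ge_Ru_min_iff[OF c, of u] by (auto simp: fd_nosic_set_def fd_box_def nosic_Pu_def)
    qed (auto simp: fd_nosic_set_def fd_box_def)
    have ge: "Pu_m c \<le> nosic_Pu c q" if "0 \<le> fst q" "0 \<le> snd q" for q
    proof -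
      have "Pu_m c * noise c \<le> Pu_m c * (fst q * h_bd1 c + snd q * h_bd2 c + noise c)"
        using that v m0 by (intro mult_left_mono) auto
      then show ?thesis using v by (simp add: nosic_Pu_def field_simps)
    qed
    show ?thesis
    proof (cases "Pu_m c \<le> Pu_max c")
      case True
      have inH: "q \<in> polygon (H c) \<longleftrightarrow> 0 \<le> fst q \<and> fst q \<le> P1_max c \<and> 0 \<le> snd q \<and> snd q \<le> P2_max c \<and>
          nosic_Pu c q \<le> Pu_max c" for q
        unfolding H_def by (rule nosic_H_iff[OF c])
      interpret sinr_polygon "h_d c" "nosic_A c" "nosic_B c" "H c"
      proof
        show "bounded (polygon (H c))" by (rule bounded_polygon_box) (auto simp: inH)
      qed (use v m0 in \<open>auto simp: nosic_A_def nosic_B_def inH intro!: add_nonneg_pos\<close>)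
      have "(0, 0) \<in> polygon (H c)" using v True by (simp add: inH nosic_Pu_def)
      then have ne: "polygon (H c) \<noteq> {}" by blast
      note best = pick_maximizer[OF ne, where G = "\<lambda>_. True" and d = "(0, 0)", folded p_def[unfolded fun_eq_iff, rule_format]]
      have aff: "affine_at (nosic_A c) q = nosic_Pu c q * h_d1u c + eta1 c * fst q + noise c"
        "affine_at (nosic_B c) q = nosic_Pu c q * h_d2u c + eta2 c * snd q + noise c" for q
        using v by (simp_all add: affine_at_def nosic_A_def nosic_B_def nosic_Pu_def field_simps)
      have pos: "0 < a * h_d1u c + eta1 c * fst q + noise c" "0 < a * h_d2u c + eta2 c * snd q + noise c"
        if "q \<in> polygon (H c)" "0 \<le> a" for q a
        using that v inH[of q] by (auto intro!: add_nonneg_pos)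
      \<comment> \<open>Lowering the power of the cellular user to \<open>nosic_Pu\<close> lowers
        neither device rate.\<close>
      have rate: "fd_nosic_rate c (q, (u, u')) \<le> bw c * log 2 (nosic_obj c q) \<and>
         (u = nosic_Pu c q \<longrightarrow> fd_nosic_rate c (q, (u, u')) = bw c * log 2 (nosic_obj c q))"
        if q: "q \<in> polygon (H c)" and u: "nosic_Pu c q \<le> u" for q u u'
      proof -
        have n0: "0 \<le> nosic_Pu c q" using ge[of q] m0 q inH[of q] by auto
        have nn: "0 \<le> fst q" "0 \<le> snd q" using q inH by auto
        note pos1 = pos[OF q n0] and pos2 = pos[OF q order_trans[OF n0 u]]
        have "fd_nosic_rate c (q, (u, u')) = shannon c (snd q * h_d c / (u * h_d1u c + eta1 c * fst q + noise c)) +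
           shannon c (fst q * h_d c / (u * h_d2u c + eta2 c * snd q + noise c))" by (cases q) simp
        moreover have "\<dots> \<le> shannon c (snd q * h_d c / (nosic_Pu c q * h_d1u c + eta1 c * fst q + noise c)) +
           shannon c (fst q * h_d c / (nosic_Pu c q * h_d2u c + eta2 c * snd q + noise c))"
          using pos1 pos2 nn v u
          by (intro add_mono shannon_mono divide_left_mono add_right_mono mult_right_mono)
             (auto intro!: divide_nonneg_pos)
        moreover have "shannon c (snd q * h_d c / (nosic_Pu c q * h_d1u c + eta1 c * fst q + noise c)) +
           shannon c (fst q * h_d c / (nosic_Pu c q * h_d2u c + eta2 c * snd q + noise c)) =
           bw c * log 2 (nosic_obj c q)"
          using pos1 nn v unfolding sinr_prod_def aff
          by (subst shannon_add) (auto intro!: divide_nonneg_pos simp: mult.commute)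
        ultimately show ?thesis by auto
      qed
      have PF: "P c \<in> fd_nosic_set c"
        using best(1) ge[of "p c"] m0 inH[of "p c"] unfolding P_def
        by (cases "p c") (auto simp: F)
      have "solves (fd_nosic_set c) (fd_nosic_rate c) (P c)"
      proof (rule solves_memI[OF PF])
        fix q assume "q \<in> fd_nosic_set c"
        moreover obtain x y u u' where "q = ((x, y), (u, u'))" by (metis surj_pair)
        ultimately have q: "q = ((x, y), (u, u))" "((x, y), (u, u)) \<in> fd_nosic_set c"
          using F by auto
        have xy: "(x, y) \<in> polygon (H c)" "nosic_Pu c (x, y) \<le> u" using q(2) by (auto simp: F inH)
        have "fd_nosic_rate c q \<le> bw c * log 2 (nosic_obj c (x, y))"
          using rate[OF xy] q(1) by blast
        also have "\<dots> \<le> bw c * log 2 (nosic_obj c (p c))"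
          using best(2)[OF xy(1)] sinr_prod_ge_1[OF xy(1)] sinr_prod_ge_1[OF best(1)] v by (intro mult_left_mono) auto
        also have "\<dots> = fd_nosic_rate c (P c)"
          using rate[OF best(1) order_refl] unfolding P_def by simp
        finally show "fd_nosic_rate c q \<le> fd_nosic_rate c (P c)" .
      qed
      moreover have "fd_nosic_rate c (P c) = R c"
        using rate[OF best(1) order_refl] unfolding P_def R_def by simp
      ultimately show ?thesis using True PF by simp
    next
      case False
      have "q \<notin> fd_nosic_set c" for q
        using F ge False by (cases q) force
      then show ?thesis using False by auto
    qed
  qed
  ultimately show ?thesis unfolding solvable_def by blast
qed

subsection \<open>Full duplex with interference cancellation\<close>

text \<open>The four multiplexing conditions of order 1 solved for the power of the cellular user:
  lower bounds \<open>sic_l1\<close>, \<open>sic_l2\<close> from the devices, upper bounds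
  \<open>sic_u1\<close>, \<open>sic_u2\<close> from the base station.\<close>

definition sic_l1 :: "couple \<Rightarrow> real \<times> real \<Rightarrow> real" where
  "sic_l1 c p = (h_d c * snd p + eta1 c * fst p) / h_d1u c"

definition sic_l2 :: "couple \<Rightarrow> real \<times> real \<Rightarrow> real" where
  "sic_l2 c p = (h_d c * fst p + eta2 c * snd p) / h_d2u c"

definition sic_u1 :: "couple \<Rightarrow> real \<times> real \<Rightarrow> real" where
  "sic_u1 c p = (h_bd2 c * snd p - h_bd1 c * fst p) / h_bu c"

definition sic_u2 :: "couple \<Rightarrow> real \<times> real \<Rightarrow> real" where
  "sic_u2 c p = h_bd1 c * fst p / h_bu c"

definition sic_lo :: "couple \<Rightarrow> real \<times> real \<Rightarrow> real" where
  "sic_lo c p = max (Pu_m c) (max (sic_l1 c p) (sic_l2 c p))"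

definition sic_hi :: "couple \<Rightarrow> real \<times> real \<Rightarrow> real" where
  "sic_hi c p = min (Pu_max c) (min (sic_u1 c p) (sic_u2 c p))"

text \<open>If any power of the cellular user satisfies the strict conditions, then so does the midpoint.\<close>

definition sic_Pu :: "couple \<Rightarrow> real \<times> real \<Rightarrow> real" where
  "sic_Pu c p = (sic_lo c p + sic_hi c p) / 2"

text \<open>Fourier-Motzkin elimination of this power: each of three lower bounds lies below each of
  three upper bounds. The caps of the devices follow.\<close>

definition sic_H :: "(couple \<Rightarrow> triple) list" where
  "sic_H = [\<lambda>c. (fst (l c) - fst (u c), fst (snd (l c)) - fst (snd (u c)), snd (snd (u c)) - snd (snd (l c))).
       l \<leftarrow> [\<lambda>c. (0, 0, Pu_m c), \<lambda>c. (eta1 c / h_d1u c, h_d c / h_d1u c, 0),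
              \<lambda>c. (h_d c / h_d2u c, eta2 c / h_d2u c, 0)],
       u \<leftarrow> [\<lambda>c. (0, 0, Pu_max c), \<lambda>c. (- h_bd1 c / h_bu c, h_bd2 c / h_bu c, 0),
              \<lambda>c. (h_bd1 c / h_bu c, 0, 0)]] @
     [\<lambda>c. (1, 0, P1_max c), \<lambda>c. (0, 1, P2_max c)]"

lemma sic_H_iff:
  "p \<in> polygon (map (\<lambda>l. l c) sic_H) \<longleftrightarrow> sic_lo c p \<le> sic_hi c p \<and> fst p \<le> P1_max c \<and> snd p \<le> P2_max c"
  by (simp add: polygon_def sic_H_def sic_lo_def sic_hi_def sic_l1_def sic_l2_def sic_u1_def sic_u2_def
      algebra_simps add_divide_distrib diff_divide_distrib) (auto simp: algebra_simps)

lemma fd_sic_set1_iff: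
  assumes c: "valid_couple c"
  shows "((x, y), (u, u')) \<in> fd_sic_set1 c \<longleftrightarrow> u' = u \<and> x \<le> P1_max c \<and> y \<le> P2_max c \<and>
    Pu_m c \<le> u \<and> u \<le> Pu_max c \<and> sic_l1 c (x, y) < u \<and> sic_l2 c (x, y) < u \<and>
    u < sic_u1 c (x, y) \<and> u < sic_u2 c (x, y)"
proof -
  note v = valid_coupleD[OF c] and m0 = Pu_m_nonneg[OF c]
  have 1: "sic_l1 c (x, y) < u \<longleftrightarrow> y * h_d c + x * eta1 c < u * h_d1u c"
    "sic_l2 c (x, y) < u \<longleftrightarrow> x * h_d c + y * eta2 c < u * h_d2u c"
    "u < sic_u1 c (x, y) \<longleftrightarrow> x * h_bd1 c + u * h_bu c < y * h_bd2 c"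
    "u < sic_u2 c (x, y) \<longleftrightarrow> u * h_bu c < x * h_bd1 c"
    using v by (simp_all add: sic_l1_def sic_l2_def sic_u1_def sic_u2_def field_simps)
  have 2: "Ru_min c \<le> shannon c (u * h_bu c / noise c) \<longleftrightarrow> Pu_m c \<le> u" if "0 \<le> u"
    using shannon_ge_Ru_min_iff[OF c that v(2)] v by simp
  \<comment> \<open>A nonnegative \<open>u\<close> makes the device powers positive through the
    decoding conditions of the base station.\<close>
  have 3: "0 \<le> x \<and> 0 \<le> y" if "0 \<le> u" "u * h_bu c < x * h_bd1 c" "x * h_bd1 c + u * h_bu c < y * h_bd2 c"
  proof -
    have "0 \<le> u * h_bu c" using that v by simp
    then have "0 < x * h_bd1 c" "0 < y * h_bd2 c" using that by linarith+
    then show ?thesis using v by (simp add: zero_less_mult_iff)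
  qed
  show ?thesis
    unfolding 1 using 2 3 m0 by (auto simp: fd_sic_set1_def fd_sic_common_def fd_box_def)
qed

text \<open>At \<open>(x0, y0)\<close> both decoding conditions of the base station are equalities
  for the power \<open>u\<close>. The inequalities of \<open>order1_possible\<close> say that the
  other multiplexing conditions hold strictly there and, for \<open>u = Pu_m c\<close>, that the
  caps of the devices do. A slight inflation of the device powers makes the equalities
  strict.\<close>

lemma order1_feasible:
  assumes c: "valid_couple c" and o: "order1_possible c" and m: "Pu_m c \<le> Pu_max c"
  obtains x y u where "((x, y), (u, u)) \<in> fd_sic_set1 c"
proof -
  note v = valid_coupleD[OF c] and m0 = Pu_m_nonneg[OF c]
  obtain u where u: "0 < u" "Pu_m c \<le> u" "u \<le> Pu_max c" "u * h_bu c / h_bd1 c < P1_max c"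
    "2 * u * h_bu c / h_bd2 c < P2_max c"
  proof (cases "Pu_m c = 0")
    case False
    show thesis by (rule that[of "Pu_m c"]) (use False m0 m o in \<open>auto simp: order1_possible_def\<close>)
  next
    case True
    \<comment> \<open>With a zero target any small positive power will do. The last two terms are
      half of the values at which the caps would be reached.\<close>
    define u where "u = min (Pu_max c) (min (P1_max c * h_bd1 c / (2 * h_bu c)) (P2_max c * h_bd2 c / (4 * h_bu c)))"
    have "0 < u" using v by (simp add: u_def)
    moreover have "u \<le> Pu_max c" by (simp add: u_def)
    moreover have "u \<le> P1_max c * h_bd1 c / (2 * h_bu c)" "u \<le> P2_max c * h_bd2 c / (4 * h_bu c)"
      by (auto simp: u_def min_le_iff_disj)
    then have "2 * (u * h_bu c) \<le> P1_max c * h_bd1 c" "2 * (2 * u * h_bu c) \<le> P2_max c * h_bd2 c"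
      using v by (simp_all add: field_simps)
    moreover have "0 < P1_max c * h_bd1 c" "0 < P2_max c * h_bd2 c" using v by simp_all
    ultimately have "0 < u" "u \<le> Pu_max c" "u * h_bu c < P1_max c * h_bd1 c"
      "2 * u * h_bu c < P2_max c * h_bd2 c" by linarith+
    then show thesis
      using True v by (intro that[of u]) (auto simp: divide_less_eq)
  qed
  define x0 where "x0 = u * h_bu c / h_bd1 c"
  define y0 where "y0 = 2 * u * h_bu c / h_bd2 c"
  have l1: "sic_l1 c (x0, y0) < u"
  proof -
    have "2 * h_bu c * h_d c * h_bd1 c / h_bd2 c + eta1 c * h_bu c < h_bd1 c * h_d1u c"
      using o by (simp add: order1_possible_def)
    then have "u * (2 * h_bu c * h_d c * h_bd1 c / h_bd2 c + eta1 c * h_bu c) < u * (h_bd1 c * h_d1u c)"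
      using u(1) by (rule mult_strict_left_mono)
    then show ?thesis using v by (simp add: sic_l1_def x0_def y0_def field_simps)
  qed
  have l2: "sic_l2 c (x0, y0) < u"
  proof -
    have "2 * h_bu c * eta2 c * h_bd1 c / h_bd2 c + h_bu c * h_d c < h_bd1 c * h_d2u c"
      using o by (simp add: order1_possible_def)
    then have "u * (2 * h_bu c * eta2 c * h_bd1 c / h_bd2 c + h_bu c * h_d c) < u * (h_bd1 c * h_d2u c)"
      using u(1) by (rule mult_strict_left_mono)
    then show ?thesis using v by (simp add: sic_l2_def x0_def y0_def field_simps)
  qed
  have ev: "eventually (\<lambda>e. (1 + e) * a < b) (at_right 0)" if "a < b" for a b :: real
  proof -
    have "((\<lambda>e. (1 + e) * a) \<longlongrightarrow> (1 + 0) * a) (at_right 0)" by (intro tendsto_intros)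
    then show ?thesis using that by (auto dest: order_tendstoD(2))
  qed
  \<comment> \<open>The bounds are homogeneous in the device powers: scaling by \<open>1 + e\<close>
    lifts the upper ones above \<open>u\<close>, while the strict inequalities for the lower ones
    survive for small \<open>e\<close>.\<close>
  have "eventually (\<lambda>e. 0 < e \<and> (1 + e) * x0 < P1_max c \<and> (1 + e) * y0 < P2_max c \<and>
      (1 + e) * sic_l1 c (x0, y0) < u \<and> (1 + e) * sic_l2 c (x0, y0) < u) (at_right (0::real))"
    using l1 l2 u by (intro eventually_conj ev) (auto simp: x0_def y0_def eventually_at_right_less)
  then obtain e where e: "0 < e" "(1 + e) * x0 < P1_max c" "(1 + e) * y0 < P2_max c"
      "(1 + e) * sic_l1 c (x0, y0) < u" "(1 + e) * sic_l2 c (x0, y0) < u"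
    by (auto dest!: eventually_happens simp: trivial_limit_at_right_real)
  have "sic_l1 c ((1 + e) * x0, (1 + e) * y0) = (1 + e) * sic_l1 c (x0, y0)"
    "sic_l2 c ((1 + e) * x0, (1 + e) * y0) = (1 + e) * sic_l2 c (x0, y0)"
    using v by (simp_all add: sic_l1_def sic_l2_def field_simps)
  moreover have "sic_u1 c ((1 + e) * x0, (1 + e) * y0) = (1 + e) * u"
    "sic_u2 c ((1 + e) * x0, (1 + e) * y0) = (1 + e) * u"
    using v by (simp_all add: sic_u1_def sic_u2_def x0_def y0_def field_simps)
  ultimately have "(((1 + e) * x0, (1 + e) * y0), (u, u)) \<in> fd_sic_set1 c"
    unfolding fd_sic_set1_iff[OF c] using e u by auto
  then show thesis by (rule that)
qed

lemma sic_Pu_strict: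
  assumes "((x, y), (u, u)) \<in> fd_sic_set1 c" and c: "valid_couple c"
  shows "sic_lo c (x, y) \<le> sic_hi c (x, y)"
    "((x, y), (sic_Pu c (x, y), sic_Pu c (x, y))) \<in> fd_sic_set1 c"
proof -
  note F = fd_sic_set1_iff[OF c]
  have "sic_lo c (x, y) \<le> u" "u \<le> sic_hi c (x, y)"
    using assms(1) unfolding F sic_lo_def sic_hi_def by auto
  moreover have "Pu_m c \<le> sic_lo c (x, y)" "sic_l1 c (x, y) \<le> sic_lo c (x, y)" "sic_l2 c (x, y) \<le> sic_lo c (x, y)"
    "sic_hi c (x, y) \<le> Pu_max c" "sic_hi c (x, y) \<le> sic_u1 c (x, y)" "sic_hi c (x, y) \<le> sic_u2 c (x, y)"
    by (auto simp: sic_lo_def sic_hi_def)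
  ultimately show "sic_lo c (x, y) \<le> sic_hi c (x, y)"
    "((x, y), (sic_Pu c (x, y), sic_Pu c (x, y))) \<in> fd_sic_set1 c"
    using assms(1) unfolding F sic_Pu_def by auto
qed

text \<open>The weak inequalities describe the closure, by convexity.\<close>

lemma fd_sic_set1_segment:
  assumes c: "valid_couple c" and q: "((x', y'), (u', u')) \<in> fd_sic_set1 c"
    and p: "x \<le> P1_max c" "y \<le> P2_max c" "Pu_m c \<le> u" "u \<le> Pu_max c" "sic_l1 c (x, y) \<le> u"
      "sic_l2 c (x, y) \<le> u" "u \<le> sic_u1 c (x, y)" "u \<le> sic_u2 c (x, y)"
    and t: "0 < t" "t \<le> 1"
  shows "((x + t * (x' - x), y + t * (y' - y)), (u + t * (u' - u), u + t * (u' - u))) \<in> fd_sic_set1 c"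
proof -
  note v = valid_coupleD[OF c]
  have le: "a + t * (a' - a) \<le> b + t * (b' - b)" if "a \<le> b" "a' \<le> b'" for a a' b b' :: real
  proof -
    have "0 \<le> (1 - t) * (b - a)" "0 \<le> t * (b' - a')" using that t by simp_all
    then show ?thesis by (simp add: algebra_simps)
  qed
  have less: "a + t * (a' - a) < b + t * (b' - b)" if "a \<le> b" "a' < b'" for a a' b b' :: real
  proof -
    have "0 \<le> (1 - t) * (b - a)" "0 < t * (b' - a')" using that t by simp_all
    then show ?thesis by (simp add: algebra_simps)
  qed
  have aff: "f c (x + t * (x' - x), y + t * (y' - y)) = f c (x, y) + t * (f c (x', y') - f c (x, y))"
    if "f \<in> {sic_l1, sic_l2, sic_u1, sic_u2}" for f
    using that v by (auto simp: sic_l1_def sic_l2_def sic_u1_def sic_u2_def field_simps)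
  note F = fd_sic_set1_iff[OF c]
  show ?thesis
    using q less[OF p(5)] less[OF p(6)] less[OF p(7)] less[OF p(8)]
      le[OF p(1), of x' "P1_max c"] le[OF p(2), of y' "P2_max c"] le[OF p(3), of "Pu_m c" u']
      le[OF p(4), of u' "Pu_max c"]
    unfolding F by (simp add: aff)
qed

definition sic_A :: "couple \<Rightarrow> triple" where "sic_A c = (eta1 c, 0, noise c)"
definition sic_B :: "couple \<Rightarrow> triple" where "sic_B c = (0, eta2 c, noise c)"

abbreviation sic_obj :: "couple \<Rightarrow> real \<times> real \<Rightarrow> real" where
  "sic_obj c \<equiv> sinr_prod (h_d c) (sic_A c) (sic_B c)"

text \<open>On the edge of a power cap the numerator of the objective has a larger degree than the
  denominator, so the quotient is not constant. These are the only edges that a strict solution can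
  meet.\<close>

lemma sic_line_crit:
  assumes c: "valid_couple c" and "0 < w"
  shows "line_crit (h_d c) (sic_A c) (sic_B c) (1, 0, w) \<noteq> (0, 0, 0)"
    and "line_crit (h_d c) (sic_A c) (sic_B c) (0, 1, w) \<noteq> (0, 0, 0)"
proof -
  note v = valid_coupleD[OF c]
  have "0 < eta1 c * w + noise c" "0 < eta2 c * w + noise c" using v assms(2) by (auto intro!: add_nonneg_pos)
  then have nz: "eta1 c * w + noise c \<noteq> 0" "eta2 c * w + noise c \<noteq> 0" "h_d c \<noteq> 0" "noise c \<noteq> 0"
    "noise c + h_d c * w \<noteq> 0"
    using v assms(2) by (auto simp: add_pos_pos less_imp_neq[symmetric])
  show "line_crit (h_d c) (sic_A c) (sic_B c) (1, 0, w) \<noteq> (0, 0, 0)"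
    "line_crit (h_d c) (sic_A c) (sic_B c) (0, 1, w) \<noteq> (0, 0, 0)"
    using nz by (auto simp: line_crit_def ratio_crit_def sic_A_def sic_B_def affine_at_def line_point_def slope_def)
qed

text \<open>Ties are resolved in favour of points that extend to strictly feasible powers.\<close>

definition sic_point :: "couple \<Rightarrow> real \<times> real" where
  "sic_point c = pick (\<lambda>p. p \<in> polygon (map (\<lambda>l. l c) sic_H))
     (\<lambda>p. (p, (sic_Pu c p, sic_Pu c p)) \<in> fd_sic_set1 c)
     (sic_obj c) (0, 0)
     (candidates (h_d c) (sic_A c) (sic_B c) (map (\<lambda>l. l c) sic_H))"

definition sic_powers :: "couple \<Rightarrow> powers" where
  "sic_powers c = (sic_point c, (sic_Pu c (sic_point c), sic_Pu c (sic_point c)))"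

lemma cf_sic_Pu: "cf_pair p \<Longrightarrow> cf_fun (\<lambda>c. sic_Pu c (p c))"
  unfolding sic_Pu_def sic_lo_def sic_hi_def sic_l1_def sic_l2_def sic_u1_def sic_u2_def
  by (intro cf_intros cf_Pu_m)

lemma cf_fd_sic_set1:
  assumes p: "cf_pair p" "cf_fun u"
  shows "cf_pred (\<lambda>c. (p c, (u c, u c)) \<in> fd_sic_set1 c)"
proof -
  have "(p c, (u c, u c)) \<in> fd_sic_set1 c \<longleftrightarrow>
     0 \<le> fst (p c) \<and> fst (p c) \<le> P1_max c \<and> 0 \<le> snd (p c) \<and> snd (p c) \<le> P2_max c \<and> 0 \<le> u c \<and> u c \<le> Pu_max c \<and>
     Ru_min c \<le> shannon c (u c * h_bu c / noise c) \<and>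
     snd (p c) * h_d c + fst (p c) * eta1 c < u c * h_d1u c \<and>
     fst (p c) * h_d c + snd (p c) * eta2 c < u c * h_d2u c \<and>
     fst (p c) * h_bd1 c + u c * h_bu c < snd (p c) * h_bd2 c \<and> u c * h_bu c < fst (p c) * h_bd1 c" for c
    by (cases "p c") (auto simp: fd_sic_set1_def fd_sic_common_def fd_box_def)
  then show ?thesis
    using p by (simp only:) (intro cf_intros cf_shannon)
qed

lemma cf_sic_point: "cf_pair sic_point"
proof -
  have "cf_triple l" if "l \<in> set sic_H" for l
    using that by (auto simp: sic_H_def intro!: cf_intros cf_Pu_m)
  then show ?thesis
    unfolding sic_point_def sic_A_def sic_B_def
    by (intro cf_polygon_pick cf_fd_sic_set1 cf_sic_Pu cf_intros) auto
qed

text \<open>The optimum over the polygon is approached along the segment towards a strictly feasible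
  point. If a strict solution attains the value, it lies on no edges but the caps, so it is a
  candidate and the tie-breaking returns a strict solution.\<close>

lemma solves_fd_sic_set1:
  assumes c: "valid_couple c" and o: "order1_possible c" and m: "Pu_m c \<le> Pu_max c"
  shows "solves (fd_sic_set1 c) (fd_sic_rate c) (sic_powers c)"
proof -
  note v = valid_coupleD[OF c] and m0 = Pu_m_nonneg[OF c] and F = fd_sic_set1_iff[OF c]
  define H where "H = map (\<lambda>l. l c) sic_H"
  define p where "p = sic_point c"
  have inH: "q \<in> polygon H \<longleftrightarrow> sic_lo c q \<le> sic_hi c q \<and> fst q \<le> P1_max c \<and> snd q \<le> P2_max c" for q
    unfolding H_def by (rule sic_H_iff)
  have nn: "0 \<le> fst q \<and> 0 \<le> snd q" if "sic_lo c q \<le> sic_hi c q" for q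
  proof -
    have "0 \<le> sic_u2 c q" "0 \<le> sic_u1 c q" using that m0 by (auto simp: sic_lo_def sic_hi_def)
    then have "0 \<le> h_bd1 c * fst q" "h_bd1 c * fst q \<le> h_bd2 c * snd q"
      using v by (simp_all add: sic_u2_def sic_u1_def zero_le_divide_iff)
    then show ?thesis using v by (metis order_trans zero_le_mult_iff not_le)
  qed
  interpret sinr_polygon "h_d c" "sic_A c" "sic_B c" H
  proof
    show "bounded (polygon H)" by (rule bounded_polygon_box) (use nn inH in blast)
  qed (use v nn inH in \<open>auto simp: sic_A_def sic_B_def\<close>)
  obtain x' y' u' where q': "((x', y'), (u', u')) \<in> fd_sic_set1 c" using order1_feasible[OF c o m] .
  have FH: "(x, y) \<in> polygon H \<and> ((x, y), (sic_Pu c (x, y), sic_Pu c (x, y))) \<in> fd_sic_set1 c"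
    if "((x, y), (u, u)) \<in> fd_sic_set1 c" for x y u
    using sic_Pu_strict[OF that c] that by (auto simp: inH F)
  have ne: "polygon H \<noteq> {}" using FH[OF q'] by blast
  note best = pick_maximizer[OF ne, where G = "\<lambda>p. (p, (sic_Pu c p, sic_Pu c p)) \<in> fd_sic_set1 c" and d = "(0, 0)",
      unfolded H_def, folded sic_point_def, folded H_def, folded p_def]
  obtain x y where xy: "p = (x, y)" by (cases p)
  define u where "u = sic_Pu c (x, y)"
  have P: "sic_powers c = ((x, y), (u, u))" unfolding sic_powers_def p_def[symmetric] xy u_def ..
  have lohi: "sic_lo c (x, y) \<le> sic_hi c (x, y)" and box: "x \<le> P1_max c" "y \<le> P2_max c"
    using best(1) by (auto simp: inH xy)
  have weak: "Pu_m c \<le> u" "u \<le> Pu_max c" "sic_l1 c (x, y) \<le> u"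
      "sic_l2 c (x, y) \<le> u" "u \<le> sic_u1 c (x, y)" "u \<le> sic_u2 c (x, y)"
  proof -
    have "sic_lo c (x, y) \<le> u" "u \<le> sic_hi c (x, y)" using lohi by (auto simp: u_def sic_Pu_def)
    then show "Pu_m c \<le> u" "u \<le> Pu_max c" "sic_l1 c (x, y) \<le> u"
      "sic_l2 c (x, y) \<le> u" "u \<le> sic_u1 c (x, y)" "u \<le> sic_u2 c (x, y)"
      by (auto simp: sic_lo_def sic_hi_def)
  qed
  have rate: "fd_sic_rate c (q, w) = bw c * log 2 (sic_obj c q)"
    if "q \<in> polygon H" for q w
  proof -
    have pos: "0 < eta1 c * fst q + noise c" "0 < eta2 c * snd q + noise c"
      using affine_pos[OF that] by (auto simp: affine_at_def sic_A_def sic_B_def)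
    have "fd_sic_rate c (q, w) = shannon c (snd q * h_d c / (eta1 c * fst q + noise c)) +
       shannon c (fst q * h_d c / (eta2 c * snd q + noise c))" by (cases q; cases w) simp
    also have "\<dots> = bw c * log 2 (sic_obj c q)"
      using pos quadrant[OF that] v
      by (subst shannon_add) (auto simp: sinr_prod_def affine_at_def sic_A_def sic_B_def mult.commute)
    finally show ?thesis .
  qed
  have Fobt: "\<exists>x y u. q = ((x, y), (u, u))" if "q \<in> fd_sic_set1 c" for q
  proof -
    obtain x y u u' where "q = ((x, y), (u, u'))" by (metis surj_pair)
    then show ?thesis using that F by auto
  qed
  define t where "t = (\<lambda>n::nat. 1 / (real n + 1))"
  have t: "0 < t n" "t n \<le> 1" for n by (auto simp: t_def)
  have t0: "t \<longlonglongrightarrow> 0" unfolding t_def using LIMSEQ_inverse_real_of_nat by (simp add: inverse_eq_divide add.commute)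
  \<comment> \<open>The segment runs from the relaxed optimum towards the strictly feasible point
    obtained from \<open>order1_feasible\<close>; along it all strict conditions hold.\<close>
  define X where "X = (\<lambda>n. ((x + t n * (x' - x), y + t n * (y' - y)), (u + t n * (u' - u), u + t n * (u' - u))))"
  show ?thesis
  proof (rule solves_limI[of X])
    show "X n \<in> fd_sic_set1 c" for n
      unfolding X_def by (rule fd_sic_set1_segment[OF c q' box weak t])
    have lim: "(\<lambda>n. a + t n * b) \<longlonglongrightarrow> a" for a b :: real
      using tendsto_add[OF tendsto_const[of a] tendsto_mult_left_zero[OF t0, of b]] by simp
    show "X \<longlonglongrightarrow> sic_powers c" unfolding X_def P by (intro tendsto_Pair lim)
    have nnxy: "0 \<le> x" "0 \<le> y" using nn[OF lohi] by auto
    have pos: "eta1 c * x + noise c \<noteq> 0" "eta2 c * y + noise c \<noteq> 0"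
      using affine_pos[OF best(1)] by (auto simp: affine_at_def sic_A_def sic_B_def xy)
    have pos': "0 < 1 + y * h_d c / (eta1 c * x + noise c)" "0 < 1 + x * h_d c / (eta2 c * y + noise c)"
      using v nnxy by (auto intro!: add_pos_nonneg divide_nonneg_nonneg)
    show "(\<lambda>n. fd_sic_rate c (X n)) \<longlonglongrightarrow> fd_sic_rate c (sic_powers c)"
      unfolding X_def P fd_sic_rate.simps shannon_def using pos pos'
      by (intro tendsto_intros lim) auto
  next
    fix q assume q: "q \<in> fd_sic_set1 c"
    then obtain x2 y2 u2 where q2: "q = ((x2, y2), (u2, u2))" using Fobt by blast
    have qH: "(x2, y2) \<in> polygon H" using FH q q2 by blast
    show "fd_sic_rate c q \<le> fd_sic_rate c (sic_powers c)"
      unfolding q2 P rate[OF qH] xy[symmetric] rate[OF best(1)]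
      using best(2)[OF qH] sinr_prod_ge_1[OF qH] sinr_prod_ge_1[OF best(1)] v by (intro mult_left_mono) auto
    assume eq: "fd_sic_rate c q = fd_sic_rate c (sic_powers c)"
    have eq': "sic_obj c (x2, y2) = sic_obj c p"
    proof (rule ccontr)
      assume "\<not> ?thesis"
      then have "log 2 (sic_obj c (x2, y2)) < log 2 (sic_obj c p)"
        using best(2)[OF qH] sinr_prod_ge_1[OF qH] by simp
      then show False
        using eq v unfolding q2 P rate[OF qH] xy[symmetric] rate[OF best(1)] by simp
    qed
    have str: "sic_l1 c (x2, y2) < u2" "sic_l2 c (x2, y2) < u2" "u2 < sic_u1 c (x2, y2)"
      "u2 < sic_u2 c (x2, y2)" "Pu_m c \<le> u2" "u2 \<le> Pu_max c"
      using q unfolding q2 F by auto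
    have "(p, (sic_Pu c p, sic_Pu c p)) \<in> fd_sic_set1 c"
    proof (rule best(3)[OF qH])
      show "((x2, y2), (sic_Pu c (x2, y2), sic_Pu c (x2, y2))) \<in> fd_sic_set1 c" using FH q q2 by blast
      show "sic_obj c (x2, y2) = sic_obj c p" by fact
      fix l assume l: "l \<in> set H" "fst l * fst (x2, y2) + fst (snd l) * snd (x2, y2) = snd (snd l)"
        "(fst l, fst (snd l)) \<noteq> (0, 0)"
      \<comment> \<open>Each eliminated constraint with a nonzero normal vector compares two bounds
        of which at least one is strict at \<open>u2\<close>, so it is inactive.\<close>
      have "l = (1, 0, P1_max c) \<or> l = (0, 1, P2_max c)"
        using l str
        by (auto simp: H_def sic_H_def sic_l1_def sic_l2_def sic_u1_def sic_u2_def
            algebra_simps add_divide_distrib diff_divide_distrib)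
      then show "line_crit (h_d c) (sic_A c) (sic_B c) l \<noteq> (0, 0, 0)"
        using sic_line_crit[OF c] v by auto
    qed
    then show "sic_powers c \<in> fd_sic_set1 c" unfolding sic_powers_def p_def .
  qed
qed

section \<open>Order 2 as order 1 with exchanged devices, and both orders together\<close>

definition swap_powers :: "powers \<Rightarrow> powers" where
  "swap_powers p = ((snd (fst p), fst (fst p)), snd p)"

lemma fd_sic_set2_eq: "fd_sic_set2 c = swap_powers ` fd_sic_set1 (swap_devices c)"
proof -
  have 1: "p \<in> fd_sic_set2 c \<longleftrightarrow> swap_powers p \<in> fd_sic_set1 (swap_devices c)" for p
    by (cases p rule: prod_cases3, rename_tac d a b, case_tac d)
       (auto simp: swap_powers_def fd_sic_set1_def fd_sic_set2_def fd_sic_common_def fd_box_def shannon_def)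
  have 2: "swap_powers (swap_powers p) = p" for p by (simp add: swap_powers_def)
  show ?thesis
  proof (intro equalityI subsetI)
    fix p assume "p \<in> fd_sic_set2 c"
    then show "p \<in> swap_powers ` fd_sic_set1 (swap_devices c)"
      using 1 2 by (intro image_eqI[of _ _ "swap_powers p"]) auto
  qed (auto simp: 1 2)
qed

lemma fd_sic_rate_swap: "fd_sic_rate c (swap_powers p) = fd_sic_rate (swap_devices c) p"
  by (cases p rule: prod_cases3, rename_tac d a b, case_tac d)
     (simp add: swap_powers_def shannon_def add.commute)

lemma order2_possible_swap: "order2_possible c \<longleftrightarrow> order1_possible (swap_devices c)"
  by (auto simp: order1_possible_def order2_possible_def mult.commute mult.left_commute)

definition cf_powers :: "(couple \<Rightarrow> powers) \<Rightarrow> bool" where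
  "cf_powers P \<longleftrightarrow> cf_pair (\<lambda>c. fst (P c)) \<and> cf_pair (\<lambda>c. snd (P c))"

lemma cf_powers_if:
  assumes "cf_pred Q" "cf_powers P" "cf_powers P'"
  shows "cf_powers (\<lambda>c. if Q c then P c else P' c)"
  using cf_pair_if[OF assms(1), of "\<lambda>c. fst (P c)" "\<lambda>c. fst (P' c)"]
    cf_pair_if[OF assms(1), of "\<lambda>c. snd (P c)" "\<lambda>c. snd (P' c)"] assms(2,3)
  unfolding cf_powers_def by (simp add: if_distrib)

lemma cf_sic_powers: "cf_powers sic_powers"
  unfolding cf_powers_def sic_powers_def fst_conv snd_conv
  by (intro conjI cf_intros cf_sic_Pu cf_sic_point)

lemma cf_fd_sic_rate:
  assumes "cf_powers P"
  shows "cf_fun (\<lambda>c. fd_sic_rate c (P c))"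
proof -
  have "fd_sic_rate c (P c) =
     shannon c (snd (fst (P c)) * h_d c / (eta1 c * fst (fst (P c)) + noise c)) +
     shannon c (fst (fst (P c)) * h_d c / (eta2 c * snd (fst (P c)) + noise c))" for c
    by (cases "P c" rule: prod_cases3, rename_tac d a b, case_tac d) simp
  then show ?thesis
    using assms unfolding cf_powers_def by (simp only:) (intro cf_intros cf_shannon; elim conjE; assumption)
qed

lemma cf_order1: "cf_pred order1_possible" and cf_order2: "cf_pred order2_possible"
  unfolding order1_possible_def order2_possible_def by (intro cf_intros cf_Pu_m)+

lemma solvable_fd_sic: "solvable False (feasible_powers FD_SIC) (d2d_rate FD_SIC)"
proof -
  obtain P0 R0 where P0: "cf_powers P0" "cf_fun R0" and s0: "\<And>c. valid_couple c \<Longrightarrow>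
      if Pu_m c \<le> Pu_max c then solves (fd_nosic_set c) (fd_nosic_rate c) (P0 c) \<and> fd_nosic_rate c (P0 c) = R0 c \<and>
        (True \<longrightarrow> P0 c \<in> fd_nosic_set c)
      else fd_nosic_set c = {}"
    using solvable_fd_nosic unfolding solvable_def cf_powers_def by blast
  define P1 where "P1 = sic_powers"
  define P2 where "P2 = (\<lambda>c. swap_powers (sic_powers (swap_devices c)))"
  \<comment> \<open>The tie-breaking of \<open>solves_Un\<close>, which keeps the choice between the
    orders feasible if the value is attained.\<close>
  define Q where "Q = (\<lambda>c. fd_sic_rate c (P2 c) < fd_sic_rate c (P1 c) \<or>
     (fd_sic_rate c (P2 c) = fd_sic_rate c (P1 c) \<and> P1 c \<in> fd_sic_set1 c))"
  define P where "P = (\<lambda>c. if order1_possible c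
     then (if order2_possible c then (if Q c then P1 c else P2 c) else P1 c)
     else (if order2_possible c then P2 c else P0 c))"
  define R where "R = (\<lambda>c. if order1_possible c \<or> order2_possible c then fd_sic_rate c (P c) else R0 c)"
  have cf1: "cf_powers P1" unfolding P1_def by (rule cf_sic_powers)
  have cf2: "cf_powers P2"
    using cf_pair_swap[of "\<lambda>c. fst (sic_powers c)"] cf_pair_swap[of "\<lambda>c. snd (sic_powers c)"] cf_sic_powers
    unfolding cf_powers_def P2_def swap_powers_def fst_conv snd_conv
    by (auto intro!: cf_pairI dest: cf_fst cf_snd)
  have "cf_pred (\<lambda>c. P1 c \<in> fd_sic_set1 c)"
    unfolding P1_def sic_powers_def by (intro cf_fd_sic_set1 cf_sic_Pu cf_sic_point)
  then have cfP: "cf_powers P"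
    unfolding P_def Q_def by (intro cf_powers_if cf1 cf2 P0 cf_order1 cf_order2 cf_intros cf_fd_sic_rate)
  moreover have "cf_fun R"
    unfolding R_def by (intro cf_intros cf_order1 cf_order2 cf_fd_sic_rate cfP P0)
  moreover have "if Pu_m c \<le> Pu_max c
      then solves (feasible_powers FD_SIC c) (d2d_rate FD_SIC c) (P c) \<and> d2d_rate FD_SIC c (P c) = R c \<and>
        (False \<longrightarrow> P c \<in> feasible_powers FD_SIC c)
      else feasible_powers FD_SIC c = {}" if c: "valid_couple c" for c
  proof (cases "Pu_m c \<le> Pu_max c")
    case m: True
    have s1: "solves (fd_sic_set1 c) (fd_sic_rate c) (P1 c)" if "order1_possible c"
      unfolding P1_def by (rule solves_fd_sic_set1[OF c that m])
    have s2: "solves (fd_sic_set2 c) (fd_sic_rate c) (P2 c)" if "order2_possible c"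
      unfolding fd_sic_set2_eq P2_def
    proof (rule solves_image)
      show "continuous_on UNIV swap_powers"
        unfolding swap_powers_def by (intro continuous_intros)
      show "solves (fd_sic_set1 (swap_devices c)) (\<lambda>q. fd_sic_rate c (swap_powers q)) (sic_powers (swap_devices c))"
        unfolding fd_sic_rate_swap
        using solves_fd_sic_set1[of "swap_devices c"] c m that by (simp add: order2_possible_swap)
    qed
    show ?thesis
    proof (cases "order1_possible c \<or> order2_possible c")
      case True
      then have r: "d2d_rate FD_SIC c = fd_sic_rate c" by (simp add: fun_eq_iff)
      have "solves (feasible_powers FD_SIC c) (fd_sic_rate c) (P c)"
        using True s1 s2 solves_Un[OF s1 s2] by (auto simp: P_def Q_def)
      then show ?thesis using True m unfolding r by (simp add: R_def)
    next
      case False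
      then have "d2d_rate FD_SIC c = fd_nosic_rate c" "feasible_powers FD_SIC c = fd_nosic_set c"
        "P c = P0 c" "R c = R0 c" by (simp_all add: fun_eq_iff P_def R_def)
      then show ?thesis using s0[OF c] by simp
    qed
  next
    case False
    have e: "fd_sic_set1 c' = {}" if "valid_couple c'" "\<not> Pu_m c' \<le> Pu_max c'" for c'
    proof -
      have "p \<notin> fd_sic_set1 c'" for p
      proof -
        obtain x y u u' where "p = ((x, y), (u, u'))" by (metis surj_pair)
        then show ?thesis using that(2) by (auto simp: fd_sic_set1_iff[OF that(1)])
      qed
      then show ?thesis by blast
    qed
    have "fd_sic_set1 c = {}" "fd_sic_set2 c = {}"
      using e[of c] e[of "swap_devices c"] c False by (simp_all add: fd_sic_set2_eq)
    then show ?thesis using s0[OF c] False by simp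
  qed
  ultimately show ?thesis unfolding solvable_def cf_powers_def by blast
qed

subsection \<open>Half duplex\<close>

text \<open>The largest device power for which the cellular user can still meet its target. For a
  valid couple with \<open>Pu_m c = 0\<close> the first branch applies, so the division is
  safe.\<close>

definition half_nosic_P1 :: "couple \<Rightarrow> real" where
  "half_nosic_P1 c = (if Pu_m c * h_bd1 c * P1_max c / noise c \<le> Pu_max c - Pu_m c then P1_max c
     else (Pu_max c - Pu_m c) * noise c / (Pu_m c * h_bd1 c))"

definition half_nosic_point :: "couple \<Rightarrow> real \<times> real" where
  "half_nosic_point c = (half_nosic_P1 c, Pu_m c * (half_nosic_P1 c * h_bd1 c + noise c) / noise c)"

text \<open>Replaces the nonemptiness test of \<open>half_uses_sic\<close>, which is no expression
  in the parameters, by a strict inequality.\<close>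

definition half_sic_cond :: "couple \<Rightarrow> bool" where
  "half_sic_cond c \<longleftrightarrow> h_d c * h_bu c < h_bd1 c * h_d2u c \<and> Pu_m c \<le> Pu_max c \<and>
     Pu_m c * h_bu c / h_bd1 c < P1_max c"

definition half_sic_Pu :: "couple \<Rightarrow> real \<Rightarrow> real" where
  "half_sic_Pu c x = (max (Pu_m c) (x * h_d c / h_d2u c) + min (Pu_max c) (x * h_bd1 c / h_bu c)) / 2"

text \<open>The second term bounds the device power through \<open>Pu * h_d2u c > P1 * h_d c\<close>
  at full power of the cellular user.\<close>

definition half_sic_P1 :: "couple \<Rightarrow> real" where
  "half_sic_P1 c = min (P1_max c) (Pu_max c * h_d2u c / h_d c)"

definition half_point :: "bool \<Rightarrow> couple \<Rightarrow> real \<times> real" where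
  "half_point sic c = (if sic \<and> half_sic_cond c then (half_sic_P1 c, half_sic_Pu c (half_sic_P1 c))
     else half_nosic_point c)"

lemma half_nosic_set_iff:
  assumes c: "valid_couple c"
  shows "(x, u) \<in> half_nosic_set c \<longleftrightarrow> 0 \<le> x \<and> x \<le> P1_max c \<and> u \<le> Pu_max c \<and>
    Pu_m c * (x * h_bd1 c + noise c) / noise c \<le> u"
proof (cases "0 \<le> x")
  case True
  note v = valid_coupleD[OF c] and m0 = Pu_m_nonneg[OF c]
  have "0 < x * h_bd1 c + noise c" using v True by (intro add_nonneg_pos) auto
  moreover from this have "0 \<le> Pu_m c * (x * h_bd1 c + noise c) / noise c" using v m0 by simp
  ultimately show ?thesis
    using True shannon_ge_Ru_min_iff[OF c, of u] by (auto simp: half_nosic_set_def)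
qed (simp add: half_nosic_set_def)

text \<open>With the least power \<open>Pu_m + k * P1\<close> of the cellular user, the SINR is
  linear over affine in \<open>P1\<close> and still increasing, so the largest admissible
  \<open>P1\<close> is optimal.\<close>

lemma solves_half_nosic:
  assumes c: "valid_couple c"
  shows "Pu_m c \<le> Pu_max c \<Longrightarrow>
      solves (half_nosic_set c) (\<lambda>q. shannon c (fst q * h_d c / (snd q * h_d2u c + noise c))) (half_nosic_point c)"
    and "Pu_m c \<le> Pu_max c \<Longrightarrow> half_nosic_point c \<in> half_nosic_set c"
    and "\<not> Pu_m c \<le> Pu_max c \<Longrightarrow> half_nosic_set c = {}"
proof -
  note v = valid_coupleD[OF c] and m0 = Pu_m_nonneg[OF c] and F = half_nosic_set_iff[OF c]
  have low: "Pu_m c * (x * h_bd1 c + noise c) / noise c = Pu_m c + Pu_m c * h_bd1 c * x / noise c" for x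
    using v by (simp add: field_simps)
  have ge: "0 \<le> Pu_m c * h_bd1 c * x / noise c" if "0 \<le> x" for x using that v m0 by simp
  show "half_nosic_set c = {}" if "\<not> Pu_m c \<le> Pu_max c"
  proof -
    have "(x, u) \<notin> half_nosic_set c" for x u
      using ge[of x] that by (auto simp: F low)
    then show ?thesis by auto
  qed
  assume m: "Pu_m c \<le> Pu_max c"
  define x where "x = half_nosic_P1 c"
  define u where "u = Pu_m c + Pu_m c * h_bd1 c * x / noise c"
  have p: "half_nosic_point c = (x, u)" by (simp add: half_nosic_point_def x_def u_def low)
  have x: "0 \<le> x \<and> x \<le> P1_max c \<and> u \<le> Pu_max c \<and> (x = P1_max c \<or> (0 < Pu_m c \<and> u = Pu_max c))"
  proof (cases "Pu_m c * h_bd1 c * P1_max c / noise c \<le> Pu_max c - Pu_m c")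
    case True
    then show ?thesis using v by (simp add: x_def half_nosic_P1_def u_def)
  next
    case False
    then have "Pu_m c \<noteq> 0" using m by auto
    then have pm: "0 < Pu_m c" "0 < Pu_m c * h_bd1 c" using m0 v by auto
    have xe: "x = (Pu_max c - Pu_m c) * noise c / (Pu_m c * h_bd1 c)"
      using False by (simp add: x_def half_nosic_P1_def)
    then have "Pu_m c * h_bd1 c * x = (Pu_max c - Pu_m c) * noise c" using pm v by simp
    then have "u = Pu_max c" using v by (simp add: u_def)
    moreover have "x \<le> P1_max c"
      using False v pm by (simp add: xe field_simps)
    moreover have "0 \<le> x" using xe m v pm by (simp add: xe)
    ultimately show ?thesis using pm by simp
  qed
  show mem: "half_nosic_point c \<in> half_nosic_set c" using x unfolding p F low u_def by simp
  show "solves (half_nosic_set c) (\<lambda>q. shannon c (fst q * h_d c / (snd q * h_d2u c + noise c))) (half_nosic_point c)"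
  proof (rule solves_memI[OF mem])
    fix q assume "q \<in> half_nosic_set c"
    then obtain y w where q: "q = (y, w)" "0 \<le> y" "y \<le> P1_max c" "w \<le> Pu_max c"
      "Pu_m c + Pu_m c * h_bd1 c * y / noise c \<le> w" by (cases q) (auto simp: F low)
    define k where "k = Pu_m c * h_bd1 c / noise c"
    have k: "0 \<le> k" "Pu_m c + k * y \<le> w" "u = Pu_m c + k * x"
      using v m0 q(5) by (simp_all add: k_def u_def)
    have "y \<le> x"
    proof (cases "x = P1_max c")
      case False
      then have "k * y \<le> k * x" "0 < k" using x k q(4) v by (auto simp: k_def)
      then show ?thesis by simp
    qed (use q in simp)
    have w0: "0 \<le> w" "0 \<le> u" using ge[OF q(2)] ge[of x] x q(5) m0 by (auto simp: u_def)
    have d: "0 < w * h_d2u c + noise c" "0 < u * h_d2u c + noise c"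
      using w0 v by (auto intro!: add_nonneg_pos)
    \<comment> \<open>On both sides the products of \<open>x\<close> and \<open>y\<close> cancel,
      leaving a positive multiple of \<open>y \<le> x\<close>.\<close>
    have "y * (u * h_d2u c + noise c) \<le> x * ((Pu_m c + k * y) * h_d2u c + noise c)"
    proof -
      have "y * (Pu_m c * h_d2u c + noise c) \<le> x * (Pu_m c * h_d2u c + noise c)"
        using \<open>y \<le> x\<close> v m0 by (intro mult_right_mono) auto
      then show ?thesis by (simp add: k(3) algebra_simps)
    qed
    also have "\<dots> \<le> x * (w * h_d2u c + noise c)"
      using x k v by (intro mult_left_mono add_right_mono mult_right_mono) auto
    finally have "y / (w * h_d2u c + noise c) \<le> x / (u * h_d2u c + noise c)"
      using d by (simp add: field_simps)
    then have "y / (w * h_d2u c + noise c) * h_d c \<le> x / (u * h_d2u c + noise c) * h_d c"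
      using v by (intro mult_right_mono) auto
    then show "shannon c (fst q * h_d c / (snd q * h_d2u c + noise c)) \<le>
       shannon c (fst (half_nosic_point c) * h_d c / (snd (half_nosic_point c) * h_d2u c + noise c))"
      unfolding q(1) p using v d q(2) by (intro shannon_mono) auto
  qed
qed

lemma half_sic_set_iff:
  assumes c: "valid_couple c"
  shows "(x, u) \<in> half_sic_set c \<longleftrightarrow> x \<le> P1_max c \<and> u \<le> Pu_max c \<and> Pu_m c \<le> u \<and>
    x * h_d c / h_d2u c < u \<and> u < x * h_bd1 c / h_bu c"
proof -
  note v = valid_coupleD[OF c] and m0 = Pu_m_nonneg[OF c]
  have 1: "x * h_d c / h_d2u c < u \<longleftrightarrow> x * h_d c < u * h_d2u c"
    "u < x * h_bd1 c / h_bu c \<longleftrightarrow> u * h_bu c < x * h_bd1 c"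
    using v by (simp_all add: field_simps)
  have 2: "Ru_min c \<le> shannon c (u * h_bu c / noise c) \<longleftrightarrow> Pu_m c \<le> u" if "0 \<le> u"
    using shannon_ge_Ru_min_iff[OF c that v(2)] v by simp
  have 3: "0 \<le> x" if "0 \<le> u" "u * h_bu c < x * h_bd1 c"
  proof -
    have "0 \<le> u * h_bu c" using that v by simp
    then have "0 < x * h_bd1 c" using that by linarith
    then show ?thesis using v by (simp add: zero_less_mult_iff)
  qed
  show ?thesis unfolding 1 using 2 3 m0 by (auto simp: half_sic_set_def)
qed

text \<open>The weak bounds may coincide, but the strict ones remain strict at the midpoint.\<close>

lemma midpoint_between:
  fixes m M l u :: real
  assumes "m \<le> M" "l < M" "m < u" "l < u"
  defines "z \<equiv> (max m l + min M u) / 2"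
  shows "m \<le> z \<and> z \<le> M \<and> l < z \<and> z < u"
  using assms(1-4) unfolding z_def max_def min_def by auto

text \<open>The channel condition puts the strict lower bound on the power of the cellular user
  below the strict upper one, for every positive \<open>x\<close>.\<close>

lemma half_sic_Pu_strict:
  assumes c: "valid_couple c" and k: "half_sic_cond c"
    and x: "Pu_m c * h_bu c / h_bd1 c < x" "x \<le> P1_max c" "x * h_d c / h_d2u c < Pu_max c"
  shows "(x, half_sic_Pu c x) \<in> half_sic_set c"
proof -
  note v = valid_coupleD[OF c] and m0 = Pu_m_nonneg[OF c]
  have "0 \<le> Pu_m c * h_bu c / h_bd1 c" using v m0 by simp
  then have x0: "0 < x" using x by linarith
  have "x * (h_d c * h_bu c) < x * (h_bd1 c * h_d2u c)"
    using k x0 unfolding half_sic_cond_def by (intro mult_strict_left_mono) auto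
  then have "x * h_d c / h_d2u c < x * h_bd1 c / h_bu c" using v by (simp add: field_simps)
  moreover have "Pu_m c < x * h_bd1 c / h_bu c" using x(1) v by (simp add: field_simps)
  moreover have "Pu_m c \<le> Pu_max c" using k by (simp add: half_sic_cond_def)
  ultimately show ?thesis
    using x(2,3) midpoint_between[of "Pu_m c" "Pu_max c" "x * h_d c / h_d2u c" "x * h_bd1 c / h_bu c"]
    unfolding half_sic_set_iff[OF c] half_sic_Pu_def by blast
qed

lemma half_sic_interval:
  assumes c: "valid_couple c" and k: "half_sic_cond c"
  shows "Pu_m c * h_bu c / h_bd1 c < half_sic_P1 c"
proof -
  note v = valid_coupleD[OF c] and m0 = Pu_m_nonneg[OF c]
  have k': "h_d c * h_bu c < h_bd1 c * h_d2u c" "Pu_m c \<le> Pu_max c" "Pu_m c * h_bu c / h_bd1 c < P1_max c"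
    using k by (auto simp: half_sic_cond_def)
  have "Pu_m c * (h_d c * h_bu c) \<le> Pu_max c * (h_d c * h_bu c)" using k' v by (intro mult_right_mono) auto
  also have "\<dots> < Pu_max c * (h_bd1 c * h_d2u c)" using k' v by (intro mult_strict_left_mono) auto
  finally have "Pu_m c * h_bu c / h_bd1 c < Pu_max c * h_d2u c / h_d c" using v by (simp add: field_simps)
  then show ?thesis using k' by (simp add: half_sic_P1_def)
qed

text \<open>Any point of the set has \<open>P1\<close> strictly above
  \<open>Pu_m * h_bu / h_bd1\<close>, which excludes a cap equal to this value; conversely, every
  \<open>P1\<close> inside the open interval works.\<close>

lemma half_uses_sic_iff:
  assumes c: "valid_couple c"
  shows "half_uses_sic c \<longleftrightarrow> half_sic_cond c"
proof
  note v = valid_coupleD[OF c] and m0 = Pu_m_nonneg[OF c]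
  assume u: "half_uses_sic c"
  then obtain x w where "(x, w) \<in> half_sic_set c" by (auto simp: half_uses_sic_def)
  then have "x \<le> P1_max c" "Pu_m c < x * h_bd1 c / h_bu c" by (auto simp: half_sic_set_iff[OF c])
  moreover from this have "Pu_m c * h_bu c / h_bd1 c < x" using v by (simp add: field_simps)
  ultimately have "Pu_m c * h_bu c / h_bd1 c < P1_max c" by linarith
  then show "half_sic_cond c" using u by (auto simp: half_uses_sic_def half_sic_cond_def)
next
  note v = valid_coupleD[OF c]
  assume k: "half_sic_cond c"
  obtain x where x: "Pu_m c * h_bu c / h_bd1 c < x" "x < half_sic_P1 c"
    using dense[OF half_sic_interval[OF c k]] by blast
  have "x < P1_max c" "x < Pu_max c * h_d2u c / h_d c" using x(2) by (auto simp: half_sic_P1_def)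
  moreover from this have "x * h_d c / h_d2u c < Pu_max c" using v by (simp add: field_simps)
  ultimately have "(x, half_sic_Pu c x) \<in> half_sic_set c"
    using x(1) by (intro half_sic_Pu_strict[OF c k]) auto
  then show "half_uses_sic c" using k by (auto simp: half_uses_sic_def half_sic_cond_def)
qed

text \<open>The rate depends on \<open>P1\<close> alone, so the problem is to find the supremum of
  the admissible \<open>P1\<close>, approached from inside the interval.\<close>

lemma solves_half_sic:
  assumes c: "valid_couple c" and k: "half_sic_cond c"
  shows "solves (half_sic_set c) (\<lambda>q. shannon c (fst q * h_d c / noise c))
    (half_sic_P1 c, half_sic_Pu c (half_sic_P1 c))"
proof -
  note v = valid_coupleD[OF c] and m0 = Pu_m_nonneg[OF c] and F = half_sic_set_iff[OF c]
  define x where "x = half_sic_P1 c"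
  define a where "a = Pu_m c * h_bu c / h_bd1 c"
  have ax: "a < x" unfolding a_def x_def by (rule half_sic_interval[OF c k])
  have "0 \<le> a" using v m0 by (simp add: a_def)
  then have x0: "0 < x" using ax by simp
  have le: "y \<le> x" if "(y, w) \<in> half_sic_set c" for y w
  proof -
    have "y \<le> P1_max c" "y * h_d c / h_d2u c < Pu_max c" using that by (auto simp: F)
    then show ?thesis using v by (simp add: x_def half_sic_P1_def field_simps)
  qed
  define t where "t = (\<lambda>n::nat. 1 / (real n + 1))"
  have t: "0 < t n" "t n \<le> 1" for n by (auto simp: t_def)
  have t0: "t \<longlonglongrightarrow> 0" unfolding t_def using LIMSEQ_inverse_real_of_nat by (simp add: inverse_eq_divide add.commute)
  \<comment> \<open>At most half of the interval is given up, which keeps \<open>X n\<close> above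
    \<open>a\<close>.\<close>
  define X where "X = (\<lambda>n. x - t n * ((x - a) / 2))"
  have Xl: "X \<longlonglongrightarrow> x"
    using tendsto_diff[OF tendsto_const[of x] tendsto_mult_left_zero[OF t0, of "(x - a) / 2"]] by (simp add: X_def)
  have X: "a < X n" "X n < x" for n
  proof -
    define w where "w = t n * ((x - a) / 2)"
    have "w \<le> 1 * ((x - a) / 2)" "0 < w"
      unfolding w_def using t[of n] ax by (auto intro!: mult_right_mono mult_pos_pos)
    then have "a < x - w" "x - w < x" using ax by auto
    then show "a < X n" "X n < x" by (simp_all add: X_def w_def)
  qed
  show ?thesis
    unfolding x_def[symmetric]
  proof (rule solves_limI[of "\<lambda>n. (X n, half_sic_Pu c (X n))"])
    fix n
    have "X n < P1_max c" "X n < Pu_max c * h_d2u c / h_d c" using X(2)[of n] by (auto simp: x_def half_sic_P1_def)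
    moreover from this have "X n * h_d c / h_d2u c < Pu_max c" using v by (simp add: field_simps)
    ultimately show "(X n, half_sic_Pu c (X n)) \<in> half_sic_set c"
      using X(1)[of n] unfolding a_def by (intro half_sic_Pu_strict[OF c k]) auto
  next
    show "(\<lambda>n. (X n, half_sic_Pu c (X n))) \<longlonglongrightarrow> (x, half_sic_Pu c x)"
      unfolding half_sic_Pu_def using v by (intro tendsto_intros Xl) auto
    show "(\<lambda>n. shannon c (fst (X n, half_sic_Pu c (X n)) * h_d c / noise c)) \<longlonglongrightarrow>
       shannon c (fst (x, half_sic_Pu c x) * h_d c / noise c)"
    proof -
      have "0 < 1 + x * h_d c / noise c" using v x0 by (intro add_pos_nonneg) auto
      then show ?thesis unfolding shannon_def fst_conv using v by (intro tendsto_intros Xl) auto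
    qed
  next
    fix q assume q: "q \<in> half_sic_set c"
    obtain y w where yw: "q = (y, w)" by (cases q)
    have y: "y \<le> x" "(y, w) \<in> half_sic_set c" using le q yw by auto
    have y0: "0 \<le> y" using y(2) by (simp add: half_sic_set_def)
    show "shannon c (fst q * h_d c / noise c) \<le> shannon c (fst (x, half_sic_Pu c x) * h_d c / noise c)"
      unfolding yw fst_conv using v y y0 by (intro shannon_mono divide_right_mono mult_right_mono) auto
    \<comment> \<open>The rate is strictly increasing, so equality means that \<open>q\<close> has
      device power \<open>x\<close>; then the midpoint power is feasible for \<open>x\<close> as
      well.\<close>
    assume "shannon c (fst q * h_d c / noise c) = shannon c (fst (x, half_sic_Pu c x) * h_d c / noise c)"
    then have "shannon c (x * h_d c / noise c) \<le> shannon c (y * h_d c / noise c)" by (simp add: yw)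
    then have "x * h_d c / noise c \<le> y * h_d c / noise c"
      using v x0 y0 by (subst (asm) shannon_mono_iff) auto
    then have "x \<le> y" using v by (simp add: divide_le_cancel)
    then have "(x, w) \<in> half_sic_set c" using y by simp
    then show "(x, half_sic_Pu c x) \<in> half_sic_set c"
      using ax unfolding a_def by (intro half_sic_Pu_strict[OF c k]) (auto simp: F)
  qed
qed

lemma half_rate_eq:
  assumes "valid_couple c"
  shows "half_rate sic c q = (if sic \<and> half_sic_cond c then shannon c (fst q * h_d c / noise c)
     else shannon c (fst q * h_d c / (snd q * h_d2u c + noise c)))"
  by (cases q) (simp add: half_uses_sic_iff[OF assms])

lemma solves_half:
  assumes c: "valid_couple c"
  shows "if Pu_m c \<le> Pu_max c then solves (half_set sic c) (half_rate sic c) (half_point sic c)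
    else half_set sic c = {}"
proof -
  have r: "half_rate sic c = (if sic \<and> half_sic_cond c then (\<lambda>q. shannon c (fst q * h_d c / noise c))
     else (\<lambda>q. shannon c (fst q * h_d c / (snd q * h_d2u c + noise c))))"
    by (cases "sic \<and> half_sic_cond c")
       (simp_all only: fun_eq_iff half_rate_eq[OF c] if_True if_False simp_thms)
  show ?thesis
    using solves_half_sic[OF c] solves_half_nosic[OF c]
    unfolding r half_set_def half_uses_sic_iff[OF c] half_point_def
    by (auto simp: half_sic_cond_def)
qed

lemma cf_half_point: "cf_pair (half_point sic)"
proof -
  have cond: "cf_pred (\<lambda>c. sic \<and> half_sic_cond c)"
    unfolding half_sic_cond_def by (cases sic) (auto intro!: cf_intros cf_Pu_m)
  have P1: "cf_fun half_sic_P1" "cf_fun half_nosic_P1"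
    unfolding half_sic_P1_def half_nosic_P1_def by (intro cf_intros cf_Pu_m)+
  show ?thesis
    unfolding half_point_def half_nosic_point_def half_sic_Pu_def
    by (intro cf_pair_if cond cf_intros P1 cf_Pu_m)
qed

section \<open>The two halves combined, and a uniform view of the modes\<close>

text \<open>\<open>powers\<close> groups the values by node, the half-slot problems group them by
  half; the product structure appears only after this regrouping.\<close>

definition pair_halves :: "(real \<times> real) \<times> (real \<times> real) \<Rightarrow> powers" where
  "pair_halves q = ((fst (fst q), fst (snd q)), (snd (fst q), snd (snd q)))"

lemma hd_powers_eq: "hd_powers sic c = pair_halves ` (half_set sic c \<times> half_set sic (swap_devices c))"
proof -
  have "((x, y), (u, w)) \<in> hd_powers sic c \<longleftrightarrow>
      ((x, y), (u, w)) \<in> pair_halves ` (half_set sic c \<times> half_set sic (swap_devices c))" for x y u w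
  proof
    assume "((x, y), (u, w)) \<in> hd_powers sic c"
    then have "((x, u), (y, w)) \<in> half_set sic c \<times> half_set sic (swap_devices c)"
      by (simp add: hd_powers_def)
    then show "((x, y), (u, w)) \<in> pair_halves ` (half_set sic c \<times> half_set sic (swap_devices c))"
      by (rule rev_image_eqI) (simp add: pair_halves_def)
  qed (auto simp: pair_halves_def hd_powers_def)
  then show ?thesis by (auto simp: set_eq_iff)
qed

lemma hd_rate_eq: "hd_rate sic c (pair_halves q) =
  1/2 * half_rate sic (swap_devices c) (snd q) + 1/2 * half_rate sic c (fst q)"
  by (cases q rule: prod_cases3, rename_tac d a b, case_tac d) (simp add: pair_halves_def)

lemma solves_hd:
  assumes c: "valid_couple c"
  shows "if Pu_m c \<le> Pu_max c
    then solves (hd_powers sic c) (hd_rate sic c) (pair_halves (half_point sic c, half_point sic (swap_devices c)))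
    else hd_powers sic c = {}"
proof (cases "Pu_m c \<le> Pu_max c")
  case True
  have "solves (half_set sic c) (half_rate sic c) (half_point sic c)"
    "solves (half_set sic (swap_devices c)) (half_rate sic (swap_devices c)) (half_point sic (swap_devices c))"
    using solves_half[of c sic] solves_half[of "swap_devices c" sic] c True by simp_all
  from solves_prod[OF this] have "solves (half_set sic c \<times> half_set sic (swap_devices c))
     (\<lambda>q. hd_rate sic c (pair_halves q)) (half_point sic c, half_point sic (swap_devices c))"
    unfolding hd_rate_eq .
  moreover have "continuous_on UNIV pair_halves"
    unfolding pair_halves_def by (intro continuous_intros)
  ultimately show ?thesis unfolding hd_powers_eq using True by (simp add: solves_image)
next
  case False
  then show ?thesis using solves_half[OF c, of sic] by (simp add: hd_powers_eq)
qed

lemma solvable_hd: "solvable (\<not> sic) (hd_powers sic) (hd_rate sic)"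
proof -
  define P where "P = (\<lambda>c. pair_halves (half_point sic c, half_point sic (swap_devices c)))"
  define r where "r = (\<lambda>c. if sic \<and> half_sic_cond c then shannon c (fst (half_point sic c) * h_d c / noise c)
      else shannon c (fst (half_point sic c) * h_d c / (snd (half_point sic c) * h_d2u c + noise c)))"
  have cond: "cf_pred (\<lambda>c. sic \<and> half_sic_cond c)"
    unfolding half_sic_cond_def by (cases sic) (auto intro!: cf_intros cf_Pu_m)
  note cfp = cf_half_point[of sic] cf_pair_swap[OF cf_half_point[of sic]]
  have "cf_pair (\<lambda>c. fst (P c))" "cf_pair (\<lambda>c. snd (P c))"
    unfolding P_def pair_halves_def fst_conv snd_conv by (intro cf_intros cfp)+
  moreover have "cf_fun r" unfolding r_def by (intro cf_if cond cf_shannon cf_intros cfp)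
  then have "cf_fun (\<lambda>c. 1/2 * r (swap_devices c) + 1/2 * r c)" by (intro cf_intros cf_swap)
  moreover have "half_rate sic c (half_point sic c) = r c" if "valid_couple c" for c
    unfolding r_def by (rule half_rate_eq[OF that])
  then have "hd_rate sic c (P c) = 1/2 * r (swap_devices c) + 1/2 * r c" if "valid_couple c" for c
    using that unfolding P_def hd_rate_eq by simp
  moreover have "P c \<in> hd_powers sic c" if "valid_couple c" "\<not> sic" "Pu_m c \<le> Pu_max c" for c
    using solves_half_nosic(2)[of c] solves_half_nosic(2)[of "swap_devices c"] that
    unfolding hd_powers_eq P_def by (intro imageI) (simp add: half_point_def half_set_def)
  moreover have "if Pu_m c \<le> Pu_max c then solves (hd_powers sic c) (hd_rate sic c) (P c) else hd_powers sic c = {}"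
    if "valid_couple c" for c
    using solves_hd[OF that, of sic] unfolding P_def .
  ultimately show ?thesis
    unfolding solvable_def
    by (intro exI[of _ P] exI[of _ "\<lambda>c. 1/2 * r (swap_devices c) + 1/2 * r c"]) auto
qed

lemma solvable_mode: "solvable (m \<in> {FD_NoSIC, HD_NoSIC}) (feasible_powers m) (d2d_rate m)"
proof (cases m)
  case FD_NoSIC
  have "feasible_powers FD_NoSIC = fd_nosic_set" "d2d_rate FD_NoSIC = fd_nosic_rate"
    by (simp_all add: fun_eq_iff)
  then show ?thesis using solvable_fd_nosic FD_NoSIC by simp
next
  case HD_NoSIC
  have "feasible_powers HD_NoSIC = hd_powers False" "d2d_rate HD_NoSIC = hd_rate False"
    by (simp_all add: fun_eq_iff)
  then show ?thesis using solvable_hd[of False] HD_NoSIC by simp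
next
  case HD_SIC
  have "feasible_powers HD_SIC = hd_powers True" "d2d_rate HD_SIC = hd_rate True"
    by (simp_all add: fun_eq_iff)
  then show ?thesis using solvable_hd[of True] HD_SIC by simp
qed (use solvable_fd_sic in simp)

text \<open>The halves are optimized separately and share no variable. Both are infeasible together,
  because the criterion involves no device.\<close>

lemma hd_value_eq:
  assumes c: "valid_couple c"
  shows "hd_value sic c = opt_value (hd_powers sic c) (hd_rate sic c)"
proof (cases "Pu_m c \<le> Pu_max c")
  case True
  have "solves (half_set sic c) (half_rate sic c) (half_point sic c)"
    "solves (half_set sic (swap_devices c)) (half_rate sic (swap_devices c)) (half_point sic (swap_devices c))"
    using solves_half[of c sic] solves_half[of "swap_devices c" sic] c True by simp_all
  moreover have "solves (hd_powers sic c) (hd_rate sic c) (pair_halves (half_point sic c, half_point sic (swap_devices c)))"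
    using solves_hd[OF c, of sic] True by simp
  ultimately show ?thesis unfolding solves_def hd_value_def by (simp add: hd_rate_eq)
next
  case False
  have "half_set sic c = {}" "half_set sic (swap_devices c) = {}" "hd_powers sic c = {}"
    using solves_half[OF c, of sic] solves_half[of "swap_devices c" sic] solves_hd[OF c, of sic] c False
    by simp_all
  then show ?thesis by (simp add: hd_value_def opt_value_def bot_ereal_def)
qed

text \<open>Makes every entry a supremum over \<open>feasible_powers\<close>; the higher of the two
  orders is a supremum over a union.\<close>

lemma max_rate_eq:
  assumes "valid_couple c"
  shows "max_rate m c = opt_value (feasible_powers m c) (d2d_rate m c)"
proof (cases m)
  case FD_SIC
  moreover have "d2d_rate FD_SIC c =
      (if order1_possible c \<or> order2_possible c then fd_sic_rate c else fd_nosic_rate c)"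
    by (simp add: fun_eq_iff)
  ultimately show ?thesis
    by (cases "order1_possible c"; cases "order2_possible c"; simp add: opt_value_Un)
qed (simp_all add: hd_value_eq[OF assms], simp_all add: opt_value_def)

section \<open>The table and the two steps\<close>

lemma solver_exists:
  "\<exists>S C. (\<forall>c. cost (solve S c) \<le> C) \<and> (\<forall>c. valid_couple c \<longrightarrow> is_solution m c (val (solve S c)) \<and>
     (\<forall>r p. m \<in> {FD_NoSIC, HD_NoSIC} \<longrightarrow> val (solve S c) = Some (r, p) \<longrightarrow> p \<in> feasible_powers m c))"
proof -
  obtain P R where P: "cf_pair (\<lambda>c. fst (P c))" "cf_pair (\<lambda>c. snd (P c))" "cf_fun R"
    and sol: "\<And>c. valid_couple c \<Longrightarrow> if Pu_m c \<le> Pu_max c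
      then solves (feasible_powers m c) (d2d_rate m c) (P c) \<and> d2d_rate m c (P c) = R c \<and>
        (m \<in> {FD_NoSIC, HD_NoSIC} \<longrightarrow> P c \<in> feasible_powers m c)
      else feasible_powers m c = {}"
    using solvable_mode[of m] unfolding solvable_def by blast
  \<comment> \<open>This difference serves as the margin: negative exactly for the infeasible valid
    couples.\<close>
  have "cf_fun (\<lambda>c. Pu_max c - Pu_m c)" by (intro cf_intros cf_Pu_m)
  then obtain e where e: "\<And>c. val (eval_cf e c) = Pu_max c - Pu_m c" unfolding cf_fun_def by blast
  obtain e0 where e0: "\<And>c. val (eval_cf e0 c) = R c" using P(3) unfolding cf_fun_def by blast
  obtain e1 e2 e3 e4 where e14: "\<And>c. val (eval_cf e1 c) = fst (fst (P c))" "\<And>c. val (eval_cf e2 c) = snd (fst (P c))"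
    "\<And>c. val (eval_cf e3 c) = fst (snd (P c))" "\<And>c. val (eval_cf e4 c) = snd (snd (P c))"
    using P(1,2) unfolding cf_pair_def cf_fun_def by metis
  define S where "S = \<lparr>sol_margin = e, sol_rate = e0, sol_P1 = e1, sol_P2 = e2, sol_Pu = e3, sol_Pu' = e4\<rparr>"
  have v: "val (solve S c) = (if Pu_m c \<le> Pu_max c then Some (R c, P c) else None)" for c
    by (simp add: solve_def S_def e e0 e14)
  obtain C C0 C1 C2 C3 C4 where C: "\<And>c. cost (eval_cf e c) \<le> C" "\<And>c. cost (eval_cf e0 c) \<le> C0"
    "\<And>c. cost (eval_cf e1 c) \<le> C1" "\<And>c. cost (eval_cf e2 c) \<le> C2" "\<And>c. cost (eval_cf e3 c) \<le> C3"
    "\<And>c. cost (eval_cf e4 c) \<le> C4"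
    using eval_cf_cost by metis
  have "cost (solve S c) \<le> C + (C0 + (C1 + (C2 + (C3 + C4))))" for c
    using C(1)[of c] by (auto simp: solve_def S_def intro!: add_mono C)
  moreover have "is_solution m c (val (solve S c))" if c: "valid_couple c" for c
    using sol[OF c] unfolding v max_rate_eq[OF c] is_solution_def
    by (auto simp: solves_def opt_value_def bot_ereal_def max_rate_eq[OF c])
  moreover have "p \<in> feasible_powers m c"
    if "valid_couple c" "m \<in> {FD_NoSIC, HD_NoSIC}" "val (solve S c) = Some (r, p)" for c r p
    using sol[OF that(1)] that(2,3) unfolding v by (auto split: if_splits)
  ultimately show ?thesis by blast
qed

section \<open>Loops of the two-step procedure\<close>

definition table_entry :: "(real \<times> powers) option \<Rightarrow> ereal \<times> powers" where
  "table_entry s = (case s of None \<Rightarrow> (-\<infinity>, ((0, 0), (0, 0))) | Some (r, p) \<Rightarrow> (ereal r, p))"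

lemma fill_table_correct:
  assumes C: "\<And>c. cost (solve S c) \<le> C"
  shows "n \<in> {1..D} \<Longrightarrow> i \<in> {1..K} \<Longrightarrow>
      val (fill_table S N D K) n i = table_entry (val (solve S (couple_of N n i)))"
    and "1 \<le> K \<Longrightarrow> cost (fill_table S N D K) \<le> (C + 2) * (K * D)"
proof -
  define f where "f = (\<lambda>n i (T :: table). do { s \<leftarrow> solve S (couple_of N n i);
       (let e = (case s of None \<Rightarrow> (-\<infinity>, ((0, 0), (0, 0))) | Some (r, p) \<Rightarrow> (ereal r, p))
        in ret (T(n := (T n)(i := e)))) })"
  define E where "E = (\<lambda>n i. table_entry (val (solve S (couple_of N n i))))"
  have f: "val (f n i T) = T(n := (T n)(i := E n i))" "cost (f n i T) \<le> C" for n i T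
    using C by (simp_all add: f_def E_def table_entry_def Let_def)
  define I where "I = (\<lambda>n (T :: table). \<forall>n'\<in>{1..<n}. \<forall>i\<in>{1..K}. T n' i = E n' i)"
  have eq: "fill_table S N D K = for_loop [1..<D+1] (\<lambda>n. for_loop [1..<K+1] (f n)) (\<lambda>n i. (-\<infinity>, ((0, 0), (0, 0))))"
    unfolding fill_table_def f_def ..
  have "I (D+1) (val (fill_table S N D K)) \<and> cost (fill_table S N D K) \<le> (D + 1 - 1) * Suc (K * Suc C)"
    unfolding eq
  proof (rule for_loop_upt[where I = I])
    fix n T assume n: "1 \<le> n" and T: "I n T"
    define J where "J = (\<lambda>i (T :: table). I n T \<and> (\<forall>i'\<in>{1..<i}. T n i' = E n i'))"
    have "J (K+1) (val (for_loop [1..<K+1] (f n) T)) \<and> cost (for_loop [1..<K+1] (f n) T) \<le> (K + 1 - 1) * Suc C"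
    proof (rule for_loop_upt[where I = J])
      show "J 1 T" using T by (simp add: J_def)
      fix i T assume "J i T"
      then have "J (Suc i) (T(n := (T n)(i := E n i)))"
        by (auto simp: J_def I_def less_Suc_eq)
      then show "J (Suc i) (val (f n i T)) \<and> cost (f n i T) \<le> C" using f by simp
    qed simp
    moreover have "I (Suc n) Y" if "J (K+1) Y" for Y
      unfolding I_def
    proof (intro ballI)
      fix n' i assume "n' \<in> {1..<Suc n}" "i \<in> {1..K}"
      then show "Y n' i = E n' i" using that by (cases "n' = n") (auto simp: J_def I_def)
    qed
    ultimately show "I (Suc n) (val (for_loop [1..<K+1] (f n) T)) \<and> cost (for_loop [1..<K+1] (f n) T) \<le> K * Suc C"
      by simp
  qed (simp_all add: I_def)
  then have I: "I (D+1) (val (fill_table S N D K))" and c: "cost (fill_table S N D K) \<le> D * Suc (K * Suc C)"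
    by simp_all
  show "n \<in> {1..D} \<Longrightarrow> i \<in> {1..K} \<Longrightarrow>
      val (fill_table S N D K) n i = table_entry (val (solve S (couple_of N n i)))"
    using I by (auto simp: I_def E_def)
  assume K: "1 \<le> K"
  \<comment> \<open>The tick of each row is charged to its \<open>K \<ge> 1\<close> entries, which
    turns \<open>C + 1\<close> into \<open>C + 2\<close>.\<close>
  then have "D * Suc (K * Suc C) \<le> D * (K + K * Suc C)" by (intro mult_le_mono2) simp
  also have "\<dots> = (C + 2) * (K * D)" by (simp add: algebra_simps)
  finally show "cost (fill_table S N D K) \<le> (C + 2) * (K * D)" using c by linarith
qed

text \<open>Distinct columns hold distinct rows, so later iterations do not overwrite the powers of
  a pair.\<close>

lemma select_powers_correct:
  fixes T :: table
  assumes inj: "inj_on r {i\<in>{1..K}. r i \<noteq> 0}"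
  defines "X \<equiv> val (select_powers K T r)"
  shows "i \<in> {1..K} \<Longrightarrow> r i \<noteq> 0 \<Longrightarrow> (fst X (r i), snd X i) = snd (T (r i) i)"
    and "cost (select_powers K T r) \<le> K"
proof -
  define I where "I = (\<lambda>j X. \<forall>i\<in>{1..<j}. r i \<noteq> 0 \<longrightarrow>
     fst X (r i) = fst (snd (T (r i) i)) \<and> snd X i = snd (snd (T (r i) i)))"
  define f where "f = (\<lambda>i (PD, PU). ret
       (if r i = 0 then (PD, PU)
        else (PD(r i := fst (snd (T (r i) i))), PU(i := snd (snd (T (r i) i))))))"
  have "I (K+1) X \<and> cost (select_powers K T r) \<le> (K + 1 - 1) * Suc 0"
    unfolding X_def select_powers_def f_def[symmetric]
  proof (rule for_loop_upt[where I = I])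
    fix j Y assume j: "1 \<le> j" "j < K + 1" and Y: "I j Y"
    obtain PD PU where eq: "Y = (PD, PU)" by (cases Y)
    have "I (Suc j) (val (f j Y))"
      unfolding I_def
    proof (intro ballI impI)
      fix i assume i: "i \<in> {1..<Suc j}" "r i \<noteq> 0"
      show "fst (val (f j Y)) (r i) = fst (snd (T (r i) i)) \<and> snd (val (f j Y)) i = snd (snd (T (r i) i))"
      proof (cases "i = j")
        case True
        then show ?thesis using i by (simp add: f_def eq)
      next
        case False
        then have "r i \<noteq> r j" using inj_onD[OF inj, of i j] i j by auto
        then show ?thesis using Y i False by (auto simp: I_def f_def eq)
      qed
    qed
    then show "I (Suc j) (val (f j Y)) \<and> cost (f j Y) \<le> 0" by (simp add: f_def eq)
  qed (simp_all add: I_def)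
  then have I: "I (K+1) X" and c: "cost (select_powers K T r) \<le> K" by simp_all
  show "cost (select_powers K T r) \<le> K" by fact
  show "i \<in> {1..K} \<Longrightarrow> r i \<noteq> 0 \<Longrightarrow> (fst X (r i), snd X i) = snd (T (r i) i)"
    using I by (auto simp: I_def prod_eq_iff)
qed

lemma assignments_row_inj:
  assumes "A \<in> assignments D K" "n \<in> {1..D}" "i \<in> {1..K}" "i' \<in> {1..K}" "A n i = 1" "A n i' = 1"
  shows "i = i'"
proof (rule ccontr)
  assume "i \<noteq> i'"
  then have "(\<Sum>i\<in>{i, i'}. A n i) = 2" using assms by simp
  moreover have "(\<Sum>i\<in>{i, i'}. A n i) \<le> (\<Sum>i=1..K. A n i)"
    using assms by (intro sum_mono2) auto
  moreover have "(\<Sum>i=1..K. A n i) = 1" using assms by (auto simp: assignments_def)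
  ultimately show False by linarith
qed

text \<open>Because an assignment is a matching, the powers of the selected couples can be chosen
  independently.\<close>

lemma assignment_powers:
  fixes q :: "nat \<Rightarrow> nat \<Rightarrow> 'a \<times> 'b"
  assumes A: "A \<in> assignments D K"
  obtains PD PU where "\<And>n i. n \<in> {1..D} \<Longrightarrow> i \<in> {1..K} \<Longrightarrow> A n i = 1 \<Longrightarrow> (PD n, PU i) = q n i"
proof
  fix n i assume ni: "n \<in> {1..D}" "i \<in> {1..K}" "A n i = 1"
  have "(SOME i. i \<in> {1..K} \<and> A n i = 1) = i"
    using ni by (intro some_equality) (auto intro: assignments_row_inj[OF A])
  moreover have "(SOME n. n \<in> {1..D} \<and> A n i = 1) = n"
    using ni by (intro some_equality) (auto intro: assignments_column_inj[OF A])
  ultimately show "(fst (q n (SOME i. i \<in> {1..K} \<and> A n i = 1)), snd (q (SOME n. n \<in> {1..D} \<and> A n i = 1) i)) = q n i"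
    by simp
qed

lemma assignment_01: "A \<in> assignments D K \<Longrightarrow> n \<in> {1..D} \<Longrightarrow> i \<in> {1..K} \<Longrightarrow> A n i = 0 \<or> A n i = 1"
  by (auto simp: assignments_def)

section \<open>Separation of the joint problem\<close>

lemma joint_rate_assignment_rate:
  assumes A: "A \<in> assignments D K"
    and eq: "\<And>n i. n \<in> {1..D} \<Longrightarrow> i \<in> {1..K} \<Longrightarrow> A n i = 1 \<Longrightarrow>
      ereal (d2d_rate m (couple_of N n i) (PD n, PU i)) = R n i"
  shows "ereal (joint_rate m N D K (A, PD, PU)) = assignment_rate D K R A"
proof -
  have "ereal (joint_rate m N D K (A, PD, PU)) =
     (\<Sum>i=1..K. \<Sum>n=1..D. ereal (real (A n i)) * ereal (d2d_rate m (couple_of N n i) (PD n, PU i)))"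
    by simp
  also have "\<dots> = assignment_rate D K R A"
    unfolding assignment_rate_def
  proof (intro sum.cong refl)
    fix i n assume "i \<in> {1..K}" "n \<in> {1..D}"
    then show "ereal (real (A n i)) * ereal (d2d_rate m (couple_of N n i) (PD n, PU i)) = ereal (real (A n i)) * R n i"
      using assignment_01[OF A, of n i] eq[of n i] by (auto simp: zero_ereal_def[symmetric] simp del: times_ereal.simps)
  qed
  finally show ?thesis .
qed

context
  fixes m :: mode and N :: network and D K :: nat and R
  assumes valid: "valid_network N D K"
  defines "R \<equiv> \<lambda>n i. max_rate m (couple_of N n i)"
begin

lemma R_eq: "n \<in> {1..D} \<Longrightarrow> i \<in> {1..K} \<Longrightarrow>
    R n i = opt_value (feasible_powers m (couple_of N n i)) (d2d_rate m (couple_of N n i))"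
  unfolding R_def using valid by (intro max_rate_eq) (auto simp: valid_network_def)

lemma joint_rate_le:
  assumes "(A, PD, PU) \<in> joint_feasible m N D K"
  shows "ereal (joint_rate m N D K (A, PD, PU)) \<le> assignment_rate D K R A"
proof -
  have A: "A \<in> assignments D K" and f: "\<And>n i. n \<in> {1..D} \<Longrightarrow> i \<in> {1..K} \<Longrightarrow> A n i = 1 \<Longrightarrow>
      (PD n, PU i) \<in> feasible_powers m (couple_of N n i)"
    using assms by (auto simp: joint_feasible_def)
  define R' where "R' = (\<lambda>n i. ereal (d2d_rate m (couple_of N n i) (PD n, PU i)))"
  have "ereal (joint_rate m N D K (A, PD, PU)) = assignment_rate D K R' A"
    by (rule joint_rate_assignment_rate[OF A]) (simp add: R'_def)
  also have "\<dots> \<le> assignment_rate D K R A"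
    unfolding assignment_rate_def
  proof (intro sum_mono)
    fix i n assume ni: "i \<in> {1..K}" "n \<in> {1..D}"
    show "ereal (real (A n i)) * R' n i \<le> ereal (real (A n i)) * R n i"
    proof (cases "A n i = 1")
      case True
      have "R' n i \<le> R n i"
        unfolding R_eq[OF ni(2,1)] R'_def opt_value_def
        by (rule SUP_upper) (rule f[OF ni(2,1) True])
      then show ?thesis by (intro ereal_mult_left_mono) auto
    next
      case False
      then show ?thesis using assignment_01[OF A ni(2,1)] by (simp add: zero_ereal_def[symmetric])
    qed
  qed
  finally show ?thesis .
qed

text \<open>Suprema may not be attained, so the powers are chosen up to an error, independently for
  the selected couples.\<close>

lemma joint_value:
  assumes fin: "\<And>n i. n \<in> {1..D} \<Longrightarrow> i \<in> {1..K} \<Longrightarrow> R n i \<noteq> \<infinity>"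
  shows "opt_value (joint_feasible m N D K) (joint_rate m N D K) =
    (SUP A\<in>assignments D K. assignment_rate D K R A)"
proof (rule antisym)
  show "opt_value (joint_feasible m N D K) (joint_rate m N D K) \<le>
    (SUP A\<in>assignments D K. assignment_rate D K R A)"
    unfolding opt_value_def
  proof (rule SUP_least)
    fix x assume x: "x \<in> joint_feasible m N D K"
    obtain A PD PU where eq: "x = (A, PD, PU)" by (cases x rule: prod_cases3)
    then have "A \<in> assignments D K" using x by (simp add: joint_feasible_def)
    then have "assignment_rate D K R A \<le> (SUP A\<in>assignments D K. assignment_rate D K R A)"
      by (rule SUP_upper)
    then show "ereal (joint_rate m N D K x) \<le> (SUP A\<in>assignments D K. assignment_rate D K R A)"
      using joint_rate_le x eq order_trans by blast
  qed
  show "(SUP A\<in>assignments D K. assignment_rate D K R A) \<le>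
    opt_value (joint_feasible m N D K) (joint_rate m N D K)"
  proof (rule SUP_least)
    fix A assume A: "A \<in> assignments D K"
    show "assignment_rate D K R A \<le> opt_value (joint_feasible m N D K) (joint_rate m N D K)"
    \<comment> \<open>An assignment that selects an entry -\<infinity> has no feasible powers to
      compare with, but its own rate is -\<infinity>.\<close>
    proof (cases "\<exists>n\<in>{1..D}. \<exists>i\<in>{1..K}. A n i = 1 \<and> R n i = -\<infinity>")
      case True
      then obtain n0 i0 where "n0 \<in> {1..D}" "i0 \<in> {1..K}" "A n0 i0 = 1" "R n0 i0 = -\<infinity>" by blast
      then have "assignment_rate D K R A = -\<infinity>" by (intro assignment_rate_MInfty[OF fin])
      then show ?thesis by simp
    next
      case False
      define \<rho> where "\<rho> = (\<lambda>n i. real_of_ereal (R n i))"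
      have R: "R n i = ereal (\<rho> n i)" if "n \<in> {1..D}" "i \<in> {1..K}" "A n i = 1" for n i
        using that False fin[OF that(1,2)] unfolding \<rho>_def by (cases "R n i") auto
      show ?thesis
      proof (rule ereal_le_epsilon2)
        fix e :: real assume e: "0 < e"
        \<comment> \<open>An assignment selects \<open>D\<close> couples, so errors of
          \<open>d\<close> add up to at most \<open>e\<close>; the \<open>+ 1\<close> covers
          \<open>D = 0\<close>.\<close>
        define d where "d = e / (real D + 1)"
        have d: "0 < d" "d * real D \<le> e" using e by (simp_all add: d_def field_simps)
        have "\<exists>q. A n i = 1 \<longrightarrow> n \<in> {1..D} \<longrightarrow> i \<in> {1..K} \<longrightarrow>
          q \<in> feasible_powers m (couple_of N n i) \<and> \<rho> n i - d < d2d_rate m (couple_of N n i) q" for n i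
        proof (cases "A n i = 1 \<and> n \<in> {1..D} \<and> i \<in> {1..K}")
          case True
          then have "opt_value (feasible_powers m (couple_of N n i)) (d2d_rate m (couple_of N n i)) = ereal (\<rho> n i)"
            using R_eq[of n i] R[of n i] by simp
          then show ?thesis using d(1) unfolding opt_value_eq_ereal_iff by blast
        qed blast
        then obtain q where q: "\<And>n i. A n i = 1 \<Longrightarrow> n \<in> {1..D} \<Longrightarrow> i \<in> {1..K} \<Longrightarrow>
          q n i \<in> feasible_powers m (couple_of N n i) \<and> \<rho> n i - d < d2d_rate m (couple_of N n i) (q n i)"
          by metis
        obtain PD PU where pq: "\<And>n i. n \<in> {1..D} \<Longrightarrow> i \<in> {1..K} \<Longrightarrow> A n i = 1 \<Longrightarrow> (PD n, PU i) = q n i"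
          using assignment_powers[OF A, of q] by blast
        have feas: "(A, PD, PU) \<in> joint_feasible m N D K"
          using A pq q by (auto simp: joint_feasible_def)
        have "assignment_rate D K R A \<le> assignment_rate D K (\<lambda>n i. ereal (d2d_rate m (couple_of N n i) (PD n, PU i) + d)) A"
          unfolding assignment_rate_def
        proof (intro sum_mono)
          fix i n assume ni: "i \<in> {1..K}" "n \<in> {1..D}"
          show "ereal (real (A n i)) * R n i \<le> ereal (real (A n i)) * ereal (d2d_rate m (couple_of N n i) (PD n, PU i) + d)"
          proof (cases "A n i = 1")
            case True
            then show ?thesis
              using R[OF ni(2,1) True] q[OF True ni(2,1)] pq[OF ni(2,1) True] by simp
          next
            case False
            then show ?thesis using assignment_01[OF A ni(2,1)] by (simp add: zero_ereal_def[symmetric])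
          qed
        qed
        also have "\<dots> = ereal (\<Sum>i=1..K. \<Sum>n=1..D. real (A n i) * (d2d_rate m (couple_of N n i) (PD n, PU i) + d))"
          by (simp add: assignment_rate_def)
        also have "(\<Sum>i=1..K. \<Sum>n=1..D. real (A n i) * (d2d_rate m (couple_of N n i) (PD n, PU i) + d)) =
            joint_rate m N D K (A, PD, PU) + (\<Sum>i=1..K. \<Sum>n=1..D. d * real (A n i))"
          by (simp add: sum.distrib algebra_simps)
        also have "(\<Sum>i=1..K. \<Sum>n=1..D. d * real (A n i)) = (\<Sum>n=1..D. d * real (\<Sum>i=1..K. A n i))"
          by (subst sum.swap) (simp add: sum_distrib_left)
        also have "\<dots> = (\<Sum>n=1..D. d)"
          using A by (intro sum.cong refl) (simp add: assignments_def del: of_nat_sum)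
        also have "\<dots> = d * real D" by (simp add: mult.commute)
        finally have "assignment_rate D K R A \<le> ereal (joint_rate m N D K (A, PD, PU) + d * real D)" .
        also have "\<dots> \<le> ereal (joint_rate m N D K (A, PD, PU)) + ereal e" using d(2) by simp
        also have "\<dots> \<le> opt_value (joint_feasible m N D K) (joint_rate m N D K) + ereal e"
          unfolding opt_value_def by (intro add_right_mono SUP_upper feas)
        finally show "assignment_rate D K R A \<le> opt_value (joint_feasible m N D K) (joint_rate m N D K) + ereal e" .
      qed
    qed
  qed
qed

lemma joint_optimalI:
  assumes opt: "assignment_optimal D K R A"
    and sel: "\<And>n i. n \<in> {1..D} \<Longrightarrow> i \<in> {1..K} \<Longrightarrow> A n i = 1 \<Longrightarrow>
      (PD n, PU i) \<in> feasible_powers m (couple_of N n i) \<and>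
      ereal (d2d_rate m (couple_of N n i) (PD n, PU i)) = R n i"
  shows "joint_optimal m N D K (A, PD, PU)"
proof -
  have A: "A \<in> assignments D K" and max: "\<And>A'. A' \<in> assignments D K \<Longrightarrow>
      assignment_rate D K R A' \<le> assignment_rate D K R A"
    using opt by (auto simp: is_arg_max_def not_less)
  have "(A, PD, PU) \<in> joint_feasible m N D K" using A sel by (auto simp: joint_feasible_def)
  moreover have "joint_rate m N D K x \<le> joint_rate m N D K (A, PD, PU)" if x: "x \<in> joint_feasible m N D K" for x
  proof -
    obtain A' PD' PU' where eq: "x = (A', PD', PU')" by (cases x rule: prod_cases3)
    have "A' \<in> assignments D K" using x eq by (simp add: joint_feasible_def)
    then have "ereal (joint_rate m N D K x) \<le> assignment_rate D K R A"
      using joint_rate_le[of A' PD' PU'] x max[of A'] unfolding eq by (blast intro: order_trans)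
    also have "\<dots> = ereal (joint_rate m N D K (A, PD, PU))"
      by (rule joint_rate_assignment_rate[OF A, symmetric]) (use sel in blast)
    finally show ?thesis by simp
  qed
  ultimately show ?thesis by (auto simp: is_arg_max_def not_less)
qed

end

text \<open>The solver and the constants are chosen before the network and its size, which makes the
  bounds genuine complexity statements. Where suprema are not attained, optimality of the output
  means equality of the values together with powers in the closure.\<close>

theorem mainTheorem8:
  fixes m :: mode
  shows "\<exists>S C0 C1 C2 C3.
    (\<forall>c. valid_couple c \<longrightarrow> is_solution m c (val (solve S c)) \<and> cost (solve S c) \<le> C0) \<and>
    (\<forall>(N :: network) (D :: nat) (K :: nat). D \<ge> 1 \<and> K \<ge> 1 \<and> valid_network N D K \<longrightarrow>
      (let R = (\<lambda>n i. max_rate m (couple_of N n i)) in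
        opt_value (joint_feasible m N D K) (joint_rate m N D K) =
          (SUP A\<in>assignments D K. assignment_rate D K R A) \<and>
        (\<forall>A PD PU. assignment_optimal D K R A \<and>
           (\<forall>n\<in>{1..D}. \<forall>i\<in>{1..K}. A n i = 1 \<longrightarrow>
              (PD n, PU i) \<in> feasible_powers m (couple_of N n i) \<and>
              ereal (d2d_rate m (couple_of N n i) (PD n, PU i)) = R n i)
           \<longrightarrow> joint_optimal m N D K (A, PD, PU)) \<and>
        (\<forall>n\<in>{1..D}. \<forall>i\<in>{1..K}. fst (val (fill_table S N D K) n i) = R n i) \<and>
        cost (fill_table S N D K) \<le> C1 * (K * D) \<and>
        (case val (hungarian D K (\<lambda>n i. - R n i)) of
           None \<Rightarrow> \<forall>A\<in>assignments D K. assignment_rate D K R A = -\<infinity>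
         | Some r \<Rightarrow> assignment_optimal D K R (matrix_of r)) \<and>
        cost (hungarian D K (\<lambda>n i. - R n i)) \<le> C2 * (D\<^sup>2 * K) \<and>
        (case val (two_step S N D K) of
           None \<Rightarrow> joint_feasible m N D K = {}
         | Some (A, PD, PU) \<Rightarrow>
             assignment_optimal D K R A \<and>
             ereal (joint_rate m N D K (A, PD, PU)) =
               opt_value (joint_feasible m N D K) (joint_rate m N D K) \<and>
             (\<forall>n\<in>{1..D}. \<forall>i\<in>{1..K}. A n i = 1 \<longrightarrow>
                (PD n, PU i) \<in> closure (feasible_powers m (couple_of N n i))) \<and>
             ((\<forall>n\<in>{1..D}. \<forall>i\<in>{1..K}. A n i = 1 \<longrightarrow>
                 (\<exists>q\<in>feasible_powers m (couple_of N n i).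
                    ereal (d2d_rate m (couple_of N n i) q) = R n i))
              \<longrightarrow> joint_optimal m N D K (A, PD, PU)) \<and>
             (m \<in> {FD_NoSIC, HD_NoSIC} \<longrightarrow> joint_optimal m N D K (A, PD, PU))) \<and>
        cost (two_step S N D K) \<le> C3 * (D\<^sup>2 * K)))"
proof -
  obtain S C where C: "\<And>c. cost (solve S c) \<le> C"
    and sol: "\<And>c. valid_couple c \<Longrightarrow> is_solution m c (val (solve S c))"
    and mem: "\<And>c r p. valid_couple c \<Longrightarrow> m \<in> {FD_NoSIC, HD_NoSIC} \<Longrightarrow> val (solve S c) = Some (r, p) \<Longrightarrow>
      p \<in> feasible_powers m c"
    using solver_exists[of m] by blast
  show ?thesis
  \<comment> \<open>\<open>C + 15\<close> is \<open>C + 2\<close> for the table, 12 for the matching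
    and 1 for reading off the powers.\<close>
  proof (rule exI[of _ S], rule exI[of _ C], rule exI[of _ "C + 2"], rule exI[of _ 12],
      rule exI[of _ "C + 15"], intro conjI allI impI, goal_cases)
    case (1 c)
    then show ?case by (rule sol)
  next
    case (2 c)
    show ?case by (rule C)
  next
    case (3 N D K)
    then have D: "1 \<le> D" and K: "1 \<le> K" and valid: "valid_network N D K" by auto
    define R where "R = (\<lambda>n i. max_rate m (couple_of N n i))"
    define T where "T = val (fill_table S N D K)"
    have c: "valid_couple (couple_of N n i)" if "n \<in> {1..D}" "i \<in> {1..K}" for n i
      using valid that by (simp add: valid_network_def)
    \<comment> \<open>The guarantees of the solver and of the table, merged for one couple: a finite
      entry with its powers, or an infeasible couple.\<close>
    have entry: "(\<exists>r p. T n i = (ereal r, p) \<and> R n i = ereal r \<and> p \<in> closure (feasible_powers m (couple_of N n i)) \<and>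
         d2d_rate m (couple_of N n i) p = r \<and>
         ((\<exists>q\<in>feasible_powers m (couple_of N n i). d2d_rate m (couple_of N n i) q = r) \<or>
           m \<in> {FD_NoSIC, HD_NoSIC} \<longrightarrow> p \<in> feasible_powers m (couple_of N n i))) \<or>
       (fst (T n i) = -\<infinity> \<and> R n i = -\<infinity> \<and> feasible_powers m (couple_of N n i) = {})"
      if ni: "n \<in> {1..D}" "i \<in> {1..K}" for n i
      using sol[OF c[OF ni]] mem[OF c[OF ni]] fill_table_correct(1)[OF C ni, of N]
      unfolding is_solution_def T_def[symmetric] R_def
      by (cases "val (solve S (couple_of N n i))") (auto simp: table_entry_def)
    have fstT: "fst (T n i) = R n i" if "n \<in> {1..D}" "i \<in> {1..K}" for n i
      using entry[OF that] by auto
    have fin: "R n i \<noteq> \<infinity>" if "n \<in> {1..D}" "i \<in> {1..K}" for n i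
      using entry[OF that] by auto
    have infeasible: "feasible_powers m (couple_of N n i) = {}"
      if "n \<in> {1..D}" "i \<in> {1..K}" "R n i = -\<infinity>" for n i
      using entry[OF that(1,2)] that(3) by auto
    \<comment> \<open>The matrix that \<open>two_step\<close> hands to the algorithm. It agrees with
      the negated rates on the index range; outside of it the two may differ, so the correctness of
      the algorithm is used for both.\<close>
    define a where "a = (\<lambda>n i. - fst (T n i))"
    have a: "a n i = - R n i" "a n i \<noteq> -\<infinity>" if "n \<in> {1..D}" "i \<in> {1..K}" for n i
      using fstT[OF that] fin[OF that] by (auto simp: a_def)
    have a': "- R n i \<noteq> -\<infinity>" if "n \<in> {1..D}" "i \<in> {1..K}" for n i
      using fin[OF that] by simp
    have value_eq: "opt_value (joint_feasible m N D K) (joint_rate m N D K) =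
        (SUP A\<in>assignments D K. assignment_rate D K R A)"
      using joint_value[OF valid, of m] fin unfolding R_def by blast
    have hunR: "case val (hungarian D K (\<lambda>n i. - R n i)) of None \<Rightarrow> no_finite D K (\<lambda>n i. - R n i)
        | Some r \<Rightarrow> \<exists>s. opt_inv K (\<lambda>n i. - R n i) D s \<and> mate s = r"
      "cost (hungarian D K (\<lambda>n i. - R n i)) \<le> 12 * (D\<^sup>2 * K)"
      by (rule hungarian_correct; use a' D K in simp)+
    have opt: "joint_optimal m N D K (A, PD, PU)"
      if "assignment_optimal D K R A" and "\<And>n i. n \<in> {1..D} \<Longrightarrow> i \<in> {1..K} \<Longrightarrow> A n i = 1 \<Longrightarrow>
        (PD n, PU i) \<in> feasible_powers m (couple_of N n i) \<and>
        ereal (d2d_rate m (couple_of N n i) (PD n, PU i)) = R n i" for A PD PU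
      by (rule joint_optimalI[OF valid]) (use that in \<open>simp_all only: R_def\<close>)
    have step2: "case val (hungarian D K (\<lambda>n i. - R n i)) of
           None \<Rightarrow> \<forall>A\<in>assignments D K. assignment_rate D K R A = -\<infinity>
         | Some r \<Rightarrow> assignment_optimal D K R (matrix_of r)"
    proof (cases "val (hungarian D K (\<lambda>n i. - R n i))")
      case None
      then have "no_finite D K (\<lambda>n i. - R n i)" using hunR(1) by simp
      then have "assignment_rate D K R A = -\<infinity>" if "A \<in> assignments D K" for A
        using that fin by (intro no_finite_rate) auto
      then show ?thesis using None by simp
    next
      case (Some r)
      then obtain s where "opt_inv K (\<lambda>n i. - R n i) D s" "mate s = r"
        using hunR(1) by auto
      then show ?thesis using opt_inv_optimal(1)[of K "\<lambda>n i. - R n i" D s R] Some by simp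
    qed
    have two: "two_step S N D K = bind_timed (fill_table S N D K) (\<lambda>T. bind_timed (hungarian D K (\<lambda>n i. - fst (T n i)))
      (\<lambda>r. case r of None \<Rightarrow> ret None
        | Some r \<Rightarrow> bind_timed (select_powers K T r) (\<lambda>(PD, PU). ret (Some (matrix_of r, PD, PU)))))"
      unfolding two_step_def ..
    have two_None: "val (two_step S N D K) = None" "cost (two_step S N D K) = cost (fill_table S N D K) + cost (hungarian D K a)"
      if "val (hungarian D K a) = None"
      using that by (simp_all add: two T_def[symmetric] a_def[symmetric])
    have two_Some: "val (two_step S N D K) = Some (matrix_of r, fst (val (select_powers K T r)), snd (val (select_powers K T r)))"
      "cost (two_step S N D K) = cost (fill_table S N D K) + cost (hungarian D K a) + cost (select_powers K T r)"
      if "val (hungarian D K a) = Some r" for r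
      using that by (simp_all add: two T_def[symmetric] a_def[symmetric] split: prod.split)
    note hun = hungarian_correct[of D K a, OF a(2)]
    have r: "\<exists>s. opt_inv K a D s \<and> mate s = r" if "val (hungarian D K a) = Some r" for r
      using hun(1) that by simp
    have inj: "inj_on r {i\<in>{1..K}. r i \<noteq> 0}" if "val (hungarian D K a) = Some r" for r
      using r[OF that] by (auto simp: opt_inv_def matching_def bij_betw_def)
    have costs: "cost (fill_table S N D K) \<le> (C + 2) * (K * D)" "cost (hungarian D K a) \<le> 12 * (D\<^sup>2 * K)"
      using fill_table_correct(2)[OF C K] hun(2) D K by auto
    have "cost (two_step S N D K) \<le> (C + 2) * (K * D) + 12 * (D\<^sup>2 * K) + K"
    proof (cases "val (hungarian D K a)")
      case None
      show ?thesis using costs two_None(2)[OF None] by linarith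
    next
      case (Some r)
      show ?thesis
        using costs two_Some(2)[OF Some] select_powers_correct(2)[OF inj[OF Some], of T] by linarith
    qed
    also have "\<dots> \<le> (C + 15) * (D\<^sup>2 * K)"
    proof -
      have KD: "K * D \<le> D\<^sup>2 * K" "K \<le> 1 * (D\<^sup>2 * K)" using D by (simp_all add: power2_eq_square)
      have "(C + 2) * (K * D) + 12 * (D\<^sup>2 * K) + K \<le> (C + 2) * (D\<^sup>2 * K) + 12 * (D\<^sup>2 * K) + 1 * (D\<^sup>2 * K)"
        using mult_le_mono2[OF KD(1), of "C + 2"] KD(2) by linarith
      also have "\<dots> = (C + 15) * (D\<^sup>2 * K)" by (simp add: algebra_simps)
      finally show ?thesis .
    qed
    finally have cost: "cost (two_step S N D K) \<le> (C + 15) * (D\<^sup>2 * K)" .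
    have result: "case val (two_step S N D K) of
           None \<Rightarrow> joint_feasible m N D K = {}
         | Some (A, PD, PU) \<Rightarrow>
             assignment_optimal D K R A \<and>
             ereal (joint_rate m N D K (A, PD, PU)) =
               opt_value (joint_feasible m N D K) (joint_rate m N D K) \<and>
             (\<forall>n\<in>{1..D}. \<forall>i\<in>{1..K}. A n i = 1 \<longrightarrow>
                (PD n, PU i) \<in> closure (feasible_powers m (couple_of N n i))) \<and>
             ((\<forall>n\<in>{1..D}. \<forall>i\<in>{1..K}. A n i = 1 \<longrightarrow>
                 (\<exists>q\<in>feasible_powers m (couple_of N n i).
                    ereal (d2d_rate m (couple_of N n i) q) = R n i))
              \<longrightarrow> joint_optimal m N D K (A, PD, PU)) \<and>
             (m \<in> {FD_NoSIC, HD_NoSIC} \<longrightarrow> joint_optimal m N D K (A, PD, PU))"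
    proof (cases "val (hungarian D K a)")
      case None
      then have nf: "no_finite D K a" using hun(1) by simp
      \<comment> \<open>Every assignment selects a couple of infinite cost, and such a couple admits
        no powers at all.\<close>
      have "(A, PD, PU) \<notin> joint_feasible m N D K" for A PD PU
      proof
        assume j: "(A, PD, PU) \<in> joint_feasible m N D K"
        then have "A \<in> assignments D K" by (simp add: joint_feasible_def)
        then obtain n i where ni: "n \<in> {1..D}" "i \<in> {1..K}" "A n i = 1" "a n i = \<infinity>"
          using nf unfolding no_finite_def by blast
        then have "R n i = -\<infinity>" using a(1)[OF ni(1,2)] by (cases "R n i") auto
        then have "feasible_powers m (couple_of N n i) = {}" by (rule infeasible[OF ni(1,2)])
        moreover have "(PD n, PU i) \<in> feasible_powers m (couple_of N n i)"
          using j ni(1-3) unfolding joint_feasible_def by blast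
        ultimately show False by blast
      qed
      then show ?thesis using two_None(1)[OF None] by auto
    next
      case (Some r)
      obtain s where s: "opt_inv K a D s" "mate s = r" using r[OF Some] by blast
      define A where "A = matrix_of r"
      obtain PD PU where X: "val (select_powers K T r) = (PD, PU)" by fastforce
      have A: "assignment_optimal D K R A"
        unfolding A_def s(2)[symmetric] by (rule opt_inv_optimal(1)[OF s(1)]) (rule a(1))
      have sel: "(PD n, PU i) \<in> closure (feasible_powers m (couple_of N n i))"
        "ereal (d2d_rate m (couple_of N n i) (PD n, PU i)) = R n i"
        "(\<exists>q\<in>feasible_powers m (couple_of N n i). ereal (d2d_rate m (couple_of N n i) q) = R n i) \<or>
           m \<in> {FD_NoSIC, HD_NoSIC} \<Longrightarrow> (PD n, PU i) \<in> feasible_powers m (couple_of N n i)"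
        if ni: "n \<in> {1..D}" "i \<in> {1..K}" "A n i = 1" for n i
      proof -
        have ri: "r i = n" using ni(3) by (simp add: A_def matrix_of_def split: if_splits)
        \<comment> \<open>Finiteness of a selected entry excludes the infeasible alternative of
          \<open>entry\<close>.\<close>
        then have "\<bar>R n i\<bar> \<noteq> \<infinity>"
          by (intro opt_inv_optimal(2)[OF s(1)]) (use a(1) s(2) ni in auto)
        moreover have "(PD n, PU i) = snd (T n i)"
          using select_powers_correct(1)[OF inj[OF Some] ni(2), of T] ri ni(1) by (simp add: X)
        ultimately show "(PD n, PU i) \<in> closure (feasible_powers m (couple_of N n i))"
          "ereal (d2d_rate m (couple_of N n i) (PD n, PU i)) = R n i"
          "(\<exists>q\<in>feasible_powers m (couple_of N n i). ereal (d2d_rate m (couple_of N n i) q) = R n i) \<or>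
           m \<in> {FD_NoSIC, HD_NoSIC} \<Longrightarrow> (PD n, PU i) \<in> feasible_powers m (couple_of N n i)"
          using entry[OF ni(1,2)] by auto
      qed
      have Aa: "A \<in> assignments D K" using A by (simp add: is_arg_max_def)
      have "ereal (joint_rate m N D K (A, PD, PU)) = assignment_rate D K R A"
        by (rule joint_rate_assignment_rate[OF Aa sel(2)])
      also have "\<dots> = (SUP A\<in>assignments D K. assignment_rate D K R A)"
        using A by (intro antisym SUP_upper SUP_least Aa) (auto simp: is_arg_max_def not_less)
      finally have "ereal (joint_rate m N D K (A, PD, PU)) =
          opt_value (joint_feasible m N D K) (joint_rate m N D K)" using value_eq by simp
      moreover have "joint_optimal m N D K (A, PD, PU)"
        if "\<And>n i. n \<in> {1..D} \<Longrightarrow> i \<in> {1..K} \<Longrightarrow> A n i = 1 \<Longrightarrow>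
          (\<exists>q\<in>feasible_powers m (couple_of N n i). ereal (d2d_rate m (couple_of N n i) q) = R n i) \<or>
           m \<in> {FD_NoSIC, HD_NoSIC}"
      proof (rule opt[OF A])
        fix n i assume ni: "n \<in> {1..D}" "i \<in> {1..K}" "A n i = 1"
        show "(PD n, PU i) \<in> feasible_powers m (couple_of N n i) \<and>
          ereal (d2d_rate m (couple_of N n i) (PD n, PU i)) = R n i"
          using sel(2,3)[OF ni] that[OF ni] by blast
      qed
      ultimately show ?thesis
        unfolding two_Some(1)[OF Some] X fst_conv snd_conv option.case prod.case A_def[symmetric]
        using A sel(1) by blast
    qed
    have opt': "\<forall>A PD PU. assignment_optimal D K R A \<and>
           (\<forall>n\<in>{1..D}. \<forall>i\<in>{1..K}. A n i = 1 \<longrightarrow>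
              (PD n, PU i) \<in> feasible_powers m (couple_of N n i) \<and>
              ereal (d2d_rate m (couple_of N n i) (PD n, PU i)) = R n i)
           \<longrightarrow> joint_optimal m N D K (A, PD, PU)"
      by (intro allI impI opt) blast+
    have fst': "\<forall>n\<in>{1..D}. \<forall>i\<in>{1..K}. fst (val (fill_table S N D K) n i) = R n i"
      using fstT unfolding T_def by blast
    show ?case
      unfolding Let_def R_def[symmetric]
      by (intro conjI value_eq opt' fst' costs(1) step2 hunR(2) result cost)
  qed
qed

end
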